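(* Let $\mathsf{A}$ be an abelian category, $\mathsf{V}$ a special preenveloping subcategory of $\mathsf{A}$ and $\mathsf{W}$ a special precovering subcategory of $\mathsf{A}$. Let $M$ and $N$ be objects in $\mathsf{A}$. For each $n\in\mathbb{Z}$ there exist natural isomorphisms $$\check{\operatorname{Ext}}{}^{n}_{\mathsf{V}}(M,N)\cong\operatorname{colim}_i\operatorname{Ext}^1_{\mathsf{A}}(\mathsf{\Theta}^{i+1}_{\mathsf{V}}M,\mathsf{\Theta}^{i+n}_{\mathsf{V}}N)\cong\operatorname{colim}_i\mathrm{S}^{-1}_{\mathsf{V}}\operatorname{Ext}^1_{\mathsf{A}}(\mathsf{\Theta}^{i}_{\mathsf{V}}M,\mathsf{\Theta}^{i+n}_{\mathsf{V}}N)$$ and $$\widehat{\operatorname{Ext}}{}^{n}_{\mathsf{W}}(M,N)\cong\operatorname{colim}_i\operatorname{Ext}^1_{\mathsf{A}}(\mathsf{\Omega}^{\mathsf{W}}_{i+n}M,\mathsf{\Omega}^{\mathsf{W}}_{i+1}N)\cong\operatorname{colim}_i\mathrm{S}^{-1}_{\mathsf{W}}\operatorname{Ext}^1_{\mathsf{A}}(\mathsf{\Omega}^{\mathsf{W}}_{i+n}M,\mathsf{\Omega}^{\mathsf{W}}_{i}N).$$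
   Context: "Subcategory" means a full additive subcategory closed under isomorphisms; Ext is Yoneda Ext. ${}^{\perp}\mathsf{V}=\{M\mid\operatorname{Ext}^1_{\mathsf{A}}(M,V)=0\ \forall V\in\mathsf{V}\}$, $\mathsf{W}^{\perp}=\{N\mid\operatorname{Ext}^1_{\mathsf{A}}(W,N)=0\ \forall W\in\mathsf{W}\}$. A special $\mathsf{V}$-preenvelope of $M$ is an exact sequence $0\to M\to V\to C\to0$ with $V\in\mathsf{V}$, $C\in{}^{\perp}\mathsf{V}$; a special $\mathsf{W}$-precover of $M$ is an exact sequence $0\to K\to W\to M\to0$ with $W\in\mathsf{W}$, $K\in\mathsf{W}^{\perp}$. $\mathsf{V}$ is special preenveloping (resp. $\mathsf{W}$ special precovering) if every object has a special $\mathsf{V}$-preenvelope (resp. special $\mathsf{W}$-precover). A special proper $\mathsf{V}$-coresolution of $M$ is an exact sequence $0\to M\to I^0\to I^1\to\cdots$ with $I^j\in\mathsf{V}$, staying exact under $\operatorname{Hom}_{\mathsf{A}}(-,V)$ for all $V\in\mathsf{V}$, with $\mathsf{\Theta}^i_{\mathsf{V}}M:=\operatorname{Ker}(I^i\to I^{i+1})\in{}^{\perp}\mathsf{V}$ for $i\ge1$; $\mathsf{\Theta}^0_{\mathsf{V}}M=M$, $\mathsf{\Theta}_{\mathsf{V}}=\mathsf{\Theta}^1_{\mathsf{V}}$. A special proper $\mathsf{W}$-resolution of $M$ is an exact sequence $\cdots\to P_1\to P_0\to M\to0$ with $P_j\in\mathsf{W}$, staying exact under $\operatorname{Hom}_{\mathsf{A}}(W,-)$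 for all $W\in\mathsf{W}$, with $\mathsf{\Omega}^{\mathsf{W}}_iM:=\operatorname{Coker}(P_{i+1}\to P_i)\in\mathsf{W}^{\perp}$ for $i\ge1$; $\mathsf{\Omega}_0^{\mathsf{W}}M=M$, $\mathsf{\Omega}^{\mathsf{W}}=\mathsf{\Omega}_1^{\mathsf{W}}$. Both exist for every object; fix choices. $\overline{\operatorname{Hom}}{}^{\mathsf{V}}_{\mathsf{A}}(M,N)$ (resp. $\underline{\operatorname{Hom}}{}^{\mathsf{W}}_{\mathsf{A}}(M,N)$) is $\operatorname{Hom}_{\mathsf{A}}(M,N)$ modulo morphisms factoring through an object of $\mathsf{V}$ (resp. $\mathsf{W}$). $\mathsf{V}$-case maps. With special $\mathsf{V}$-preenvelopes $0\to M\to I^0\to\mathsf{\Theta}_{\mathsf{V}}M\to0$ and $0\to N\to J^0\to\mathsf{\Theta}_{\mathsf{V}}N\to0$, the connecting morphism $\operatorname{Hom}_{\mathsf{A}}(M,N)\to\operatorname{Ext}^1_{\mathsf{A}}(\mathsf{\Theta}_{\mathsf{V}}M,N)$ induces a monomorphism $\overline{\delta}\colon\overline{\operatorname{Hom}}{}^{\mathsf{V}}_{\mathsf{A}}(M,N)\to\operatorname{Ext}^1_{\mathsf{A}}(\mathsf{\Theta}_{\mathsf{V}}M,N)$; the connecting morphism $\partial\colon\operatorname{Hom}_{\mathsf{A}}(\mathsf{\Theta}_{\mathsf{V}}M,\mathsf{\Theta}_{\mathsf{V}}N)\to\operatorname{Ext}^1_{\mathsf{A}}(\mathsf{\Theta}_{\mathsf{V}}M,N)$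 is epi and there is a unique $\beta\colon\operatorname{Ext}^1_{\mathsf{A}}(\mathsf{\Theta}_{\mathsf{V}}M,N)\to\overline{\operatorname{Hom}}{}^{\mathsf{V}}_{\mathsf{A}}(\mathsf{\Theta}_{\mathsf{V}}M,\mathsf{\Theta}_{\mathsf{V}}N)$ with $\beta\partial$ the canonical projection. Put $\Delta=\beta\overline{\delta}$ and $\Psi=\overline{\delta}\beta\colon\operatorname{Ext}^1_{\mathsf{A}}(\mathsf{\Theta}_{\mathsf{V}}M,N)\to\operatorname{Ext}^1_{\mathsf{A}}(\mathsf{\Theta}^2_{\mathsf{V}}M,\mathsf{\Theta}_{\mathsf{V}}N)$ (here $\overline\delta$ is taken for the pair $\mathsf{\Theta}_{\mathsf{V}}M,\mathsf{\Theta}_{\mathsf{V}}N$). Let $\mathrm{S}^{-1}_{\mathsf{V}}\operatorname{Ext}^1_{\mathsf{A}}(M,N)=\operatorname{Ker}(\operatorname{Ext}^1_{\mathsf{A}}(\mathsf{\Theta}_{\mathsf{V}}M,N)\to\operatorname{Ext}^1_{\mathsf{A}}(I^0,N))$ (the first left satellite of $\operatorname{Ext}^1_{\mathsf{A}}(-,N)$ at $M$), with inclusion $\iota$; $\Psi$ takes values in $\mathrm{S}^{-1}_{\mathsf{V}}\operatorname{Ext}^1_{\mathsf{A}}(\mathsf{\Theta}_{\mathsf{V}}M,\mathsf{\Theta}_{\mathsf{V}}N)$, and $\Psi\iota$ gives $\Phi\colon\mathrm{S}^{-1}_{\mathsf{V}}\operatorname{Ext}^1_{\mathsf{A}}(M,N)\to\mathrm{S}^{-1}_{\mathsf{V}}\operatorname{Ext}^1_{\mathsf{A}}(\mathsf{\Theta}_{\mathsf{V}}M,\mathsf{\Theta}_{\mathsf{V}}N)$.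 Iterating, $\Delta,\Psi,\Phi$ are the transition maps, over integers $i\ge\max\{0,-n\}$, of the direct systems $\{\overline{\operatorname{Hom}}{}^{\mathsf{V}}_{\mathsf{A}}(\mathsf{\Theta}^i_{\mathsf{V}}M,\mathsf{\Theta}^{i+n}_{\mathsf{V}}N)\}$, $\{\operatorname{Ext}^1_{\mathsf{A}}(\mathsf{\Theta}^{i+1}_{\mathsf{V}}M,\mathsf{\Theta}^{i+n}_{\mathsf{V}}N)\}$, $\{\mathrm{S}^{-1}_{\mathsf{V}}\operatorname{Ext}^1_{\mathsf{A}}(\mathsf{\Theta}^{i}_{\mathsf{V}}M,\mathsf{\Theta}^{i+n}_{\mathsf{V}}N)\}$, and $\check{\operatorname{Ext}}{}^{n}_{\mathsf{V}}(M,N)$ is defined as the colimit of the first. $\mathsf{W}$-case maps (dual). With special $\mathsf{W}$-precovers $0\to\mathsf{\Omega}^{\mathsf{W}}M\to P_0\to M\to0$, $0\to\mathsf{\Omega}^{\mathsf{W}}N\to Q_0\to N\to0$, there are a monomorphism $\overline{\delta}\colon\underline{\operatorname{Hom}}{}^{\mathsf{W}}_{\mathsf{A}}(M,N)\to\operatorname{Ext}^1_{\mathsf{A}}(M,\mathsf{\Omega}^{\mathsf{W}}N)$ induced by the connecting morphism, an epic connecting morphism $\partial\colon\operatorname{Hom}_{\mathsf{A}}(\mathsf{\Omega}^{\mathsf{W}}M,\mathsf{\Omega}^{\mathsf{W}}N)\to\operatorname{Ext}^1_{\mathsf{A}}(M,\mathsf{\Omega}^{\mathsf{W}}N)$, and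 a unique $\beta\colon\operatorname{Ext}^1_{\mathsf{A}}(M,\mathsf{\Omega}^{\mathsf{W}}N)\to\underline{\operatorname{Hom}}{}^{\mathsf{W}}_{\mathsf{A}}(\mathsf{\Omega}^{\mathsf{W}}M,\mathsf{\Omega}^{\mathsf{W}}N)$ with $\beta\partial$ the canonical projection. $\mathrm{S}^{-1}_{\mathsf{W}}\operatorname{Ext}^1_{\mathsf{A}}(M,N)=\operatorname{Ker}(\operatorname{Ext}^1_{\mathsf{A}}(M,\mathsf{\Omega}^{\mathsf{W}}N)\to\operatorname{Ext}^1_{\mathsf{A}}(M,Q_0))$. The transition maps are $\beta\overline{\delta}$, $\overline{\delta}\beta$, and the restriction of $\overline{\delta}\beta$ to the satellites, over integers $i\ge\max\{0,-n\}$, and $\widehat{\operatorname{Ext}}{}^{n}_{\mathsf{W}}(M,N)=\operatorname{colim}_i\underline{\operatorname{Hom}}{}^{\mathsf{W}}_{\mathsf{A}}(\mathsf{\Omega}^{\mathsf{W}}_{i+n}M,\mathsf{\Omega}^{\mathsf{W}}_iN)$. *)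

theory Defs
  imports "HOL-Algebra.Coset"
begin

section \<open>Abelian categories\<close>

text \<open>
  A category is given by a set of objects and a set of arrows with domain and codomain;
  \<open>Cmp A g f\<close> is the composite \<open>g \<circ> f\<close>, meaningful when \<open>Cod A f = Dom A g\<close>.
  All fields are only relevant on \<open>Obj A\<close> and on (composable, respectively parallel) arrows in
  \<open>Arr A\<close>.
\<close>

record ('o, 'a) additive_data =
  Obj :: "'o set"
  Arr :: "'a set"
  Dom :: "'a \<Rightarrow> 'o"
  Cod :: "'a \<Rightarrow> 'o"
  Id :: "'o \<Rightarrow> 'a"
  Cmp :: "'a \<Rightarrow> 'a \<Rightarrow> 'a"
  Plus :: "'a \<Rightarrow> 'a \<Rightarrow> 'a"
  Zero :: "'o \<Rightarrow> 'o \<Rightarrow> 'a"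

definition Hom :: "('o, 'a) additive_data \<Rightarrow> 'o \<Rightarrow> 'o \<Rightarrow> 'a set" where
  "Hom A X Y = {f \<in> Arr A. Dom A f = X \<and> Cod A f = Y}"

text \<open>
  Abelian groups are written as commutative groups in the (multiplicative) sense of HOL-Algebra:
  \<open>\<otimes>\<close> is addition and \<open>\<one>\<close> is zero.
\<close>

definition Hom_group :: "('o, 'a) additive_data \<Rightarrow> 'o \<Rightarrow> 'o \<Rightarrow> 'a monoid" where
  "Hom_group A X Y = \<lparr>carrier = Hom A X Y, mult = Plus A, one = Zero A X Y\<rparr>"

locale category =
  fixes A :: "('o, 'a) additive_data"
  assumes Dom_closed: "f \<in> Arr A \<Longrightarrow> Dom A f \<in> Obj A"
    and Cod_closed: "f \<in> Arr A \<Longrightarrow> Cod A f \<in> Obj A"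
    and Id_closed: "X \<in> Obj A \<Longrightarrow> Id A X \<in> Hom A X X"
    and Cmp_closed: "\<lbrakk>f \<in> Hom A X Y; g \<in> Hom A Y Z\<rbrakk> \<Longrightarrow> Cmp A g f \<in> Hom A X Z"
    and Cmp_Id_right: "f \<in> Hom A X Y \<Longrightarrow> Cmp A f (Id A X) = f"
    and Cmp_Id_left: "f \<in> Hom A X Y \<Longrightarrow> Cmp A (Id A Y) f = f"
    and Cmp_assoc: "\<lbrakk>f \<in> Hom A X Y; g \<in> Hom A Y Z; h \<in> Hom A Z W\<rbrakk>
      \<Longrightarrow> Cmp A (Cmp A h g) f = Cmp A h (Cmp A g f)"

locale preadditive_category = category +
  assumes Hom_comm_group: "\<lbrakk>X \<in> Obj A; Y \<in> Obj A\<rbrakk> \<Longrightarrow> comm_group (Hom_group A X Y)"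
    and Cmp_Plus_left: "\<lbrakk>f \<in> Hom A X Y; g \<in> Hom A Y Z; h \<in> Hom A Y Z\<rbrakk>
      \<Longrightarrow> Cmp A (Plus A g h) f = Plus A (Cmp A g f) (Cmp A h f)"
    and Cmp_Plus_right: "\<lbrakk>f \<in> Hom A X Y; g \<in> Hom A X Y; h \<in> Hom A Y Z\<rbrakk>
      \<Longrightarrow> Cmp A h (Plus A f g) = Plus A (Cmp A h f) (Cmp A h g)"

definition is_zero_object :: "('o, 'a) additive_data \<Rightarrow> 'o \<Rightarrow> bool" where
  "is_zero_object A Z \<longleftrightarrow>
     Z \<in> Obj A \<and> (\<forall>X\<in>Obj A. (\<exists>!f. f \<in> Hom A X Z) \<and> (\<exists>!f. f \<in> Hom A Z X))"

definition is_biproduct ::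
    "('o, 'a) additive_data \<Rightarrow> 'o \<Rightarrow> 'o \<Rightarrow> 'o \<times> 'a \<times> 'a \<times> 'a \<times> 'a \<Rightarrow> bool" where
  "is_biproduct A X Y = (\<lambda>(P, i1, i2, p1, p2).
     P \<in> Obj A \<and> i1 \<in> Hom A X P \<and> i2 \<in> Hom A Y P \<and> p1 \<in> Hom A P X \<and> p2 \<in> Hom A P Y \<and>
     Cmp A p1 i1 = Id A X \<and> Cmp A p2 i2 = Id A Y \<and>
     Cmp A p2 i1 = Zero A X Y \<and> Cmp A p1 i2 = Zero A Y X \<and>
     Plus A (Cmp A i1 p1) (Cmp A i2 p2) = Id A P)"

definition monic :: "('o, 'a) additive_data \<Rightarrow> 'a \<Rightarrow> bool" where
  "monic A f \<longleftrightarrow> f \<in> Arr A \<and>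
     (\<forall>Z\<in>Obj A. \<forall>g\<in>Hom A Z (Dom A f). \<forall>h\<in>Hom A Z (Dom A f). Cmp A f g = Cmp A f h \<longrightarrow> g = h)"

definition epic :: "('o, 'a) additive_data \<Rightarrow> 'a \<Rightarrow> bool" where
  "epic A f \<longleftrightarrow> f \<in> Arr A \<and>
     (\<forall>Z\<in>Obj A. \<forall>g\<in>Hom A (Cod A f) Z. \<forall>h\<in>Hom A (Cod A f) Z. Cmp A g f = Cmp A h f \<longrightarrow> g = h)"

definition is_iso :: "('o, 'a) additive_data \<Rightarrow> 'a \<Rightarrow> bool" where
  "is_iso A f \<longleftrightarrow> f \<in> Arr A \<and>
     (\<exists>g\<in>Hom A (Cod A f) (Dom A f). Cmp A g f = Id A (Dom A f) \<and> Cmp A f g = Id A (Cod A f))"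

definition is_kernel :: "('o, 'a) additive_data \<Rightarrow> 'a \<Rightarrow> 'a \<Rightarrow> bool" where
  "is_kernel A k f \<longleftrightarrow> k \<in> Arr A \<and> f \<in> Arr A \<and> Cod A k = Dom A f \<and>
     Cmp A f k = Zero A (Dom A k) (Cod A f) \<and>
     (\<forall>Z\<in>Obj A. \<forall>g\<in>Hom A Z (Dom A f). Cmp A f g = Zero A Z (Cod A f) \<longrightarrow>
        (\<exists>!u. u \<in> Hom A Z (Dom A k) \<and> Cmp A k u = g))"

definition is_cokernel :: "('o, 'a) additive_data \<Rightarrow> 'a \<Rightarrow> 'a \<Rightarrow> bool" where
  "is_cokernel A c f \<longleftrightarrow> c \<in> Arr A \<and> f \<in> Arr A \<and> Dom A c = Cod A f \<and>
     Cmp A c f = Zero A (Dom A f) (Cod A c) \<and>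
     (\<forall>Z\<in>Obj A. \<forall>g\<in>Hom A (Cod A f) Z. Cmp A g f = Zero A (Dom A f) Z \<longrightarrow>
        (\<exists>!u. u \<in> Hom A (Cod A c) Z \<and> Cmp A u c = g))"

locale abelian_category = preadditive_category +
  assumes zero_object: "\<exists>Z. is_zero_object A Z"
    and biproducts: "\<lbrakk>X \<in> Obj A; Y \<in> Obj A\<rbrakk> \<Longrightarrow> \<exists>P. is_biproduct A X Y P"
    and kernels: "f \<in> Arr A \<Longrightarrow> \<exists>k. is_kernel A k f"
    and cokernels: "f \<in> Arr A \<Longrightarrow> \<exists>c. is_cokernel A c f"
    and monic_normal: "monic A f \<Longrightarrow> \<exists>g. is_kernel A f g"
    and epic_normal: "epic A f \<Longrightarrow> \<exists>g. is_cokernel A f g"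

text \<open>
  Exactness of \<open>\<cdot> \<midarrow>f\<rightarrow> \<cdot> \<midarrow>g\<rightarrow> \<cdot>\<close>: the image of \<open>f\<close>, i.e. the kernel of its cokernel, is the kernel
  of \<open>g\<close>.
\<close>

definition exact_at :: "('o, 'a) additive_data \<Rightarrow> 'a \<Rightarrow> 'a \<Rightarrow> bool" where
  "exact_at A f g \<longleftrightarrow> (\<exists>k c. is_cokernel A c f \<and> is_kernel A k c \<and> is_kernel A k g)"

text \<open>\<open>short_exact A f g\<close>: the sequence \<open>0 \<rightarrow> Dom f \<midarrow>f\<rightarrow> \<cdot> \<midarrow>g\<rightarrow> Cod g \<rightarrow> 0\<close> is exact.\<close>

definition short_exact :: "('o, 'a) additive_data \<Rightarrow> 'a \<Rightarrow> 'a \<Rightarrow> bool" where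
  "short_exact A f g \<longleftrightarrow> is_kernel A f g \<and> is_cokernel A g f"


section \<open>Yoneda Ext\<close>

text \<open>
  An element of \<open>Ext1 A X Y\<close> is a Yoneda class of pairs \<open>(f, g)\<close> forming an extension
  \<open>0 \<rightarrow> Y \<midarrow>f\<rightarrow> E \<midarrow>g\<rightarrow> X \<rightarrow> 0\<close>; the object \<open>E\<close> is \<open>Cod A f\<close>.
\<close>

definition extensions :: "('o, 'a) additive_data \<Rightarrow> 'o \<Rightarrow> 'o \<Rightarrow> ('a \<times> 'a) set" where
  "extensions A X Y = {(f, g). short_exact A f g \<and> Dom A f = Y \<and> Cod A g = X}"

definition ext_equiv ::
    "('o, 'a) additive_data \<Rightarrow> 'o \<Rightarrow> 'o \<Rightarrow> (('a \<times> 'a) \<times> ('a \<times> 'a)) set" where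
  "ext_equiv A X Y = {((f, g), (f', g')).
     (f, g) \<in> extensions A X Y \<and> (f', g') \<in> extensions A X Y \<and>
     (\<exists>h\<in>Hom A (Cod A f) (Cod A f'). is_iso A h \<and> Cmp A h f = f' \<and> Cmp A g' h = g)}"

definition ext_class :: "('o, 'a) additive_data \<Rightarrow> 'a \<times> 'a \<Rightarrow> ('a \<times> 'a) set" where
  "ext_class A E = ext_equiv A (Cod A (snd E)) (Dom A (fst E)) `` {E}"

text \<open>
  Functoriality of \<open>Ext1\<close>.  For \<open>a : X' \<rightarrow> X\<close> and \<open>\<xi> \<in> Ext1 A X Y\<close>, the class \<open>ext_pull A a \<xi>\<close> in
  \<open>Ext1 A X' Y\<close> consists of the extensions \<open>E'\<close> admitting a morphism \<open>(id, h, a) : E' \<rightarrow> E\<close> to a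
  member \<open>E\<close> of \<open>\<xi>\<close>; dually for \<open>b : Y \<rightarrow> Y'\<close> and \<open>ext_push A b \<xi>\<close> in \<open>Ext1 A X Y'\<close>.
\<close>

definition ext_pull :: "('o, 'a) additive_data \<Rightarrow> 'a \<Rightarrow> ('a \<times> 'a) set \<Rightarrow> ('a \<times> 'a) set" where
  "ext_pull A a \<xi> = {(f', g'). short_exact A f' g' \<and> Cod A g' = Dom A a \<and>
     (\<exists>(f, g)\<in>\<xi>. Dom A f' = Dom A f \<and>
        (\<exists>h\<in>Hom A (Cod A f') (Cod A f). Cmp A h f' = f \<and> Cmp A g h = Cmp A a g'))}"

definition ext_push :: "('o, 'a) additive_data \<Rightarrow> 'a \<Rightarrow> ('a \<times> 'a) set \<Rightarrow> ('a \<times> 'a) set" where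
  "ext_push A b \<xi> = {(f', g'). short_exact A f' g' \<and> Dom A f' = Cod A b \<and>
     (\<exists>(f, g)\<in>\<xi>. Cod A g' = Cod A g \<and>
        (\<exists>h\<in>Hom A (Cod A f) (Cod A f'). Cmp A h f = Cmp A f' b \<and> Cmp A g' h = g))}"

definition biproduct_choice ::
    "('o, 'a) additive_data \<Rightarrow> 'o \<Rightarrow> 'o \<Rightarrow> 'o \<times> 'a \<times> 'a \<times> 'a \<times> 'a" where
  "biproduct_choice A X Y = (SOME P. is_biproduct A X Y P)"

definition oplus_obj :: "('o, 'a) additive_data \<Rightarrow> 'o \<Rightarrow> 'o \<Rightarrow> 'o" where
  "oplus_obj A X Y = fst (biproduct_choice A X Y)"

definition oplus_arr :: "('o, 'a) additive_data \<Rightarrow> 'a \<Rightarrow> 'a \<Rightarrow> 'a" where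
  "oplus_arr A f g =
     (case biproduct_choice A (Dom A f) (Dom A g) of (_, _, _, p1, p2) \<Rightarrow>
      case biproduct_choice A (Cod A f) (Cod A g) of (_, i1, i2, _, _) \<Rightarrow>
        Plus A (Cmp A i1 (Cmp A f p1)) (Cmp A i2 (Cmp A g p2)))"

definition diagonal :: "('o, 'a) additive_data \<Rightarrow> 'o \<Rightarrow> 'a" where
  "diagonal A X = (case biproduct_choice A X X of (_, i1, i2, _, _) \<Rightarrow> Plus A i1 i2)"

definition codiagonal :: "('o, 'a) additive_data \<Rightarrow> 'o \<Rightarrow> 'a" where
  "codiagonal A Y = (case biproduct_choice A Y Y of (_, _, _, p1, p2) \<Rightarrow> Plus A p1 p2)"

definition ext_oplus ::
    "('o, 'a) additive_data \<Rightarrow> ('a \<times> 'a) set \<Rightarrow> ('a \<times> 'a) set \<Rightarrow> ('a \<times> 'a) set" where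
  "ext_oplus A \<xi> \<eta> =
     (\<Union>(f, g)\<in>\<xi>. \<Union>(f', g')\<in>\<eta>. ext_class A (oplus_arr A f f', oplus_arr A g g'))"

text \<open>The Baer sum \<open>\<nabla>(\<xi> \<oplus> \<eta>)\<Delta>\<close>; the zero element is the class of the split extensions.\<close>

definition baer_sum ::
    "('o, 'a) additive_data \<Rightarrow> 'o \<Rightarrow> 'o \<Rightarrow> ('a \<times> 'a) set \<Rightarrow> ('a \<times> 'a) set \<Rightarrow> ('a \<times> 'a) set" where
  "baer_sum A X Y \<xi> \<eta> =
     ext_pull A (diagonal A X) (ext_push A (codiagonal A Y) (ext_oplus A \<xi> \<eta>))"

definition split_extensions :: "('o, 'a) additive_data \<Rightarrow> 'o \<Rightarrow> 'o \<Rightarrow> ('a \<times> 'a) set" where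
  "split_extensions A X Y =
     {(f, g) \<in> extensions A X Y. \<exists>s\<in>Hom A X (Dom A g). Cmp A g s = Id A X}"

definition Ext1 :: "('o, 'a) additive_data \<Rightarrow> 'o \<Rightarrow> 'o \<Rightarrow> ('a \<times> 'a) set monoid" where
  "Ext1 A X Y = \<lparr>carrier = extensions A X Y // ext_equiv A X Y,
     mult = baer_sum A X Y, one = split_extensions A X Y\<rparr>"


section \<open>Special preenveloping and special precovering subcategories\<close>

text \<open>A full subcategory is represented by its set of objects.\<close>

definition additive_subcategory :: "('o, 'a) additive_data \<Rightarrow> 'o set \<Rightarrow> bool" where
  "additive_subcategory A V \<longleftrightarrow> V \<subseteq> Obj A \<and>
     (\<forall>f. is_iso A f \<and> Dom A f \<in> V \<longrightarrow> Cod A f \<in> V) \<and>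
     (\<exists>Z\<in>V. is_zero_object A Z) \<and>
     (\<forall>X\<in>V. \<forall>Y\<in>V. \<exists>P. is_biproduct A X Y P \<and> fst P \<in> V)"

definition left_perp :: "('o, 'a) additive_data \<Rightarrow> 'o set \<Rightarrow> 'o set" where
  "left_perp A V = {M \<in> Obj A. \<forall>X\<in>V. carrier (Ext1 A M X) = {\<one>\<^bsub>Ext1 A M X\<^esub>}}"

definition right_perp :: "('o, 'a) additive_data \<Rightarrow> 'o set \<Rightarrow> 'o set" where
  "right_perp A W = {N \<in> Obj A. \<forall>X\<in>W. carrier (Ext1 A X N) = {\<one>\<^bsub>Ext1 A X N\<^esub>}}"

definition special_preenveloping :: "('o, 'a) additive_data \<Rightarrow> 'o set \<Rightarrow> bool" where
  "special_preenveloping A V \<longleftrightarrow> additive_subcategory A V \<and>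
     (\<forall>M\<in>Obj A. \<exists>f g. short_exact A f g \<and> Dom A f = M \<and> Cod A f \<in> V \<and> Cod A g \<in> left_perp A V)"

definition special_precovering :: "('o, 'a) additive_data \<Rightarrow> 'o set \<Rightarrow> bool" where
  "special_precovering A W \<longleftrightarrow> additive_subcategory A W \<and>
     (\<forall>M\<in>Obj A. \<exists>f g. short_exact A f g \<and> Cod A g = M \<and> Dom A g \<in> W \<and> Dom A f \<in> right_perp A W)"

text \<open>
  A coresolution \<open>0 \<rightarrow> M \<rightarrow> I\<^sup>0 \<rightarrow> I\<^sup>1 \<rightarrow> \<dots>\<close> with objects \<open>I\<^sup>j = cobj j\<close>, differentials
  \<open>cdiff j : I\<^sup>j \<rightarrow> I\<^sup>j\<^sup>+\<^sup>1\<close> and augmentation \<open>caug : M \<rightarrow> I\<^sup>0\<close>, together with chosen kernels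
  \<open>cinc i : csyz i \<rightarrow> I\<^sup>i\<close> of the differentials, where \<open>csyz i\<close> is \<open>\<Theta>\<^sup>i M\<close> and the choice for
  \<open>i = 0\<close> is \<open>M\<close> itself.
\<close>

record ('o, 'a) coresolution =
  cobj :: "nat \<Rightarrow> 'o"
  cdiff :: "nat \<Rightarrow> 'a"
  caug :: 'a
  csyz :: "nat \<Rightarrow> 'o"
  cinc :: "nat \<Rightarrow> 'a"

definition special_proper_coresolution ::
    "('o, 'a) additive_data \<Rightarrow> 'o set \<Rightarrow> 'o \<Rightarrow> ('o, 'a) coresolution \<Rightarrow> bool" where
  "special_proper_coresolution A V M R \<longleftrightarrow>
     (\<forall>j. cobj R j \<in> V \<and> cdiff R j \<in> Hom A (cobj R j) (cobj R (Suc j))) \<and>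
     caug R \<in> Hom A M (cobj R 0) \<and>
     monic A (caug R) \<and> exact_at A (caug R) (cdiff R 0) \<and>
     (\<forall>j. exact_at A (cdiff R j) (cdiff R (Suc j))) \<and>
     (\<forall>X\<in>V.
        (\<forall>h\<in>Hom A M X. \<exists>u\<in>Hom A (cobj R 0) X. h = Cmp A u (caug R)) \<and>
        (\<forall>h\<in>Hom A (cobj R 0) X. Cmp A h (caug R) = Zero A M X \<longrightarrow>
           (\<exists>u\<in>Hom A (cobj R 1) X. h = Cmp A u (cdiff R 0))) \<and>
        (\<forall>j. \<forall>h\<in>Hom A (cobj R (Suc j)) X. Cmp A h (cdiff R j) = Zero A (cobj R j) X \<longrightarrow>
           (\<exists>u\<in>Hom A (cobj R (Suc (Suc j))) X. h = Cmp A u (cdiff R (Suc j))))) \<and>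
     csyz R 0 = M \<and> cinc R 0 = caug R \<and>
     (\<forall>i. cinc R i \<in> Hom A (csyz R i) (cobj R i) \<and> is_kernel A (cinc R i) (cdiff R i)) \<and>
     (\<forall>i\<ge>1. csyz R i \<in> left_perp A V)"

text \<open>The epimorphism \<open>I\<^sup>i \<rightarrow> \<Theta>\<^sup>i\<^sup>+\<^sup>1 M\<close> and the extension \<open>0 \<rightarrow> \<Theta>\<^sup>i M \<rightarrow> I\<^sup>i \<rightarrow> \<Theta>\<^sup>i\<^sup>+\<^sup>1 M \<rightarrow> 0\<close>.\<close>

definition cpr :: "('o, 'a) additive_data \<Rightarrow> ('o, 'a) coresolution \<Rightarrow> nat \<Rightarrow> 'a" where
  "cpr A R i =
     (THE p. p \<in> Hom A (cobj R i) (csyz R (Suc i)) \<and> Cmp A (cinc R (Suc i)) p = cdiff R i)"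

definition cses :: "('o, 'a) additive_data \<Rightarrow> ('o, 'a) coresolution \<Rightarrow> nat \<Rightarrow> 'a \<times> 'a" where
  "cses A R i = (cinc R i, cpr A R i)"

text \<open>
  A resolution \<open>\<dots> \<rightarrow> P\<^sub>1 \<rightarrow> P\<^sub>0 \<rightarrow> M \<rightarrow> 0\<close> with objects \<open>P\<^sub>j = robj j\<close>, differentials
  \<open>rdiff j : P\<^sub>j\<^sub>+\<^sub>1 \<rightarrow> P\<^sub>j\<close> and augmentation \<open>raug : P\<^sub>0 \<rightarrow> M\<close>, together with chosen cokernels
  \<open>rpr i : P\<^sub>i \<rightarrow> rsyz i\<close> of the differentials \<open>rdiff i\<close>, where \<open>rsyz i\<close> is \<open>\<Omega>\<^sub>i M\<close> and the choice
  for \<open>i = 0\<close> is \<open>M\<close> itself.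
\<close>

record ('o, 'a) resolution =
  robj :: "nat \<Rightarrow> 'o"
  rdiff :: "nat \<Rightarrow> 'a"
  raug :: 'a
  rsyz :: "nat \<Rightarrow> 'o"
  rpr :: "nat \<Rightarrow> 'a"

definition special_proper_resolution ::
    "('o, 'a) additive_data \<Rightarrow> 'o set \<Rightarrow> 'o \<Rightarrow> ('o, 'a) resolution \<Rightarrow> bool" where
  "special_proper_resolution A W M Q \<longleftrightarrow>
     (\<forall>j. robj Q j \<in> W \<and> rdiff Q j \<in> Hom A (robj Q (Suc j)) (robj Q j)) \<and>
     raug Q \<in> Hom A (robj Q 0) M \<and>
     epic A (raug Q) \<and> exact_at A (rdiff Q 0) (raug Q) \<and>
     (\<forall>j. exact_at A (rdiff Q (Suc j)) (rdiff Q j)) \<and>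
     (\<forall>X\<in>W.
        (\<forall>h\<in>Hom A X M. \<exists>u\<in>Hom A X (robj Q 0). h = Cmp A (raug Q) u) \<and>
        (\<forall>h\<in>Hom A X (robj Q 0). Cmp A (raug Q) h = Zero A X M \<longrightarrow>
           (\<exists>u\<in>Hom A X (robj Q 1). h = Cmp A (rdiff Q 0) u)) \<and>
        (\<forall>j. \<forall>h\<in>Hom A X (robj Q (Suc j)). Cmp A (rdiff Q j) h = Zero A X (robj Q j) \<longrightarrow>
           (\<exists>u\<in>Hom A X (robj Q (Suc (Suc j))). h = Cmp A (rdiff Q (Suc j)) u))) \<and>
     rsyz Q 0 = M \<and> rpr Q 0 = raug Q \<and>
     (\<forall>i. rpr Q i \<in> Hom A (robj Q i) (rsyz Q i) \<and> is_cokernel A (rpr Q i) (rdiff Q i)) \<and>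
     (\<forall>i\<ge>1. rsyz Q i \<in> right_perp A W)"

text \<open>The monomorphism \<open>\<Omega>\<^sub>i\<^sub>+\<^sub>1 M \<rightarrow> P\<^sub>i\<close> and the extension \<open>0 \<rightarrow> \<Omega>\<^sub>i\<^sub>+\<^sub>1 M \<rightarrow> P\<^sub>i \<rightarrow> \<Omega>\<^sub>i M \<rightarrow> 0\<close>.\<close>

definition rinc :: "('o, 'a) additive_data \<Rightarrow> ('o, 'a) resolution \<Rightarrow> nat \<Rightarrow> 'a" where
  "rinc A Q i =
     (THE k. k \<in> Hom A (rsyz Q (Suc i)) (robj Q i) \<and> Cmp A k (rpr Q (Suc i)) = rdiff Q i)"

definition rses :: "('o, 'a) additive_data \<Rightarrow> ('o, 'a) resolution \<Rightarrow> nat \<Rightarrow> 'a \<times> 'a" where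
  "rses A Q i = (rinc A Q i, rpr Q i)"


section \<open>Stable Hom, connecting maps and satellites\<close>

definition factoring_through :: "('o, 'a) additive_data \<Rightarrow> 'o set \<Rightarrow> 'o \<Rightarrow> 'o \<Rightarrow> 'a set" where
  "factoring_through A U X Y =
     {f. \<exists>Z\<in>U. \<exists>u\<in>Hom A X Z. \<exists>v\<in>Hom A Z Y. f = Cmp A v u}"

definition stable_Hom :: "('o, 'a) additive_data \<Rightarrow> 'o set \<Rightarrow> 'o \<Rightarrow> 'o \<Rightarrow> 'a set monoid" where
  "stable_Hom A U X Y = Hom_group A X Y Mod factoring_through A U X Y"

definition stable_class :: "('o, 'a) additive_data \<Rightarrow> 'o set \<Rightarrow> 'a \<Rightarrow> 'a set" where
  "stable_class A U f =
     factoring_through A U (Dom A f) (Cod A f) #>\<^bsub>Hom_group A (Dom A f) (Cod A f)\<^esub> f"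

text \<open>
  Connecting maps of an extension \<open>E = (0 \<rightarrow> M \<rightarrow> I \<rightarrow> T \<rightarrow> 0)\<close>: the map
  \<open>Hom(M, N) \<rightarrow> Ext\<^sup>1(T, N)\<close> is pushout of \<open>E\<close>, the map \<open>Hom(X, T) \<rightarrow> Ext\<^sup>1(X, M)\<close> is pullback.
\<close>

definition connecting_push :: "('o, 'a) additive_data \<Rightarrow> 'a \<times> 'a \<Rightarrow> 'a \<Rightarrow> ('a \<times> 'a) set" where
  "connecting_push A E f = ext_push A f (ext_class A E)"

definition connecting_pull :: "('o, 'a) additive_data \<Rightarrow> 'a \<times> 'a \<Rightarrow> 'a \<Rightarrow> ('a \<times> 'a) set" where
  "connecting_pull A E f = ext_pull A f (ext_class A E)"

text \<open>
  The maps induced on stable Hom.  Below, \<open>the_elem (g ` c)\<close> is the common value of \<open>g\<close> on the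
  class \<open>c\<close>, and \<open>\<beta>\<close> is the map with \<open>\<beta> (\<partial> h) =\<close> class of \<open>h\<close>.
  In the \<open>V\<close>-case \<open>E\<close> is \<open>0 \<rightarrow> M \<rightarrow> I \<rightarrow> \<Theta>M \<rightarrow> 0\<close> for \<open>\<delta>\<close> and \<open>0 \<rightarrow> N \<rightarrow> J \<rightarrow> \<Theta>N \<rightarrow> 0\<close> for \<open>\<beta>\<close>,
  with \<open>X = \<Theta>M\<close>; in the \<open>W\<close>-case \<open>E\<close> is \<open>0 \<rightarrow> \<Omega>N \<rightarrow> Q \<rightarrow> N \<rightarrow> 0\<close> for \<open>\<delta>\<close> and
  \<open>0 \<rightarrow> \<Omega>M \<rightarrow> P \<rightarrow> M \<rightarrow> 0\<close> for \<open>\<beta>\<close>, with \<open>Y = \<Omega>N\<close>.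
\<close>

definition deltaV :: "('o, 'a) additive_data \<Rightarrow> 'a \<times> 'a \<Rightarrow> 'a set \<Rightarrow> ('a \<times> 'a) set" where
  "deltaV A E c = the_elem (connecting_push A E ` c)"

definition betaV ::
    "('o, 'a) additive_data \<Rightarrow> 'o set \<Rightarrow> 'o \<Rightarrow> 'a \<times> 'a \<Rightarrow> ('a \<times> 'a) set \<Rightarrow> 'a set" where
  "betaV A V X E \<xi> =
     the_elem (stable_class A V ` {h \<in> Hom A X (Cod A (snd E)). connecting_pull A E h = \<xi>})"

definition deltaW :: "('o, 'a) additive_data \<Rightarrow> 'a \<times> 'a \<Rightarrow> 'a set \<Rightarrow> ('a \<times> 'a) set" where
  "deltaW A E c = the_elem (connecting_pull A E ` c)"

definition betaW ::
    "('o, 'a) additive_data \<Rightarrow> 'o set \<Rightarrow> 'o \<Rightarrow> 'a \<times> 'a \<Rightarrow> ('a \<times> 'a) set \<Rightarrow> 'a set" where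
  "betaW A W Y E \<xi> =
     the_elem (stable_class A W ` {h \<in> Hom A (Dom A (fst E)) Y. connecting_push A E h = \<xi>})"

text \<open>
  First left satellites.  \<open>E\<close> is \<open>0 \<rightarrow> M \<rightarrow> I \<rightarrow> \<Theta>M \<rightarrow> 0\<close> in the \<open>V\<close>-case and
  \<open>0 \<rightarrow> \<Omega>N \<rightarrow> Q \<rightarrow> N \<rightarrow> 0\<close> in the \<open>W\<close>-case.
\<close>

definition satelliteV :: "('o, 'a) additive_data \<Rightarrow> 'a \<times> 'a \<Rightarrow> 'o \<Rightarrow> ('a \<times> 'a) set monoid" where
  "satelliteV A E N =
     (let p = snd E; G = Ext1 A (Cod A p) N
      in G\<lparr>carrier := kernel G (Ext1 A (Dom A p) N) (ext_pull A p)\<rparr>)"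

definition satelliteW :: "('o, 'a) additive_data \<Rightarrow> 'o \<Rightarrow> 'a \<times> 'a \<Rightarrow> ('a \<times> 'a) set monoid" where
  "satelliteW A M E =
     (let k = fst E; G = Ext1 A M (Dom A k)
      in G\<lparr>carrier := kernel G (Ext1 A M (Cod A k)) (ext_push A k)\<rparr>)"


section \<open>Sequential colimits of abelian groups\<close>

text \<open>
  The colimit of \<open>G i\<^sub>0 \<rightarrow> G (i\<^sub>0 + 1) \<rightarrow> \<dots>\<close> with transition maps \<open>t i : G i \<rightarrow> G (Suc i)\<close>;
  \<open>fold t [i..<k]\<close> is the composite \<open>G i \<rightarrow> G k\<close> for \<open>i \<le> k\<close>.
\<close>

definition colim_rel ::
    "nat \<Rightarrow> (nat \<Rightarrow> 'b monoid) \<Rightarrow> (nat \<Rightarrow> 'b \<Rightarrow> 'b) \<Rightarrow> ((nat \<times> 'b) \<times> (nat \<times> 'b)) set" where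
  "colim_rel i0 G t = {((i, x), (j, y)).
     i0 \<le> i \<and> i0 \<le> j \<and> x \<in> carrier (G i) \<and> y \<in> carrier (G j) \<and>
     (\<exists>k. i \<le> k \<and> j \<le> k \<and> fold t [i..<k] x = fold t [j..<k] y)}"

definition colim ::
    "nat \<Rightarrow> (nat \<Rightarrow> 'b monoid) \<Rightarrow> (nat \<Rightarrow> 'b \<Rightarrow> 'b) \<Rightarrow> (nat \<times> 'b) set monoid" where
  "colim i0 G t = \<lparr>
     carrier = (SIGMA i:{i0..}. carrier (G i)) // colim_rel i0 G t,
     mult = (\<lambda>a b. \<Union>{colim_rel i0 G t `` {(k, fold t [i..<k] x \<otimes>\<^bsub>G k\<^esub> fold t [j..<k] y)} | i x j y k.
        (i, x) \<in> a \<and> (j, y) \<in> b \<and> i \<le> k \<and> j \<le> k}),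
     one = colim_rel i0 G t `` {(i0, \<one>\<^bsub>G i0\<^esub>)}\<rparr>"

text \<open>The map into \<open>colim i0 G' t'\<close> induced by a morphism of direct systems \<open>h i : G i \<rightarrow> G' i\<close>.\<close>

definition colim_map ::
    "nat \<Rightarrow> (nat \<Rightarrow> 'c monoid) \<Rightarrow> (nat \<Rightarrow> 'c \<Rightarrow> 'c) \<Rightarrow> (nat \<Rightarrow> 'b \<Rightarrow> 'c) \<Rightarrow>
     (nat \<times> 'b) set \<Rightarrow> (nat \<times> 'c) set" where
  "colim_map i0 G' t' h a = (\<Union>(i, x)\<in>a. colim_rel i0 G' t' `` {(i, h i x)})"

text \<open>For an integer \<open>n\<close> the systems below start at \<open>nat (- n) = max 0 (- n)\<close>, and
  \<open>shift n i = i + n\<close> from there on.\<close>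

definition shift :: "int \<Rightarrow> nat \<Rightarrow> nat" where
  "shift n i = nat (int i + n)"


section \<open>The direct systems and their colimits: the V-case\<close>

text \<open>
  Here \<open>R\<close> and \<open>S\<close> are the chosen coresolutions of \<open>M\<close> and \<open>N\<close>.
\<close>

definition homV_sys where
  "homV_sys A V R S n i = stable_Hom A V (csyz R i) (csyz S (shift n i))"

definition homV_trans where
  "homV_trans A V R S n i =
     betaV A V (csyz R (Suc i)) (cses A S (shift n i)) \<circ> deltaV A (cses A R i)"

definition extV_sys where
  "extV_sys A R S n i = Ext1 A (csyz R (Suc i)) (csyz S (shift n i))"

definition extV_trans where
  "extV_trans A V R S n i =
     deltaV A (cses A R (Suc i)) \<circ> betaV A V (csyz R (Suc i)) (cses A S (shift n i))"

definition satV_sys where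
  "satV_sys A R S n i = satelliteV A (cses A R i) (csyz S (shift n i))"

definition Ext_check ::
    "('o, 'a) additive_data \<Rightarrow> 'o set \<Rightarrow> ('o \<Rightarrow> ('o, 'a) coresolution) \<Rightarrow> int \<Rightarrow> 'o \<Rightarrow> 'o \<Rightarrow>
     (nat \<times> 'a set) set monoid" where
  "Ext_check A V R n M N =
     colim (nat (- n)) (homV_sys A V (R M) (R N) n) (homV_trans A V (R M) (R N) n)"

definition colim_extV ::
    "('o, 'a) additive_data \<Rightarrow> 'o set \<Rightarrow> ('o \<Rightarrow> ('o, 'a) coresolution) \<Rightarrow> int \<Rightarrow> 'o \<Rightarrow> 'o \<Rightarrow>
     (nat \<times> ('a \<times> 'a) set) set monoid" where
  "colim_extV A V R n M N =
     colim (nat (- n)) (extV_sys A (R M) (R N) n) (extV_trans A V (R M) (R N) n)"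

text \<open>The transition maps of the satellites are the restrictions of those of the \<open>Ext\<^sup>1\<close>.\<close>

definition colim_satV ::
    "('o, 'a) additive_data \<Rightarrow> 'o set \<Rightarrow> ('o \<Rightarrow> ('o, 'a) coresolution) \<Rightarrow> int \<Rightarrow> 'o \<Rightarrow> 'o \<Rightarrow>
     (nat \<times> ('a \<times> 'a) set) set monoid" where
  "colim_satV A V R n M N =
     colim (nat (- n)) (satV_sys A (R M) (R N) n) (extV_trans A V (R M) (R N) n)"

text \<open>
  Functoriality.  \<open>F\<close> lifts \<open>f : M' \<rightarrow> M\<close> if it consists of the morphisms
  \<open>F i : \<Theta>\<^sup>i M' \<rightarrow> \<Theta>\<^sup>i M\<close> induced on kernels by a map of coresolutions over \<open>f\<close>.  Lifts exist because
  the coresolutions are proper, and the maps they induce on the three colimits do not depend on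
  the lift.
\<close>

definition liftV ::
    "('o, 'a) additive_data \<Rightarrow> ('o, 'a) coresolution \<Rightarrow> ('o, 'a) coresolution \<Rightarrow> 'a \<Rightarrow>
     (nat \<Rightarrow> 'a) \<Rightarrow> bool" where
  "liftV A R' R f F \<longleftrightarrow> F 0 = f \<and>
     (\<forall>i. F i \<in> Hom A (csyz R' i) (csyz R i) \<and>
        (\<exists>u\<in>Hom A (cobj R' i) (cobj R i).
           Cmp A u (cinc R' i) = Cmp A (cinc R i) (F i) \<and>
           Cmp A (F (Suc i)) (cpr A R' i) = Cmp A (cpr A R i) u))"

definition stable_act :: "('o, 'a) additive_data \<Rightarrow> 'o set \<Rightarrow> 'a \<Rightarrow> 'a \<Rightarrow> 'a set \<Rightarrow> 'a set" where
  "stable_act A U f g c = the_elem ((\<lambda>x. stable_class A U (Cmp A g (Cmp A x f))) ` c)"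

definition ext_act ::
    "('o, 'a) additive_data \<Rightarrow> 'a \<Rightarrow> 'a \<Rightarrow> ('a \<times> 'a) set \<Rightarrow> ('a \<times> 'a) set" where
  "ext_act A f g \<xi> = ext_push A g (ext_pull A f \<xi>)"

text \<open>The maps from the colimits at \<open>(M, N)\<close> to those at \<open>(M', N')\<close> induced by lifts \<open>F\<close> of
  \<open>f : M' \<rightarrow> M\<close> and \<open>G\<close> of \<open>g : N \<rightarrow> N'\<close>.\<close>

definition Ext_check_map where
  "Ext_check_map A V R n M' N' F G =
     colim_map (nat (- n)) (homV_sys A V (R M') (R N') n) (homV_trans A V (R M') (R N') n)
       (\<lambda>i. stable_act A V (F i) (G (shift n i)))"

definition colim_extV_map where
  "colim_extV_map A V R n M' N' F G =
     colim_map (nat (- n)) (extV_sys A (R M') (R N') n) (extV_trans A V (R M') (R N') n)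
       (\<lambda>i. ext_act A (F (Suc i)) (G (shift n i)))"

definition colim_satV_map where
  "colim_satV_map A V R n M' N' F G =
     colim_map (nat (- n)) (satV_sys A (R M') (R N') n) (extV_trans A V (R M') (R N') n)
       (\<lambda>i. ext_act A (F (Suc i)) (G (shift n i)))"


section \<open>The direct systems and their colimits: the W-case\<close>

text \<open>
  Here \<open>P\<close> and \<open>Q\<close> are the chosen resolutions of \<open>M\<close> and \<open>N\<close>.
\<close>

definition homW_sys where
  "homW_sys A W P Q n i = stable_Hom A W (rsyz P (shift n i)) (rsyz Q i)"

definition homW_trans where
  "homW_trans A W P Q n i =
     betaW A W (rsyz Q (Suc i)) (rses A P (shift n i)) \<circ> deltaW A (rses A Q i)"

definition extW_sys where
  "extW_sys A P Q n i = Ext1 A (rsyz P (shift n i)) (rsyz Q (Suc i))"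

definition extW_trans where
  "extW_trans A W P Q n i =
     deltaW A (rses A Q (Suc i)) \<circ> betaW A W (rsyz Q (Suc i)) (rses A P (shift n i))"

definition satW_sys where
  "satW_sys A P Q n i = satelliteW A (rsyz P (shift n i)) (rses A Q i)"

definition Ext_hat ::
    "('o, 'a) additive_data \<Rightarrow> 'o set \<Rightarrow> ('o \<Rightarrow> ('o, 'a) resolution) \<Rightarrow> int \<Rightarrow> 'o \<Rightarrow> 'o \<Rightarrow>
     (nat \<times> 'a set) set monoid" where
  "Ext_hat A W Q n M N =
     colim (nat (- n)) (homW_sys A W (Q M) (Q N) n) (homW_trans A W (Q M) (Q N) n)"

definition colim_extW ::
    "('o, 'a) additive_data \<Rightarrow> 'o set \<Rightarrow> ('o \<Rightarrow> ('o, 'a) resolution) \<Rightarrow> int \<Rightarrow> 'o \<Rightarrow> 'o \<Rightarrow>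
     (nat \<times> ('a \<times> 'a) set) set monoid" where
  "colim_extW A W Q n M N =
     colim (nat (- n)) (extW_sys A (Q M) (Q N) n) (extW_trans A W (Q M) (Q N) n)"

definition colim_satW ::
    "('o, 'a) additive_data \<Rightarrow> 'o set \<Rightarrow> ('o \<Rightarrow> ('o, 'a) resolution) \<Rightarrow> int \<Rightarrow> 'o \<Rightarrow> 'o \<Rightarrow>
     (nat \<times> ('a \<times> 'a) set) set monoid" where
  "colim_satW A W Q n M N =
     colim (nat (- n)) (satW_sys A (Q M) (Q N) n) (extW_trans A W (Q M) (Q N) n)"

text \<open>\<open>F\<close> lifts \<open>f : M' \<rightarrow> M\<close> if it consists of the morphisms \<open>F i : \<Omega>\<^sub>i M' \<rightarrow> \<Omega>\<^sub>i M\<close> induced on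
  cokernels by a map of resolutions over \<open>f\<close>.\<close>

definition liftW ::
    "('o, 'a) additive_data \<Rightarrow> ('o, 'a) resolution \<Rightarrow> ('o, 'a) resolution \<Rightarrow> 'a \<Rightarrow>
     (nat \<Rightarrow> 'a) \<Rightarrow> bool" where
  "liftW A Q' Q f F \<longleftrightarrow> F 0 = f \<and>
     (\<forall>i. F i \<in> Hom A (rsyz Q' i) (rsyz Q i) \<and>
        (\<exists>u\<in>Hom A (robj Q' i) (robj Q i).
           Cmp A (F i) (rpr Q' i) = Cmp A (rpr Q i) u \<and>
           Cmp A u (rinc A Q' i) = Cmp A (rinc A Q i) (F (Suc i))))"

definition Ext_hat_map where
  "Ext_hat_map A W Q n M' N' F G =
     colim_map (nat (- n)) (homW_sys A W (Q M') (Q N') n) (homW_trans A W (Q M') (Q N') n)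
       (\<lambda>i. stable_act A W (F (shift n i)) (G i))"

definition colim_extW_map where
  "colim_extW_map A W Q n M' N' F G =
     colim_map (nat (- n)) (extW_sys A (Q M') (Q N') n) (extW_trans A W (Q M') (Q N') n)
       (\<lambda>i. ext_act A (F (shift n i)) (G (Suc i)))"

definition colim_satW_map where
  "colim_satW_map A W Q n M' N' F G =
     colim_map (nat (- n)) (satW_sys A (Q M') (Q N') n) (extW_trans A W (Q M') (Q N') n)
       (\<lambda>i. ext_act A (F (shift n i)) (G (Suc i)))"


section \<open>Natural isomorphisms\<close>

text \<open>
  \<open>\<phi> M N : X M N \<rightarrow> Y M N\<close> is an isomorphism of abelian groups, natural in \<open>M\<close> (contravariantly) and
  \<open>N\<close> (covariantly).  \<open>lift M' M f F\<close> says that \<open>F\<close> lifts \<open>f : M' \<rightarrow> M\<close>; \<open>Xmap M' N' F G\<close> and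
  \<open>Ymap M' N' F G\<close> are the induced maps into the groups at \<open>(M', N')\<close>.  The square is required to
  commute for all choices of the lifts.
\<close>

definition natural_iso ::
    "('o, 'a) additive_data \<Rightarrow> ('o \<Rightarrow> 'o \<Rightarrow> 'a \<Rightarrow> (nat \<Rightarrow> 'a) \<Rightarrow> bool) \<Rightarrow>
     ('o \<Rightarrow> 'o \<Rightarrow> 'x monoid) \<Rightarrow> ('o \<Rightarrow> 'o \<Rightarrow> (nat \<Rightarrow> 'a) \<Rightarrow> (nat \<Rightarrow> 'a) \<Rightarrow> 'x \<Rightarrow> 'x) \<Rightarrow>
     ('o \<Rightarrow> 'o \<Rightarrow> 'y monoid) \<Rightarrow> ('o \<Rightarrow> 'o \<Rightarrow> (nat \<Rightarrow> 'a) \<Rightarrow> (nat \<Rightarrow> 'a) \<Rightarrow> 'y \<Rightarrow> 'y) \<Rightarrow>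
     ('o \<Rightarrow> 'o \<Rightarrow> 'x \<Rightarrow> 'y) \<Rightarrow> bool" where
  "natural_iso A lift X Xmap Y Ymap \<phi> \<longleftrightarrow>
     (\<forall>M\<in>Obj A. \<forall>N\<in>Obj A.
        comm_group (X M N) \<and> comm_group (Y M N) \<and> \<phi> M N \<in> iso (X M N) (Y M N)) \<and>
     (\<forall>M\<in>Obj A. \<forall>N\<in>Obj A. \<forall>M'\<in>Obj A. \<forall>N'\<in>Obj A.
        \<forall>f\<in>Hom A M' M. \<forall>g\<in>Hom A N N'. \<forall>F G. lift M' M f F \<and> lift N N' g G \<longrightarrow>
          (\<forall>x\<in>carrier (X M N). \<phi> M' N' (Xmap M' N' F G x) = Ymap M' N' F G (\<phi> M N x)))"

end

theory Submission
  imports Defs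
begin

text \<open>
  The maps \<open>\<delta>\<close> from stable Hom to \<open>Ext\<^sup>1\<close> and \<open>\<beta>\<close> from \<open>Ext\<^sup>1\<close> to the next stable Hom compose,
  in the two possible orders, to the transition maps of the two systems; hence the systems
  interleave and have the same colimit.  In the same way the inclusion of the satellites into
  \<open>Ext\<^sup>1\<close> interleaves with the transition maps of \<open>Ext\<^sup>1\<close>, since the image of \<open>\<delta>\<close> lies in the
  satellite.

  The group axioms for the Baer sum are needed only for \<open>Ext\<^sup>1(X, N)\<close> with \<open>X\<close> in the left
  orthogonal of \<open>V\<close>, or with \<open>N\<close> in the right orthogonal of \<open>W\<close>.  There the connecting map from
  a Hom group is surjective and additive, so the axioms are inherited from Hom.  All
  compatibilities of pullback and pushout of extensions follow from one exchange rule: a morphism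
  of extensions \<open>E \<rightarrow> E'\<close> with outer components \<open>\<alpha>\<close> and \<open>\<gamma>\<close> gives \<open>\<alpha>E = E'\<gamma>\<close>.
\<close>

section \<open>Interleaved direct systems\<close>

text \<open>Orthogonality is what makes both maps exist. Pushing an extension along a morphism
  through an object \<open>Z\<close> of \<open>V\<close> gives a class in an \<open>Ext1\<close>
  group that vanishes, so \<delta> descends to stable Hom. The connecting map behind \<beta> is onto
  because the next \<open>Ext1\<close> term vanishes, and its kernel consists of morphisms through a
  middle term, which lies in \<open>V\<close>. The encoding of \<open>Ext1\<close> shapes the rest:
  elements are sets of pairs, the operations range over all representatives, and zero is the set of
  split extensions. Hence every identity is reduced to exhibiting one morphism of extensions between
  fixed representatives. A satellite is the kernel of a map into \<open>Ext1\<close> of an object of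
  \<open>V\<close>, which need not lie in the left orthogonal, so group laws for that target are not
  at hand. It is therefore obtained as the image of a subgroup of a Hom group. The
  \<open>W\<close>-case is written out in parallel. The opposite category swaps the pairs and makes
  its own choice of biproducts, so classes and Baer sums do not transfer literally; it serves for
  statements about arrows and morphisms of extensions.\<close>

locale direct_system =
  fixes i0 :: nat and G :: "nat \<Rightarrow> 'b monoid" and t :: "nat \<Rightarrow> 'b \<Rightarrow> 'b"
  assumes comm_group_obj: "i0 \<le> i \<Longrightarrow> comm_group (G i)"
    and trans_hom: "i0 \<le> i \<Longrightarrow> t i \<in> hom (G i) (G (Suc i))"
begin

definition transit :: "nat \<Rightarrow> nat \<Rightarrow> 'b \<Rightarrow> 'b" where
  "transit i k = fold t [i..<k]"

definition cls :: "nat \<Rightarrow> 'b \<Rightarrow> (nat \<times> 'b) set" where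
  "cls i x = colim_rel i0 G t `` {(i, x)}"

lemma transit_refl [simp]: "transit i i = id"
  by (simp add: transit_def)

lemma transit_Suc: "i \<le> k \<Longrightarrow> transit i (Suc k) x = t k (transit i k x)"
  by (simp add: transit_def)

lemma transit_transit: "i \<le> j \<Longrightarrow> j \<le> k \<Longrightarrow> transit j k (transit i j x) = transit i k x"
  by (induction k) (auto simp: transit_Suc le_Suc_eq)

lemma transit_in_hom:
  assumes "i0 \<le> i" "i \<le> k" shows "transit i k \<in> hom (G i) (G k)"
  using assms(2)
proof (induction k rule: dec_induct)
  case base
  then show ?case by (simp add: hom_def)
next
  case (step k)
  then have "t k \<circ> transit i k \<in> hom (G i) (G (Suc k))"
    using assms by (auto intro!: hom_compose[of _ _ "G k"] trans_hom)
  moreover have "transit i (Suc k) = t k \<circ> transit i k" using step by (auto simp: transit_Suc)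
  ultimately show ?case by (simp only:)
qed

lemma transit_closed: "i0 \<le> i \<Longrightarrow> i \<le> k \<Longrightarrow> x \<in> carrier (G i) \<Longrightarrow> transit i k x \<in> carrier (G k)"
  using transit_in_hom by (auto simp: hom_def)

lemma transit_mult: "i0 \<le> i \<Longrightarrow> i \<le> k \<Longrightarrow> x \<in> carrier (G i) \<Longrightarrow> y \<in> carrier (G i) \<Longrightarrow>
    transit i k (x \<otimes>\<^bsub>G i\<^esub> y) = transit i k x \<otimes>\<^bsub>G k\<^esub> transit i k y"
  using transit_in_hom by (auto simp: hom_def)

lemma group_obj: "i0 \<le> i \<Longrightarrow> group (G i)"
  using comm_group_obj comm_group.axioms by blast

lemma transit_one: "i0 \<le> i \<Longrightarrow> i \<le> k \<Longrightarrow> transit i k \<one>\<^bsub>G i\<^esub> = \<one>\<^bsub>G k\<^esub>"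
  using hom_one[OF transit_in_hom group_obj group_obj] by simp

lemma rel_iff: "((i, x), (j, y)) \<in> colim_rel i0 G t \<longleftrightarrow>
    i0 \<le> i \<and> i0 \<le> j \<and> x \<in> carrier (G i) \<and> y \<in> carrier (G j) \<and>
    (\<exists>k. i \<le> k \<and> j \<le> k \<and> transit i k x = transit j k y)"
  by (auto simp: colim_rel_def transit_def)

lemma equiv_rel: "equiv (SIGMA i:{i0..}. carrier (G i)) (colim_rel i0 G t)"
proof (rule equivI)
  show "Relation.trans (colim_rel i0 G t)"
  proof (rule transI, clarify)
    fix i x j y k z
    assume 1: "((i, x), (j, y)) \<in> colim_rel i0 G t" and 2: "((j, y), (k, z)) \<in> colim_rel i0 G t"
    from 1 obtain m where m: "i \<le> m" "j \<le> m" "transit i m x = transit j m y" by (auto simp: rel_iff)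
    from 2 obtain l where l: "j \<le> l" "k \<le> l" "transit j l y = transit k l z" by (auto simp: rel_iff)
    have "transit i (max m l) x = transit m (max m l) (transit j m y)"
      using m by (simp add: transit_transit flip: m(3))
    also have "\<dots> = transit l (max m l) (transit j l y)" using m l(1) by (simp add: transit_transit)
    also have "\<dots> = transit k (max m l) z" using l(2) by (simp add: transit_transit l(3))
    finally show "((i, x), (k, z)) \<in> colim_rel i0 G t"
      using 1 2 m l by (auto simp: rel_iff intro!: exI[of _ "max m l"])
  qed
  show "sym (colim_rel i0 G t)" by (rule symI, clarify) (auto simp: rel_iff intro: sym)
qed (auto simp: refl_on_def rel_iff)

lemma cls_eq_iff:
  assumes "i0 \<le> i" "i0 \<le> j" "x \<in> carrier (G i)" "y \<in> carrier (G j)"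
  shows "cls i x = cls j y \<longleftrightarrow> (\<exists>k. i \<le> k \<and> j \<le> k \<and> transit i k x = transit j k y)"
  unfolding cls_def using eq_equiv_class_iff[OF equiv_rel] assms by (simp add: rel_iff)

lemma cls_transit:
  assumes "i0 \<le> i" "i \<le> k" "x \<in> carrier (G i)"
  shows "cls k (transit i k x) = cls i x"
  using assms by (subst cls_eq_iff) (auto simp: transit_closed)

text \<open>The product of the colimit and \<open>colim_map\<close> quantify over all
  representatives of a class; this turns membership into an equation between classes.\<close>

lemma in_cls: "(j, y) \<in> cls i x \<longleftrightarrow> i0 \<le> i \<and> i0 \<le> j \<and> x \<in> carrier (G i) \<and> y \<in> carrier (G j) \<and>
    cls j y = cls i x"
proof -
  have "(j, y) \<in> cls i x \<longleftrightarrow> ((i, x), (j, y)) \<in> colim_rel i0 G t" by (simp add: cls_def)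
  then show ?thesis using cls_eq_iff[of i j x y] by (metis rel_iff)
qed

lemma carrier_colim: "carrier (colim i0 G t) = {cls i x | i x. i0 \<le> i \<and> x \<in> carrier (G i)}"
  by (auto simp: colim_def quotient_def cls_def)

text \<open>Representatives are offered at every late stage, so that several elements can be
  represented at one common stage.\<close>

lemma colimE:
  assumes "a \<in> carrier (colim i0 G t)"
  obtains i where "i0 \<le> i" "\<And>k. i \<le> k \<Longrightarrow> \<exists>x\<in>carrier (G k). a = cls k x"
proof -
  obtain i x where "i0 \<le> i" "x \<in> carrier (G i)" "a = cls i x" using assms
      by (auto simp: carrier_colim)
  then show ?thesis using that[of i] cls_transit transit_closed by metis
qed

lemma colimE2:
  assumes "a \<in> carrier (colim i0 G t)" "b \<in> carrier (colim i0 G t)"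
  obtains k x y where "i0 \<le> k" "x \<in> carrier (G k)" "y \<in> carrier (G k)" "a = cls k x" "b = cls k y"
proof -
  obtain i where i: "i0 \<le> i" "\<And>k. i \<le> k \<Longrightarrow> \<exists>x\<in>carrier (G k). a = cls k x" using colimE assms by metis
  obtain j where j: "i0 \<le> j" "\<And>k. j \<le> k \<Longrightarrow> \<exists>x\<in>carrier (G k). b = cls k x" using colimE assms by metis
  show ?thesis using i(1) i(2)[of "max i j"] j(2)[of "max i j"] that[of "max i j"] by auto
qed

lemma colimE3:
  assumes "a \<in> carrier (colim i0 G t)" "b \<in> carrier (colim i0 G t)" "c \<in> carrier (colim i0 G t)"
  obtains k x y z where "i0 \<le> k" "x \<in> carrier (G k)" "y \<in> carrier (G k)" "z \<in> carrier (G k)"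
    "a = cls k x" "b = cls k y" "c = cls k z"
proof -
  obtain i x y where i: "i0 \<le> i" "x \<in> carrier (G i)" "y \<in> carrier (G i)" "a = cls i x" "b = cls i y"
    using colimE2 assms by metis
  obtain j where j: "i0 \<le> j" "\<And>k. j \<le> k \<Longrightarrow> \<exists>x\<in>carrier (G k). c = cls k x" using colimE assms by metis
  obtain z where z: "z \<in> carrier (G (max i j))" "c = cls (max i j) z" using j(2)[of "max i j"]
      by auto
  show ?thesis using that[of "max i j" "transit i (max i j) x" "transit i (max i j) y" z] i z
    by (simp add: cls_transit transit_closed le_max_iff_disj)
qed

text \<open>The product is a union over all pairs of representatives and all later stages. All of
  these yield the same class, because the representatives agree with \<open>x\<close> and
  \<open>y\<close> far enough along and the transition maps are additive; so the union is taken over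
  a singleton.\<close>

lemma mult_cls:
  assumes k: "i0 \<le> k" and x: "x \<in> carrier (G k)" and y: "y \<in> carrier (G k)"
  shows "cls k x \<otimes>\<^bsub>colim i0 G t\<^esub> cls k y = cls k (x \<otimes>\<^bsub>G k\<^esub> y)"
proof -
  have xy: "x \<otimes>\<^bsub>G k\<^esub> y \<in> carrier (G k)"
    using group_obj[OF k] x y by (simp add: group.is_monoid monoid.m_closed)
  have *: "cls l (transit i l x' \<otimes>\<^bsub>G l\<^esub> transit j l y') = cls k (x \<otimes>\<^bsub>G k\<^esub> y)"
    if "(i, x') \<in> cls k x" "(j, y') \<in> cls k y" "i \<le> l" "j \<le> l" for i x' j y' l
  proof -
    from that have 1: "cls i x' = cls k x" "cls j y' = cls k y" and
      2: "i0 \<le> i" "i0 \<le> j" "x' \<in> carrier (G i)" "y' \<in> carrier (G j)"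
      by (auto simp: in_cls)
    have "cls l (transit i l x') = cls k x" "cls l (transit j l y') = cls k y"
      using 1 2 that by (auto simp: cls_transit)
    moreover have l: "i0 \<le> l" and c: "transit i l x' \<in> carrier (G l)"
        "transit j l y' \<in> carrier (G l)"
      using 2 that transit_closed by auto
    ultimately obtain p q where p: "l \<le> p" "k \<le> p" "transit l p (transit i l x') = transit k p x"
      and q: "l \<le> q" "k \<le> q" "transit l q (transit j l y') = transit k q y"
      using cls_eq_iff[OF l k] x y by auto
    define r where "r = max p q"
    have r: "p \<le> r" "q \<le> r" "l \<le> r" "k \<le> r" using p q by (auto simp: r_def)
    from c have m: "transit i l x' \<otimes>\<^bsub>G l\<^esub> transit j l y' \<in> carrier (G l)"
      using group_obj[OF l] by (simp add: group.is_monoid monoid.m_closed)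
    have "transit l r (transit i l x') = transit k r x"
        "transit l r (transit j l y') = transit k r y"
      using p q r transit_transit by metis+
    then have "transit l r (transit i l x' \<otimes>\<^bsub>G l\<^esub> transit j l y') = transit k r (x \<otimes>\<^bsub>G k\<^esub> y)"
      using c l k r x y by (simp add: transit_mult)
    then show ?thesis using r l k m xy by (subst cls_eq_iff) auto
  qed
  have mem: "(k, x) \<in> cls k x" "(k, y) \<in> cls k y" using k x y by (auto simp: in_cls)
  have "{cls l (transit i l x' \<otimes>\<^bsub>G l\<^esub> transit j l y') | i x' j y' l.
      (i, x') \<in> cls k x \<and> (j, y') \<in> cls k y \<and> i \<le> l \<and> j \<le> l} = {cls k (x \<otimes>\<^bsub>G k\<^esub> y)}"
    (is "?S = _")
  proof
    show "?S \<subseteq> {cls k (x \<otimes>\<^bsub>G k\<^esub> y)}" using * by auto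
    have "cls k (transit k k x \<otimes>\<^bsub>G k\<^esub> transit k k y) \<in> ?S" using mem by blast
    then show "{cls k (x \<otimes>\<^bsub>G k\<^esub> y)} \<subseteq> ?S" by simp
  qed
  then show ?thesis by (simp add: colim_def cls_def[symmetric] transit_def[symmetric])
qed

lemma one_colim: "i0 \<le> k \<Longrightarrow> \<one>\<^bsub>colim i0 G t\<^esub> = cls k \<one>\<^bsub>G k\<^esub>"
  using cls_transit[of i0 k "\<one>\<^bsub>G i0\<^esub>"] transit_one[of i0 k] group_obj[of i0]
  by (simp add: colim_def cls_def[symmetric] group.is_monoid)

lemma cls_carrier: "i0 \<le> k \<Longrightarrow> x \<in> carrier (G k) \<Longrightarrow> cls k x \<in> carrier (colim i0 G t)"
  by (auto simp: carrier_colim)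

text \<open>Any three elements live at a common stage, where the laws hold by assumption.\<close>

lemma comm_group_colim: "comm_group (colim i0 G t)"
proof (rule comm_groupI)
  fix a b assume ab: "a \<in> carrier (colim i0 G t)" "b \<in> carrier (colim i0 G t)"
  then obtain k x y where k: "i0 \<le> k" and xy: "x \<in> carrier (G k)" "y \<in> carrier (G k)"
    and [simp]: "a = cls k x" "b = cls k y" by (rule colimE2)
  interpret comm_group "G k" by (rule comm_group_obj[OF k])
  show "a \<otimes>\<^bsub>colim i0 G t\<^esub> b \<in> carrier (colim i0 G t)"
    using k xy by (simp add: mult_cls cls_carrier)
  show "a \<otimes>\<^bsub>colim i0 G t\<^esub> b = b \<otimes>\<^bsub>colim i0 G t\<^esub> a"
    using k xy by (simp add: mult_cls m_comm)
next
  fix a b c assume "a \<in> carrier (colim i0 G t)" "b \<in> carrier (colim i0 G t)"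
      "c \<in> carrier (colim i0 G t)"
  then obtain k x y z where k: "i0 \<le> k" and xyz: "x \<in> carrier (G k)" "y \<in> carrier (G k)"
      "z \<in> carrier (G k)"
    and [simp]: "a = cls k x" "b = cls k y" "c = cls k z" by (rule colimE3)
  interpret comm_group "G k" by (rule comm_group_obj[OF k])
  show "a \<otimes>\<^bsub>colim i0 G t\<^esub> b \<otimes>\<^bsub>colim i0 G t\<^esub> c = a \<otimes>\<^bsub>colim i0 G t\<^esub> (b \<otimes>\<^bsub>colim i0 G t\<^esub> c)"
    using k xyz by (simp add: mult_cls m_assoc)
next
  interpret comm_group "G i0" by (rule comm_group_obj) simp
  show "\<one>\<^bsub>colim i0 G t\<^esub> \<in> carrier (colim i0 G t)" by (simp add: one_colim[of i0] cls_carrier)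
next
  fix a assume "a \<in> carrier (colim i0 G t)"
  then obtain k x where k: "i0 \<le> k" and x: "x \<in> carrier (G k)" and [simp]: "a = cls k x"
    by (auto simp: carrier_colim)
  interpret comm_group "G k" by (rule comm_group_obj[OF k])
  show "\<one>\<^bsub>colim i0 G t\<^esub> \<otimes>\<^bsub>colim i0 G t\<^esub> a = a"
    using k x by (simp add: one_colim[OF k] mult_cls)
  have "cls k (inv\<^bsub>G k\<^esub> x) \<otimes>\<^bsub>colim i0 G t\<^esub> a = \<one>\<^bsub>colim i0 G t\<^esub>"
    using k x by (simp add: one_colim[OF k] mult_cls l_inv)
  then show "\<exists>b\<in>carrier (colim i0 G t). b \<otimes>\<^bsub>colim i0 G t\<^esub> a = \<one>\<^bsub>colim i0 G t\<^esub>"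
    using k x cls_carrier by blast
qed

end

text \<open>Only closure and compatibility are asked of \<open>h\<close>, since naturality compares
  values of induced maps. Where a homomorphism is wanted, additivity comes from \<open>d_hom\<close>
  in the locale \<open>interleaved\<close>.\<close>

locale system_map = src: direct_system i0 G t + tgt: direct_system i0 G' t'
  for i0 and G :: "nat \<Rightarrow> 'b monoid" and t and G' :: "nat \<Rightarrow> 'c monoid" and t' +
  fixes h :: "nat \<Rightarrow> 'b \<Rightarrow> 'c"
  assumes map_closed: "i0 \<le> i \<Longrightarrow> x \<in> carrier (G i) \<Longrightarrow> h i x \<in> carrier (G' i)"
    and map_comm: "i0 \<le> i \<Longrightarrow> x \<in> carrier (G i) \<Longrightarrow> h (Suc i) (t i x) = t' i (h i x)"
begin

lemma map_transit:
  assumes "i0 \<le> i" "i \<le> k" "x \<in> carrier (G i)"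
  shows "h k (src.transit i k x) = tgt.transit i k (h i x)"
  using assms(2) by (induction k rule: dec_induct)
    (use assms in \<open>simp_all add: src.transit_Suc tgt.transit_Suc map_comm src.transit_closed\<close>)

text \<open>Well-definedness: two representatives of a class agree at some later stage, and
  \<open>map_transit\<close> carries this agreement to the target. The union in
  \<open>colim_map\<close> is then constant over a nonempty set.\<close>

lemma colim_map_cls:
  assumes i: "i0 \<le> i" and x: "x \<in> carrier (G i)"
  shows "colim_map i0 G' t' h (src.cls i x) = tgt.cls i (h i x)"
proof -
  have *: "tgt.cls j (h j y) = tgt.cls i (h i x)" if "(j, y) \<in> src.cls i x" for j y
  proof -
    have j: "i0 \<le> j" "y \<in> carrier (G j)" "src.cls j y = src.cls i x"
      using that by (auto simp: src.in_cls)
    then obtain k where k: "j \<le> k" "i \<le> k" "src.transit j k y = src.transit i k x"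
      using src.cls_eq_iff i x by blast
    then have "tgt.transit j k (h j y) = tgt.transit i k (h i x)"
      using i j x by (metis map_transit)
    then show ?thesis using k i j x map_closed by (subst tgt.cls_eq_iff) auto
  qed
  have "(i, x) \<in> src.cls i x" using i x by (simp add: src.in_cls)
  then have ne: "src.cls i x \<noteq> {}" by blast
  have "(\<Union>(j, y)\<in>src.cls i x. tgt.cls j (h j y)) = tgt.cls i (h i x)"
  proof (rule SUP_eq_const[OF ne])
    fix p assume "p \<in> src.cls i x"
    then show "(case p of (j, y) \<Rightarrow> tgt.cls j (h j y)) = tgt.cls i (h i x)"
      using *[of "fst p" "snd p"] by (simp add: case_prod_unfold)
  qed
  then show ?thesis by (simp only: colim_map_def tgt.cls_def)
qed

lemma colim_map_closed:
  "a \<in> carrier (colim i0 G t) \<Longrightarrow> colim_map i0 G' t' h a \<in> carrier (colim i0 G' t')"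
  by (auto simp: src.carrier_colim colim_map_cls tgt.cls_carrier map_closed)

end

text \<open>A single zigzag \<open>G i\<close>, \<open>H i\<close>, \<open>G (Suc i)\<close>,
  \<open>H (Suc i)\<close>, ... with maps \<open>d\<close> and \<open>b\<close> in turn. The two
  systems are its alternate terms, with the two-step composites as transition maps.\<close>

locale interleaved = src: direct_system i0 G "\<lambda>i. b i \<circ> d i" + tgt: direct_system i0 H
    "\<lambda>i. d (Suc i) \<circ> b i"
  for i0 and G :: "nat \<Rightarrow> 'b monoid" and H :: "nat \<Rightarrow> 'c monoid"
    and d :: "nat \<Rightarrow> 'b \<Rightarrow> 'c" and b :: "nat \<Rightarrow> 'c \<Rightarrow> 'b" +
  assumes d_hom: "i0 \<le> i \<Longrightarrow> d i \<in> hom (G i) (H i)"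
    and b_hom: "i0 \<le> i \<Longrightarrow> b i \<in> hom (H i) (G (Suc i))"
begin

lemma d_closed: "i0 \<le> i \<Longrightarrow> x \<in> carrier (G i) \<Longrightarrow> d i x \<in> carrier (H i)"
  using d_hom by (auto simp: hom_def)

lemma b_closed: "i0 \<le> i \<Longrightarrow> x \<in> carrier (H i) \<Longrightarrow> b i x \<in> carrier (G (Suc i))"
  using b_hom by (auto simp: hom_def)

sublocale system_map i0 G "\<lambda>i. b i \<circ> d i" H "\<lambda>i. d (Suc i) \<circ> b i" d
  by unfold_locales (auto simp: d_closed)

abbreviation colim_d where
  "colim_d \<equiv> colim_map i0 H (\<lambda>i. d (Suc i) \<circ> b i) d"

lemma colim_d_iso:
  "colim_d \<in> iso (colim i0 G (\<lambda>i. b i \<circ> d i)) (colim i0 H (\<lambda>i. d (Suc i) \<circ> b i))"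
    (is "_ \<in> iso ?G ?H")
proof (rule isoI)
  show "colim_d \<in> hom ?G ?H"
  proof (rule homI)
    fix a c assume "a \<in> carrier ?G" "c \<in> carrier ?G"
    then obtain k x y where k: "i0 \<le> k" and xy: "x \<in> carrier (G k)" "y \<in> carrier (G k)"
      and [simp]: "a = src.cls k x" "c = src.cls k y" by (rule src.colimE2)
    interpret comm_group "G k" by (rule src.comm_group_obj[OF k])
    show "colim_d (a \<otimes>\<^bsub>?G\<^esub> c) = colim_d a \<otimes>\<^bsub>?H\<^esub> colim_d c"
      using k xy hom_mult[OF d_hom[OF k]]
      by (simp add: src.mult_cls tgt.mult_cls colim_map_cls d_closed)
  qed (rule colim_map_closed)
  show "bij_betw colim_d (carrier ?G) (carrier ?H)"
  proof (rule bij_betw_imageI)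
    show "inj_on colim_d (carrier ?G)"
    proof (rule inj_onI)
      fix a c assume ac: "a \<in> carrier ?G" "c \<in> carrier ?G" and eq: "colim_d a = colim_d c"
      from ac obtain k x y where k: "i0 \<le> k" and xy: "x \<in> carrier (G k)" "y \<in> carrier (G k)"
        and [simp]: "a = src.cls k x" "c = src.cls k y" by (rule src.colimE2)
      have "tgt.cls k (d k x) = tgt.cls k (d k y)" using eq k xy by (simp add: colim_map_cls)
      then obtain m where m: "k \<le> m" "tgt.transit k m (d k x) = tgt.transit k m (d k y)"
        using k xy by (subst (asm) tgt.cls_eq_iff) (auto simp: d_closed)
      then have "d m (src.transit k m x) = d m (src.transit k m y)"
        using k xy by (simp add: map_transit)
      \<comment> \<open>Applying \<open>b m\<close> to the equality turns \<open>d m\<close> into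
        the transition map of \<open>G\<close>, so \<open>x\<close> and \<open>y\<close> agree one
        stage later.\<close>
      then have "src.transit k (Suc m) x = src.transit k (Suc m) y"
        using m by (simp add: src.transit_Suc)
      then show "a = c" using k xy m
        by (simp add: src.cls_eq_iff) (metis le_SucI)
    qed
    show "colim_d ` carrier ?G = carrier ?H"
    proof
      show "carrier ?H \<subseteq> colim_d ` carrier ?G"
      proof
        fix c assume "c \<in> carrier ?H"
        then obtain i y where i: "i0 \<le> i" "y \<in> carrier (H i)" and c: "c = tgt.cls i y"
          by (auto simp: tgt.carrier_colim)
        \<comment> \<open>Moving \<open>y\<close> one stage on passes through
          \<open>G (Suc i)\<close>, which exhibits \<open>b i y\<close> as a preimage.\<close>
        have "c = tgt.cls (Suc i) (d (Suc i) (b i y))"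
          using tgt.cls_transit[of i "Suc i" y] i c by (simp add: tgt.transit_Suc)
        then have "c = colim_d (src.cls (Suc i) (b i y))"
          using i by (simp add: colim_map_cls b_closed)
        then show "c \<in> colim_d ` carrier ?G" using i by (simp add: src.cls_carrier b_closed)
      qed
    qed (auto simp: colim_map_closed)
  qed
qed

end

lemma interleavedI:
  assumes "\<And>i. i0 \<le> i \<Longrightarrow> comm_group (G i)" "\<And>i. i0 \<le> i \<Longrightarrow> comm_group (H i)"
    and d: "\<And>i. i0 \<le> i \<Longrightarrow> d i \<in> hom (G i) (H i)"
    and b: "\<And>i. i0 \<le> i \<Longrightarrow> b i \<in> hom (H i) (G (Suc i))"
  shows "interleaved i0 G H d b"
proof (intro interleaved.intro direct_system.intro interleaved_axioms.intro)
  fix i assume "i0 \<le> i"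
  then show "b i \<circ> d i \<in> hom (G i) (G (Suc i))" "d (Suc i) \<circ> b i \<in> hom (H i) (H (Suc i))"
    using b[of i] d[of i] d[of "Suc i"] by (auto simp: hom_def Pi_iff)
qed (use assms in blast)+

text \<open>\<open>act\<close> and \<open>act'\<close> are the actions of a pair of lifts on the two
  systems. The square for \<open>b\<close> has \<open>act\<close> at \<open>Suc i\<close> because
  \<open>b\<close> raises the stage. The second conclusion is the inverse transformation, for use
  when the interleaving runs opposite to the desired isomorphism.\<close>

lemma natural_iso_interleaved:
  fixes G :: "'o \<Rightarrow> 'o \<Rightarrow> nat \<Rightarrow> 'x monoid" and H :: "'o \<Rightarrow> 'o \<Rightarrow> nat \<Rightarrow> 'y monoid"
  assumes sys: "\<And>M N. M \<in> Obj A \<Longrightarrow> N \<in> Obj A \<Longrightarrow> interleaved i0 (G M N) (H M N) (d M N) (b M N)"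
    and act: "\<And>M N M' N' f g F F'. \<lbrakk>M \<in> Obj A; N \<in> Obj A; M' \<in> Obj A; N' \<in> Obj A;
        f \<in> Hom A M' M; g \<in> Hom A N N'; lift M' M f F; lift N N' g F'\<rbrakk> \<Longrightarrow>
      (\<forall>i\<ge>i0. (\<forall>x\<in>carrier (G M N i). act F F' i x \<in> carrier (G M' N' i) \<and>
              d M' N' i (act F F' i x) = act' F F' i (d M N i x)) \<and>
            (\<forall>y\<in>carrier (H M N i). act' F F' i y \<in> carrier (H M' N' i) \<and>
              b M' N' i (act' F F' i y) = act F F' (Suc i) (b M N i y)))"
  defines "X \<equiv> \<lambda>M N. colim i0 (G M N) (\<lambda>i. b M N i \<circ> d M N i)"
    and "Y \<equiv> \<lambda>M N. colim i0 (H M N) (\<lambda>i. d M N (Suc i) \<circ> b M N i)"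
  defines "Xmap \<equiv> \<lambda>M N F F'. colim_map i0 (G M N) (\<lambda>i. b M N i \<circ> d M N i) (act F F')"
    and "Ymap \<equiv> \<lambda>M N F F'. colim_map i0 (H M N) (\<lambda>i. d M N (Suc i) \<circ> b M N i) (act' F F')"
    and "\<phi> \<equiv> \<lambda>M N. colim_map i0 (H M N) (\<lambda>i. d M N (Suc i) \<circ> b M N i) (d M N)"
  shows "natural_iso A lift X Xmap Y Ymap \<phi>"
    and "natural_iso A lift Y Ymap X Xmap (\<lambda>M N. inv_into (carrier (X M N)) (\<phi> M N))"
proof -
  have grp: "comm_group (X M N)" "comm_group (Y M N)" "\<phi> M N \<in> iso (X M N) (Y M N)"
    if "M \<in> Obj A" "N \<in> Obj A" for M N
  proof -
    interpret interleaved i0 "G M N" "H M N" "d M N" "b M N" using sys that .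
    show "comm_group (X M N)" "comm_group (Y M N)" "\<phi> M N \<in> iso (X M N) (Y M N)"
      unfolding X_def Y_def \<phi>_def using src.comm_group_colim tgt.comm_group_colim colim_d_iso
        by auto
  qed
  have nat: "\<phi> M' N' (Xmap M' N' F F' x) = Ymap M' N' F F' (\<phi> M N x)"
      "Xmap M' N' F F' x \<in> carrier (X M' N')"
    if ob: "M \<in> Obj A" "N \<in> Obj A" "M' \<in> Obj A" "N' \<in> Obj A"
      and l: "f \<in> Hom A M' M" "g \<in> Hom A N N'" "lift M' M f F" "lift N N' g F'"
      and x: "x \<in> carrier (X M N)" for M N M' N' f g F F' x
  proof -
    note a = act[OF ob l, rule_format]
    interpret I: interleaved i0 "G M N" "H M N" "d M N" "b M N" using sys ob by blast
    interpret I': interleaved i0 "G M' N'" "H M' N'" "d M' N'" "b M' N'" using sys ob by blast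
    interpret x: system_map i0 "G M N" "\<lambda>i. b M N i \<circ> d M N i" "G M' N'" "\<lambda>i. b M' N' i \<circ> d M' N' i"
        "act F F'"
      by unfold_locales (use a I.d_closed in \<open>auto simp: Let_def\<close>)
    interpret y: system_map i0 "H M N" "\<lambda>i. d M N (Suc i) \<circ> b M N i" "H M' N'"
        "\<lambda>i. d M' N' (Suc i) \<circ> b M' N' i" "act' F F'"
      by unfold_locales (use a I.b_closed in \<open>auto simp: Let_def\<close>)
    show "\<phi> M' N' (Xmap M' N' F F' x) = Ymap M' N' F F' (\<phi> M N x)"
      using x a I.d_closed unfolding X_def \<phi>_def Xmap_def Ymap_def
      by (auto simp: I.src.carrier_colim x.colim_map_cls y.colim_map_cls I.colim_map_cls
        I'.colim_map_cls)
    show "Xmap M' N' F F' x \<in> carrier (X M' N')"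
      using x.colim_map_closed x unfolding X_def Xmap_def .
  qed
  show "natural_iso A lift X Xmap Y Ymap \<phi>"
    unfolding natural_iso_def
  proof (intro conjI ballI allI impI; (elim conjE)?)
    fix M N M' N' f g F F' x
    assume "M \<in> Obj A" "N \<in> Obj A" "M' \<in> Obj A" "N' \<in> Obj A"
      "f \<in> Hom A M' M" "g \<in> Hom A N N'" "lift M' M f F" "lift N N' g F'" "x \<in> carrier (X M N)"
    then show "\<phi> M' N' (Xmap M' N' F F' x) = Ymap M' N' F F' (\<phi> M N x)" by (rule nat(1))
  qed (rule grp; assumption)+
  show "natural_iso A lift Y Ymap X Xmap (\<lambda>M N. inv_into (carrier (X M N)) (\<phi> M N))"
    unfolding natural_iso_def
  proof (intro conjI ballI allI impI; (elim conjE)?)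
    fix M N assume ob: "M \<in> Obj A" "N \<in> Obj A"
    show "comm_group (Y M N)" "comm_group (X M N)" using grp ob by auto
    show "inv_into (carrier (X M N)) (\<phi> M N) \<in> iso (Y M N) (X M N)"
      using group.iso_set_sym[OF comm_group.axioms(2)[OF grp(1)[OF ob]] grp(3)[OF ob]] .
  next
    fix M N M' N' f g F F' y
    assume ob: "M \<in> Obj A" "N \<in> Obj A" "M' \<in> Obj A" "N' \<in> Obj A"
      and l: "f \<in> Hom A M' M" "g \<in> Hom A N N'" "lift M' M f F" "lift N N' g F'"
      and y: "y \<in> carrier (Y M N)"
    have bij: "bij_betw (\<phi> M N) (carrier (X M N)) (carrier (Y M N))"
      "bij_betw (\<phi> M' N') (carrier (X M' N')) (carrier (Y M' N'))"
      using grp ob by (auto simp: iso_def)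
    define x where "x = inv_into (carrier (X M N)) (\<phi> M N) y"
    have x: "x \<in> carrier (X M N)" "\<phi> M N x = y"
      using bij(1) y unfolding x_def
      by (auto simp: bij_betw_def f_inv_into_f inv_into_into)
    then show "inv_into (carrier (X M' N')) (\<phi> M' N') (Ymap M' N' F F' y) =
        Xmap M' N' F F' (inv_into (carrier (X M N)) (\<phi> M N) y)"
      using nat[OF ob l x(1)] bij_betw_imp_inj_on[OF bij(2)] unfolding x_def[symmetric]
      by (simp add: inv_into_f_eq)
  qed
qed

section \<open>Abelian categories and duality\<close>

text \<open>Objects and arrows are kept and only the structure maps are reversed, so a dual
  statement results from instantiating in \<open>opp A\<close> and simplifying. An extension becomes
  the swapped pair.\<close>

definition opp :: "('o, 'a) additive_data \<Rightarrow> ('o, 'a) additive_data" where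
  "opp A = \<lparr>Obj = Obj A, Arr = Arr A, Dom = Cod A, Cod = Dom A, Id = Id A,
     Cmp = (\<lambda>g f. Cmp A f g), Plus = Plus A, Zero = (\<lambda>X Y. Zero A Y X)\<rparr>"

lemma opp_simps [simp]:
  "Obj (opp A) = Obj A" "Arr (opp A) = Arr A" "Dom (opp A) = Cod A" "Cod (opp A) = Dom A"
  "Id (opp A) = Id A" "Cmp (opp A) g f = Cmp A f g" "Plus (opp A) = Plus A"
  "Zero (opp A) X Y = Zero A Y X"
  by (simp_all add: opp_def)

lemma Hom_opp [simp]: "Hom (opp A) X Y = Hom A Y X"
  by (auto simp: Hom_def)

lemma monic_opp [simp]: "monic (opp A) f = epic A f"
  and epic_opp [simp]: "epic (opp A) f = monic A f"
  by (auto simp: monic_def epic_def)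

lemma is_kernel_opp [simp]: "is_kernel (opp A) f g = is_cokernel A f g"
  and is_cokernel_opp [simp]: "is_cokernel (opp A) f g = is_kernel A f g"
  by (auto simp: is_kernel_def is_cokernel_def)

lemma short_exact_opp [simp]: "short_exact (opp A) f g = short_exact A g f"
  by (auto simp: short_exact_def)

text \<open>Composability becomes a matter of equations between domains and codomains, which simp
  can discharge. The rule is removed where a Hom set has to stay intact, for instance as the range
  of a bounded quantifier.\<close>

lemma mem_Hom [simp]: "f \<in> Hom A X Y \<longleftrightarrow> f \<in> Arr A \<and> Dom A f = X \<and> Cod A f = Y"
  by (simp add: Hom_def)

section \<open>Calculus of arrows in categories and preadditive categories\<close>

context category
begin

abbreviation comp (infixr "\<cdot>" 70) where "g \<cdot> f \<equiv> Cmp A g f"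

lemma Cmp_arr [simp]:
  assumes "f \<in> Arr A" "g \<in> Arr A" "Cod A f = Dom A g"
  shows "g \<cdot> f \<in> Arr A" "Dom A (g \<cdot> f) = Dom A f" "Cod A (g \<cdot> f) = Cod A g"
  using Cmp_closed[of f "Dom A f" "Cod A f" g "Cod A g"] assms by auto

lemma Id_arr [simp]:
  assumes "X \<in> Obj A" shows "Id A X \<in> Arr A" "Dom A (Id A X) = X" "Cod A (Id A X) = X"
  using Id_closed[OF assms] by auto

lemma Cmp_assoc' [simp]:
  assumes "f \<in> Arr A" "g \<in> Arr A" "h \<in> Arr A" "Cod A f = Dom A g" "Cod A g = Dom A h"
  shows "(h \<cdot> g) \<cdot> f = h \<cdot> (g \<cdot> f)"
  using Cmp_assoc[of f "Dom A f" "Cod A f" g "Cod A g" h "Cod A h"] assms by auto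

lemma Cmp_Id [simp]:
  assumes "f \<in> Arr A"
  shows "Dom A f = X \<Longrightarrow> f \<cdot> Id A X = f" "Cod A f = X \<Longrightarrow> Id A X \<cdot> f = f"
  using Cmp_Id_left[of f "Dom A f" "Cod A f"] Cmp_Id_right[of f "Dom A f" "Cod A f"] assms by auto

lemma arr_Obj [simp]: "f \<in> Arr A \<Longrightarrow> Dom A f \<in> Obj A" "f \<in> Arr A \<Longrightarrow> Cod A f \<in> Obj A"
  by (rule Dom_closed Cod_closed; assumption)+

text \<open>Composites are normalised to the right, so an equation for \<open>g \<cdot> f\<close>
  does not rewrite inside \<open>g \<cdot> (f \<cdot> x)\<close>; this is the form that
  does.\<close>

lemma Cmp_eq_extend:
  assumes "g \<cdot> f = u" "f \<in> Arr A" "g \<in> Arr A" "x \<in> Arr A" "Cod A f = Dom A g" "Cod A x = Dom A f"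
  shows "g \<cdot> (f \<cdot> x) = u \<cdot> x"
  using assms by auto

lemma monicD: "\<lbrakk>monic A f; f \<cdot> g = f \<cdot> h; g \<in> Arr A; h \<in> Arr A; Dom A g = Dom A h;
    Cod A g = Dom A f; Cod A h = Dom A f\<rbrakk> \<Longrightarrow> g = h"
  unfolding monic_def by force

lemma epicD: "\<lbrakk>epic A f; g \<cdot> f = h \<cdot> f; g \<in> Arr A; h \<in> Arr A; Dom A g = Cod A f;
    Dom A h = Cod A f; Cod A g = Cod A h\<rbrakk> \<Longrightarrow> g = h"
  unfolding epic_def by force

lemma category_opp: "category (opp A)"
  by unfold_locales auto

end

context preadditive_category
begin

abbreviation plus (infixl "\<oplus>" 65) where "f \<oplus> g \<equiv> Plus A f g"

definition Neg where
  "Neg f = inv\<^bsub>Hom_group A (Dom A f) (Cod A f)\<^esub> f"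

lemma Hom_group_simps [simp]:
  "carrier (Hom_group A X Y) = Hom A X Y" "f \<otimes>\<^bsub>Hom_group A X Y\<^esub> g = f \<oplus> g"
  "\<one>\<^bsub>Hom_group A X Y\<^esub> = Zero A X Y"
  by (simp_all add: Hom_group_def)

lemma Plus_arr [simp]:
  assumes "f \<in> Arr A" "g \<in> Arr A" "Dom A f = Dom A g" "Cod A f = Cod A g"
  shows "f \<oplus> g \<in> Arr A" "Dom A (f \<oplus> g) = Dom A g" "Cod A (f \<oplus> g) = Cod A g"
proof -
  interpret comm_group "Hom_group A (Dom A g) (Cod A g)" using Hom_comm_group assms by simp
  show "f \<oplus> g \<in> Arr A" "Dom A (f \<oplus> g) = Dom A g" "Cod A (f \<oplus> g) = Cod A g"
    using m_closed[of f g] assms by auto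
qed

lemma Neg_arr [simp]:
  assumes "f \<in> Arr A"
  shows "Neg f \<in> Arr A" "Dom A (Neg f) = Dom A f" "Cod A (Neg f) = Cod A f"
proof -
  interpret comm_group "Hom_group A (Dom A f) (Cod A f)" using Hom_comm_group assms by simp
  show "Neg f \<in> Arr A" "Dom A (Neg f) = Dom A f" "Cod A (Neg f) = Cod A f"
    using inv_closed[of f] assms by (auto simp: Neg_def)
qed

lemma Zero_arr [simp]:
  assumes "X \<in> Obj A" "Y \<in> Obj A"
  shows "Zero A X Y \<in> Arr A" "Dom A (Zero A X Y) = X" "Cod A (Zero A X Y) = Y"
proof -
  interpret comm_group "Hom_group A X Y" using Hom_comm_group assms by simp
  show "Zero A X Y \<in> Arr A" "Dom A (Zero A X Y) = X" "Cod A (Zero A X Y) = Y"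
    using one_closed by auto
qed

lemma Plus_assoc:
  assumes "f \<in> Arr A" "g \<in> Arr A" "h \<in> Arr A" "Dom A f = Dom A g" "Cod A f = Cod A g"
    "Dom A h = Dom A g" "Cod A h = Cod A g"
  shows "(f \<oplus> g) \<oplus> h = f \<oplus> (g \<oplus> h)"
proof -
  interpret comm_group "Hom_group A (Dom A g) (Cod A g)" using Hom_comm_group assms by simp
  show ?thesis using m_assoc[of f g h] assms by auto
qed

lemma Plus_Zero [simp]:
  assumes "f \<in> Arr A" "Dom A f = X" "Cod A f = Y"
  shows "f \<oplus> Zero A X Y = f" "Zero A X Y \<oplus> f = f"
proof -
  interpret comm_group "Hom_group A X Y" using Hom_comm_group assms by auto
  show "f \<oplus> Zero A X Y = f" "Zero A X Y \<oplus> f = f" using r_one[of f] l_one[of f] assms by auto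
qed

lemma Plus_Neg [simp]:
  assumes "f \<in> Arr A"
  shows "f \<oplus> Neg f = Zero A (Dom A f) (Cod A f)" "Neg f \<oplus> f = Zero A (Dom A f) (Cod A f)"
proof -
  interpret comm_group "Hom_group A (Dom A f) (Cod A f)" using Hom_comm_group assms by simp
  show "f \<oplus> Neg f = Zero A (Dom A f) (Cod A f)" "Neg f \<oplus> f = Zero A (Dom A f) (Cod A f)"
    using r_inv[of f] l_inv[of f] assms by (auto simp: Neg_def)
qed

lemma eq_if_diff_Zero:
  assumes "f \<oplus> Neg g = Zero A X Y" "f \<in> Arr A" "g \<in> Arr A" "Dom A f = X" "Dom A g = X"
    "Cod A f = Y" "Cod A g = Y"
  shows "f = g"
proof -
  have "f = (f \<oplus> Neg g) \<oplus> g" using assms(2-) by (simp add: Plus_assoc)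
  then show ?thesis unfolding assms(1) using assms(2-) by simp
qed

lemma Plus_left_cancel:
  assumes "f \<oplus> g = f \<oplus> h" "f \<in> Arr A" "g \<in> Arr A" "h \<in> Arr A" "Dom A g = Dom A f"
    "Cod A g = Cod A f" "Dom A h = Dom A f" "Cod A h = Cod A f"
  shows "g = h"
proof -
  have "Neg f \<oplus> (f \<oplus> g) = g" "Neg f \<oplus> (f \<oplus> h) = h"
    using assms(2-) by (simp_all flip: Plus_assoc)
  then show ?thesis unfolding assms(1) by (rule trans[OF sym])
qed

lemma Cmp_distrib [simp]:
  assumes "f \<in> Arr A" "g \<in> Arr A" "Dom A f = Dom A g" "Cod A f = Cod A g" "h \<in> Arr A"
  shows "Cod A g = Dom A h \<Longrightarrow> h \<cdot> (f \<oplus> g) = h \<cdot> f \<oplus> h \<cdot> g"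
    and "Cod A h = Dom A g \<Longrightarrow> (f \<oplus> g) \<cdot> h = f \<cdot> h \<oplus> g \<cdot> h"
  using Cmp_Plus_right[of f "Dom A f" "Cod A f" g h "Cod A h"]
    Cmp_Plus_left[of h "Dom A h" "Cod A h" f "Cod A f" g] assms by auto

lemma Cmp_Zero [simp]:
  assumes "f \<in> Arr A" "X \<in> Obj A"
  shows "Dom A f = Y \<Longrightarrow> f \<cdot> Zero A X Y = Zero A X (Cod A f)"
    and "Cod A f = Y \<Longrightarrow> Zero A Y X \<cdot> f = Zero A (Dom A f) X"
proof -
  assume Y: "Dom A f = Y"
  have "f \<cdot> Zero A X Y \<oplus> f \<cdot> Zero A X Y = f \<cdot> (Zero A X Y \<oplus> Zero A X Y)"
    using Y assms by (subst Cmp_distrib) auto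
  also have "\<dots> = f \<cdot> Zero A X Y \<oplus> Zero A X (Cod A f)" using Y assms by auto
  finally show "f \<cdot> Zero A X Y = Zero A X (Cod A f)"
    by (rule Plus_left_cancel) (use Y assms in auto)
next
  assume Y: "Cod A f = Y"
  have "Zero A Y X \<cdot> f \<oplus> Zero A Y X \<cdot> f = (Zero A Y X \<oplus> Zero A Y X) \<cdot> f"
    using Y assms by (subst Cmp_distrib) auto
  also have "\<dots> = Zero A Y X \<cdot> f \<oplus> Zero A (Dom A f) X" using Y assms by auto
  finally show "Zero A Y X \<cdot> f = Zero A (Dom A f) X"
    by (rule Plus_left_cancel) (use Y assms in auto)
qed

lemma Cmp_Neg [simp]:
  assumes "f \<in> Arr A" "g \<in> Arr A" "Cod A f = Dom A g"
  shows "g \<cdot> Neg f = Neg (g \<cdot> f)" "Neg g \<cdot> f = Neg (g \<cdot> f)"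
proof -
  have "g \<cdot> f \<oplus> g \<cdot> Neg f = g \<cdot> f \<oplus> Neg (g \<cdot> f)"
    using assms by (subst Cmp_distrib[symmetric]) auto
  then show "g \<cdot> Neg f = Neg (g \<cdot> f)" by (rule Plus_left_cancel) (use assms in auto)
  have "g \<cdot> f \<oplus> Neg g \<cdot> f = g \<cdot> f \<oplus> Neg (g \<cdot> f)"
    using assms by (subst Cmp_distrib[symmetric]) auto
  then show "Neg g \<cdot> f = Neg (g \<cdot> f)" by (rule Plus_left_cancel) (use assms in auto)
qed

lemma Neg_Zero [simp]: "X \<in> Obj A \<Longrightarrow> Y \<in> Obj A \<Longrightarrow> Neg (Zero A X Y) = Zero A X Y"
  using Plus_Neg(1)[of "Zero A X Y"] Plus_Zero(2)[of "Neg (Zero A X Y)" X Y] by simp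

lemma monicI:
  assumes "f \<in> Arr A"
    and "\<And>z. z \<in> Arr A \<Longrightarrow> Cod A z = Dom A f \<Longrightarrow> f \<cdot> z = Zero A (Dom A z) (Cod A f) \<Longrightarrow>
      z = Zero A (Dom A z) (Dom A f)"
  shows "monic A f"
  unfolding monic_def
proof (intro conjI ballI impI)
  fix Z g h assume gh: "g \<in> Hom A Z (Dom A f)" "h \<in> Hom A Z (Dom A f)" "f \<cdot> g = f \<cdot> h"
  have "f \<cdot> (g \<oplus> Neg h) = Zero A Z (Cod A f)" using gh assms(1) by auto
  then have "g \<oplus> Neg h = Zero A Z (Dom A f)"
    using assms(2)[of "g \<oplus> Neg h"] gh assms(1) by auto
  then show "g = h" by (rule eq_if_diff_Zero) (use gh in auto)
qed (rule assms)

lemma preadditive_opp: "preadditive_category (opp A)"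
proof (intro preadditive_category.intro category_opp preadditive_category_axioms.intro)
  fix X Y assume "X \<in> Obj (opp A)" "Y \<in> Obj (opp A)"
  moreover have "Hom_group (opp A) X Y = Hom_group A Y X" by (simp add: Hom_group_def)
  ultimately show "comm_group (Hom_group (opp A) X Y)" by (simp add: Hom_comm_group)
qed auto

end

lemma is_zero_object_opp [simp]: "is_zero_object (opp A) Z = is_zero_object A Z"
  by (auto simp: is_zero_object_def simp del: mem_Hom)

lemma (in preadditive_category) is_biproduct_opp:
  "is_biproduct (opp A) X Y (P, i1, i2, p1, p2) \<longleftrightarrow> is_biproduct A X Y (P, p1, p2, i1, i2)"
  by (auto simp: is_biproduct_def)

definition inl :: "('o, 'a) additive_data \<Rightarrow> 'o \<Rightarrow> 'o \<Rightarrow> 'a" where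
  "inl A X Y = (case biproduct_choice A X Y of (_, i1, _, _, _) \<Rightarrow> i1)"

definition inr :: "('o, 'a) additive_data \<Rightarrow> 'o \<Rightarrow> 'o \<Rightarrow> 'a" where
  "inr A X Y = (case biproduct_choice A X Y of (_, _, i2, _, _) \<Rightarrow> i2)"

definition prl :: "('o, 'a) additive_data \<Rightarrow> 'o \<Rightarrow> 'o \<Rightarrow> 'a" where
  "prl A X Y = (case biproduct_choice A X Y of (_, _, _, p1, _) \<Rightarrow> p1)"

definition prr :: "('o, 'a) additive_data \<Rightarrow> 'o \<Rightarrow> 'o \<Rightarrow> 'a" where
  "prr A X Y = (case biproduct_choice A X Y of (_, _, _, _, p2) \<Rightarrow> p2)"

context abelian_category
begin

lemma abelian_opp: "abelian_category (opp A)"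
proof (intro abelian_category.intro preadditive_opp abelian_category_axioms.intro)
  fix X Y assume "X \<in> Obj (opp A)" "Y \<in> Obj (opp A)"
    then obtain P i1 i2 p1 p2 where "is_biproduct A X Y (P, i1, i2, p1, p2)"
      using biproducts by (metis opp_simps(1) prod_cases5)
    then have "is_biproduct (opp A) X Y (P, p1, p2, i1, i2)" by (simp add: is_biproduct_opp)
    then show "\<exists>P. is_biproduct (opp A) X Y P" by blast
qed (auto simp: zero_object kernels cokernels monic_normal epic_normal)

section \<open>Kernels, cokernels and the short five lemma\<close>

lemma kernel_arr:
  assumes "is_kernel A k f"
  shows "k \<in> Arr A" "f \<in> Arr A" "Cod A k = Dom A f" "f \<cdot> k = Zero A (Dom A k) (Cod A f)"
  using assms by (auto simp: is_kernel_def)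

lemma kernelE:
  assumes "is_kernel A k f" "g \<in> Arr A" "Cod A g = Dom A f" "f \<cdot> g = Zero A (Dom A g) (Cod A f)"
  obtains u where "u \<in> Arr A" "Dom A u = Dom A g" "Cod A u = Dom A k" "k \<cdot> u = g"
  using assms unfolding is_kernel_def by (metis arr_Obj(1) mem_Hom)

lemma kernel_monic: assumes "is_kernel A k f" shows "monic A k"
proof (rule monicI)
  note k = kernel_arr[OF assms]
  show "k \<in> Arr A" by (rule k)
  fix z assume z: "z \<in> Arr A" "Cod A z = Dom A k" "k \<cdot> z = Zero A (Dom A z) (Cod A k)"
  have "k \<cdot> Zero A (Dom A z) (Dom A k) = Zero A (Dom A z) (Dom A f)" using k z by simp
  moreover have "f \<cdot> Zero A (Dom A z) (Dom A f) = Zero A (Dom A z) (Cod A f)" using k z by simp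
  moreover have "Zero A (Dom A z) (Dom A f) \<in> Hom A (Dom A z) (Dom A f)" "Dom A z \<in> Obj A"
    using k z by auto
  ultimately show "z = Zero A (Dom A z) (Dom A k)"
    using assms z k unfolding is_kernel_def
    by (metis Zero_arr arr_Obj(1) mem_Hom)
qed

lemma kernelI:
  assumes "k \<in> Arr A" "f \<in> Arr A" "Cod A k = Dom A f" "f \<cdot> k = Zero A (Dom A k) (Cod A f)"
    "monic A k"
    and "\<And>g. g \<in> Arr A \<Longrightarrow> Cod A g = Dom A f \<Longrightarrow> f \<cdot> g = Zero A (Dom A g) (Cod A f) \<Longrightarrow>
      \<exists>u. u \<in> Hom A (Dom A g) (Dom A k) \<and> k \<cdot> u = g"
  shows "is_kernel A k f"
  unfolding is_kernel_def
proof (intro conjI ballI impI)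
  fix Z g assume "g \<in> Hom A Z (Dom A f)" "f \<cdot> g = Zero A Z (Cod A f)"
  then obtain u where "u \<in> Hom A Z (Dom A k)" "k \<cdot> u = g" using assms(6)[of g] by auto
  then show "\<exists>!u. u \<in> Hom A Z (Dom A k) \<and> k \<cdot> u = g"
    by (intro ex1I[of _ u]) (auto intro: monicD[OF assms(5)])
qed (use assms in auto)

lemmas cokernel_arr = abelian_category.kernel_arr[OF abelian_opp, simplified]
lemmas cokernelE = abelian_category.kernelE[OF abelian_opp, simplified]
lemmas cokernel_epic = abelian_category.kernel_monic[OF abelian_opp, simplified]
lemmas cokernelI = abelian_category.kernelI[OF abelian_opp, simplified]
lemmas epicI = preadditive_category.monicI[OF preadditive_opp, simplified]

text \<open>By normality \<open>g\<close> is the cokernel of some \<open>t\<close>. Since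
  \<open>g\<close> kills \<open>t\<close>, \<open>t\<close> factors through \<open>f\<close>;
  whatever kills \<open>f\<close> therefore kills \<open>t\<close> and factors through
  \<open>g\<close>. Short exactness can thus be checked as a kernel condition plus an
  epimorphism.\<close>

lemma epic_cokernel:
  assumes "is_kernel A f g" "epic A g" shows "is_cokernel A g f"
proof -
  note fg = kernel_arr[OF assms(1)]
  obtain t where t: "is_cokernel A g t" using epic_normal assms(2) by blast
  note ga = cokernel_arr[OF t]
  obtain s where s: "s \<in> Arr A" "Dom A s = Dom A t" "Cod A s = Dom A f" "f \<cdot> s = t"
    using kernelE[OF assms(1), of t] ga by auto
  show ?thesis
  proof (rule cokernelI)
    fix u assume u: "u \<in> Arr A" "Dom A u = Cod A f" "u \<cdot> f = Zero A (Dom A f) (Cod A u)"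
    have "u \<cdot> t = (u \<cdot> f) \<cdot> s" using s(1-3) u(1,2) fg by (simp flip: s(4))
    also have "\<dots> = Zero A (Dom A t) (Cod A u)" unfolding u(3) using s(1-3) u(1,2) fg by simp
    finally show "\<exists>v. v \<in> Arr A \<and> Dom A v = Cod A g \<and> Cod A v = Cod A u \<and> v \<cdot> g = u"
      using cokernelE[OF t, of u] u fg ga by metis
  qed (use fg assms(2) in auto)
qed

text \<open>Being monic, \<open>f\<close> is the kernel of some \<open>t\<close>; being epic, it
  forces \<open>t\<close> to vanish. The identity then lifts through \<open>f\<close> and gives a
  right inverse, which is two-sided because \<open>f\<close> is monic.\<close>

lemma iso_if_monic_epic:
  assumes "monic A f" "epic A f" shows "is_iso A f"
proof -
  have f: "f \<in> Arr A" using assms by (simp add: monic_def)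
  obtain t where t: "is_kernel A f t" using monic_normal assms(1) by blast
  note ta = kernel_arr[OF t]
  have t0: "t = Zero A (Cod A f) (Cod A t)"
    by (rule epicD[OF assms(2)]) (use ta f in auto)
  obtain s where s: "s \<in> Arr A" "Dom A s = Cod A f" "Cod A s = Dom A f" "f \<cdot> s = Id A (Cod A f)"
    using kernelE[OF t, of "Id A (Cod A f)"] ta t0 f by auto
  have "f \<cdot> (s \<cdot> f) = f \<cdot> Id A (Dom A f)"
    using f s Cmp_eq_extend[OF s(4), of f] by simp
  then have "s \<cdot> f = Id A (Dom A f)" by (rule monicD[OF assms(1)]) (use f s in auto)
  then show ?thesis unfolding is_iso_def using f s by (auto intro!: bexI[of _ s])
qed

lemma short_exact_arr:
  assumes "short_exact A f g"
  shows "f \<in> Arr A" "g \<in> Arr A" "Dom A g = Cod A f" "g \<cdot> f = Zero A (Dom A f) (Cod A g)"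
    "monic A f" "epic A g"
  using assms kernel_arr kernel_monic cokernel_epic by (auto simp: short_exact_def)

lemma short_exact_lift:
  assumes "short_exact A f g" "u \<in> Arr A" "Cod A u = Cod A f" "g \<cdot> u = Zero A (Dom A u) (Cod A g)"
  obtains v where "v \<in> Arr A" "Dom A v = Dom A u" "Cod A v = Dom A f" "f \<cdot> v = u"
  using kernelE[of f g u] assms short_exact_arr[OF assms(1)] by (auto simp: short_exact_def)

lemma short_exact_colift:
  assumes "short_exact A f g" "u \<in> Arr A" "Dom A u = Cod A f" "u \<cdot> f = Zero A (Dom A f) (Cod A u)"
  obtains v where "v \<in> Arr A" "Dom A v = Cod A g" "Cod A v = Cod A u" "v \<cdot> g = u"
  using cokernelE[of g f u] assms short_exact_arr[OF assms(1)] by (auto simp: short_exact_def)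

text \<open>The monic half of the short five lemma; the epic half is its dual.\<close>

lemma short_exact_middle_monic:
  assumes E: "short_exact A f g" "short_exact A f' g'" and h: "h \<in> Hom A (Cod A f) (Cod A f')"
    and "Dom A f' = Dom A f" "Cod A g' = Cod A g" "h \<cdot> f = f'" "g' \<cdot> h = g"
  shows "monic A h"
proof (rule monicI)
  note fg = short_exact_arr[OF E(1)] short_exact_arr[OF E(2)]
  show "h \<in> Arr A" using h by simp
  fix z assume z: "z \<in> Arr A" "Cod A z = Dom A h" "h \<cdot> z = Zero A (Dom A z) (Cod A h)"
  have "g \<cdot> z = g' \<cdot> (h \<cdot> z)" using assms z fg by (metis Cmp_eq_extend mem_Hom)
  also have "\<dots> = Zero A (Dom A z) (Cod A g)" using assms z fg by simp
  finally obtain w where w: "w \<in> Arr A" "Dom A w = Dom A z" "Cod A w = Dom A f" "f \<cdot> w = z"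
    using short_exact_lift[OF E(1), of z] z h by auto
  have "f' \<cdot> w = h \<cdot> z" using w assms fg by (metis Cmp_eq_extend mem_Hom)
  then have "f' \<cdot> w = f' \<cdot> Zero A (Dom A z) (Dom A f')" using z fg h by simp
  then have "w = Zero A (Dom A z) (Dom A f')"
    by (rule monicD[OF fg(11)]) (use w z fg h assms in auto)
  then show "z = Zero A (Dom A z) (Dom A h)" using w(4) fg h assms z by auto
qed

lemmas short_exact_middle_epic =
  abelian_category.short_exact_middle_monic[OF abelian_opp, simplified]

lemma short_exact_middle_iso:
  assumes "short_exact A f g" "short_exact A f' g'" "h \<in> Hom A (Cod A f) (Cod A f')"
    "Dom A f' = Dom A f" "Cod A g' = Cod A g" "h \<cdot> f = f'" "g' \<cdot> h = g"
  shows "is_iso A h"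
proof (rule iso_if_monic_epic)
  show "monic A h" using short_exact_middle_monic assms by blast
  have "h \<in> Arr A \<and> Dom A h = Dom A g \<and> Cod A h = Dom A g'"
    using assms(3) short_exact_arr(3)[OF assms(1)] short_exact_arr(3)[OF assms(2)] by simp
  then show "epic A h"
    using short_exact_middle_epic[OF assms(2,1) _ assms(5)[symmetric] assms(4)[symmetric]
      assms(7,6)] by blast
qed

section \<open>The chosen biproducts\<close>

lemma biproduct_choiceE:
  assumes "X \<in> Obj A" "Y \<in> Obj A"
  obtains P i1 i2 p1 p2 where "biproduct_choice A X Y = (P, i1, i2, p1, p2)"
    "P \<in> Obj A" "i1 \<in> Arr A" "Dom A i1 = X" "Cod A i1 = P" "i2 \<in> Arr A" "Dom A i2 = Y"
      "Cod A i2 = P"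
    "p1 \<in> Arr A" "Dom A p1 = P" "Cod A p1 = X" "p2 \<in> Arr A" "Dom A p2 = P" "Cod A p2 = Y"
    "p1 \<cdot> i1 = Id A X" "p2 \<cdot> i2 = Id A Y" "p2 \<cdot> i1 = Zero A X Y" "p1 \<cdot> i2 = Zero A Y X"
    "i1 \<cdot> p1 \<oplus> i2 \<cdot> p2 = Id A P"
proof -
  have "is_biproduct A X Y (biproduct_choice A X Y)"
    unfolding biproduct_choice_def using biproducts[OF assms] by (rule someI_ex)
  then show ?thesis using that
    by (cases "biproduct_choice A X Y") (auto simp: is_biproduct_def)
qed

lemma biproduct_arr [simp]:
  assumes "X \<in> Obj A" "Y \<in> Obj A"
  shows "oplus_obj A X Y \<in> Obj A"
    "inl A X Y \<in> Arr A" "Dom A (inl A X Y) = X" "Cod A (inl A X Y) = oplus_obj A X Y"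
    "inr A X Y \<in> Arr A" "Dom A (inr A X Y) = Y" "Cod A (inr A X Y) = oplus_obj A X Y"
    "prl A X Y \<in> Arr A" "Dom A (prl A X Y) = oplus_obj A X Y" "Cod A (prl A X Y) = X"
    "prr A X Y \<in> Arr A" "Dom A (prr A X Y) = oplus_obj A X Y" "Cod A (prr A X Y) = Y"
    "prl A X Y \<cdot> inl A X Y = Id A X" "prr A X Y \<cdot> inr A X Y = Id A Y"
    "prr A X Y \<cdot> inl A X Y = Zero A X Y" "prl A X Y \<cdot> inr A X Y = Zero A Y X"
    "inl A X Y \<cdot> prl A X Y \<oplus> inr A X Y \<cdot> prr A X Y = Id A (oplus_obj A X Y)"
  by (rule biproduct_choiceE[OF assms]; simp add: oplus_obj_def inl_def inr_def prl_def prr_def)+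

lemma biproduct_comp [simp]:
  assumes "X \<in> Obj A" "Y \<in> Obj A" "x \<in> Arr A"
  shows "Cod A x = X \<Longrightarrow> prl A X Y \<cdot> inl A X Y \<cdot> x = x"
    "Cod A x = Y \<Longrightarrow> prr A X Y \<cdot> inr A X Y \<cdot> x = x"
    "Cod A x = X \<Longrightarrow> prr A X Y \<cdot> inl A X Y \<cdot> x = Zero A (Dom A x) Y"
    "Cod A x = Y \<Longrightarrow> prl A X Y \<cdot> inr A X Y \<cdot> x = Zero A (Dom A x) X"
proof -
  show "prl A X Y \<cdot> inl A X Y \<cdot> x = x" if "Cod A x = X"
    using Cmp_eq_extend[OF biproduct_arr(14)[OF assms(1,2)], of x] assms that by simp
  show "prr A X Y \<cdot> inr A X Y \<cdot> x = x" if "Cod A x = Y"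
    using Cmp_eq_extend[OF biproduct_arr(15)[OF assms(1,2)], of x] assms that by simp
  show "prr A X Y \<cdot> inl A X Y \<cdot> x = Zero A (Dom A x) Y" if "Cod A x = X"
    using Cmp_eq_extend[OF biproduct_arr(16)[OF assms(1,2)], of x] assms that by simp
  show "prl A X Y \<cdot> inr A X Y \<cdot> x = Zero A (Dom A x) X" if "Cod A x = Y"
    using Cmp_eq_extend[OF biproduct_arr(17)[OF assms(1,2)], of x] assms that by simp
qed

lemma biproduct_eqI:
  assumes "X \<in> Obj A" "Y \<in> Obj A" "x \<in> Arr A" "y \<in> Arr A" "Dom A x = Dom A y"
    "Cod A x = oplus_obj A X Y" "Cod A y = oplus_obj A X Y"
    and eq: "prl A X Y \<cdot> x = prl A X Y \<cdot> y" "prr A X Y \<cdot> x = prr A X Y \<cdot> y"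
  shows "x = y"
proof -
  have "z = inl A X Y \<cdot> prl A X Y \<cdot> z \<oplus> inr A X Y \<cdot> prr A X Y \<cdot> z"
    if "z \<in> Arr A" "Cod A z = oplus_obj A X Y" for z
  proof -
    have "z = (inl A X Y \<cdot> prl A X Y \<oplus> inr A X Y \<cdot> prr A X Y) \<cdot> z"
      using that assms(1,2) by (simp only: biproduct_arr) simp
    then show ?thesis using that assms(1,2) by (simp del: biproduct_arr(18))
  qed
  from this[of x] this[of y] show ?thesis using assms by simp
qed

lemma biproduct_coeqI:
  assumes "X \<in> Obj A" "Y \<in> Obj A" "x \<in> Arr A" "y \<in> Arr A" "Cod A x = Cod A y"
    "Dom A x = oplus_obj A X Y" "Dom A y = oplus_obj A X Y"
    and eq: "x \<cdot> inl A X Y = y \<cdot> inl A X Y" "x \<cdot> inr A X Y = y \<cdot> inr A X Y"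
  shows "x = y"
proof -
  have "z = (z \<cdot> inl A X Y) \<cdot> prl A X Y \<oplus> (z \<cdot> inr A X Y) \<cdot> prr A X Y"
    if "z \<in> Arr A" "Dom A z = oplus_obj A X Y" for z
  proof -
    have "z = z \<cdot> (inl A X Y \<cdot> prl A X Y \<oplus> inr A X Y \<cdot> prr A X Y)"
      using that assms(1,2) by (simp only: biproduct_arr) simp
    then show ?thesis using that assms(1,2) by (simp del: biproduct_arr(18))
  qed
  from this[of x] this[of y] show ?thesis using assms by (simp del: Cmp_assoc')
qed

text \<open>The pullback of \<open>g\<close> and \<open>a\<close> is constructed inside a biproduct.
  The last clause is the existence half of its universal property; the uniqueness half is used only
  within the proof.\<close>

lemma pullback_extension:
  assumes E: "short_exact A f g" and a: "a \<in> Arr A" "Cod A a = Cod A g"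
  obtains f' g' h where "short_exact A f' g'" "Dom A f' = Dom A f" "Cod A g' = Dom A a"
    "h \<in> Hom A (Cod A f') (Cod A f)" "h \<cdot> f' = f" "g \<cdot> h = a \<cdot> g'"
    "\<And>u v. \<lbrakk>u \<in> Arr A; v \<in> Arr A; Dom A v = Dom A u; Cod A u = Cod A f; Cod A v = Dom A a;
      g \<cdot> u = a \<cdot> v\<rbrakk> \<Longrightarrow> \<exists>w\<in>Hom A (Dom A u) (Cod A f'). h \<cdot> w = u \<and> g' \<cdot> w = v"
proof -
  note fg = short_exact_arr[OF E]
  have ob: "Cod A f \<in> Obj A" "Dom A a \<in> Obj A" using fg a by simp_all
  let ?P = "oplus_obj A (Cod A f) (Dom A a)"
  let ?i1 = "inl A (Cod A f) (Dom A a)" and ?i2 = "inr A (Cod A f) (Dom A a)"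
  let ?p1 = "prl A (Cod A f) (Dom A a)" and ?p2 = "prr A (Cod A f) (Dom A a)"
  \<comment> \<open>The difference of the two composites to \<open>Cod A g\<close>; its kernel is
    the pullback.\<close>
  define m where "m = g \<cdot> ?p1 \<oplus> Neg (a \<cdot> ?p2)"
  have m: "m \<in> Arr A" "Dom A m = ?P" "Cod A m = Cod A g" using fg(1-3) a ob by (auto simp: m_def)
  have mi: "m \<cdot> ?i1 = g" unfolding m_def using fg(1-3) a ob by simp
  obtain k where k: "is_kernel A k m" using kernels m by blast
  note ka = kernel_arr[OF k] and mk = kernel_monic[OF k]
  have kP: "Cod A k = ?P" using ka m by simp
  have pair: "\<exists>w\<in>Hom A (Dom A u) (Dom A k). ?p1 \<cdot> k \<cdot> w = u \<and> ?p2 \<cdot> k \<cdot> w = v"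
    if uv: "u \<in> Arr A" "v \<in> Arr A" "Dom A v = Dom A u" "Cod A u = Cod A f" "Cod A v = Dom A a"
      "g \<cdot> u = a \<cdot> v" for u v
  proof -
    let ?z = "?i1 \<cdot> u \<oplus> ?i2 \<cdot> v"
    have z: "?z \<in> Arr A" "Dom A ?z = Dom A u" "Cod A ?z = ?P" using uv ob by auto
    have zp: "?p1 \<cdot> ?z = u" "?p2 \<cdot> ?z = v" using uv ob by simp_all
    have "m \<cdot> ?z = g \<cdot> (?p1 \<cdot> ?z) \<oplus> Neg (a \<cdot> (?p2 \<cdot> ?z))"
      unfolding m_def using z fg(1-3) a ob by (simp del: Cmp_distrib(1))
    also have "\<dots> = Zero A (Dom A u) (Cod A m)" unfolding zp using uv fg(1-3) a m by simp
    finally obtain w where "w \<in> Arr A" "Dom A w = Dom A u" "Cod A w = Dom A k" "k \<cdot> w = ?z"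
      using kernelE[OF k, of ?z] z m by metis
    then show ?thesis using zp by (intro bexI[of _ w]) simp_all
  qed
  have joint: "w = w'"
    if w: "w \<in> Arr A" "w' \<in> Arr A" "Dom A w = Dom A w'" "Cod A w = Dom A k" "Cod A w' = Dom A k"
    and eq: "?p1 \<cdot> k \<cdot> w = ?p1 \<cdot> k \<cdot> w'" "?p2 \<cdot> k \<cdot> w = ?p2 \<cdot> k \<cdot> w'" for w w'
  proof (rule monicD[OF mk])
    show "k \<cdot> w = k \<cdot> w'" by (rule biproduct_eqI[OF ob]) (use w eq ka(1) kP in simp_all)
  qed (use w in simp_all)
  let ?g' = "?p2 \<cdot> k" and ?h = "?p1 \<cdot> k"
  have hg: "?h \<in> Arr A" "?g' \<in> Arr A" "Dom A ?h = Dom A k" "Dom A ?g' = Dom A k"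
    "Cod A ?h = Cod A f" "Cod A ?g' = Dom A a" using ka kP ob by auto
  have sq: "g \<cdot> ?h = a \<cdot> ?g'"
  proof (rule eq_if_diff_Zero)
    have "m \<cdot> k = g \<cdot> ?p1 \<cdot> k \<oplus> Neg (a \<cdot> ?p2 \<cdot> k)" unfolding m_def using ob fg a ka kP by simp
    then show "g \<cdot> ?h \<oplus> Neg (a \<cdot> ?g') = Zero A (Dom A k) (Cod A m)" using ka by simp
  qed (use ob fg a ka kP m in auto)
  \<comment> \<open>The pair consisting of \<open>f\<close> and zero is compatible because
    \<open>g\<close> kills \<open>f\<close>; it induces the new subobject.\<close>
  have "\<exists>w\<in>Hom A (Dom A f) (Dom A k). ?p1 \<cdot> k \<cdot> w = f \<and> ?p2 \<cdot> k \<cdot> w = Zero A (Dom A f) (Dom A a)"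
    by (rule pair) (use fg a in simp_all)
  then obtain f' where f'0: "f' \<in> Hom A (Dom A f) (Dom A k)"
    and f'1: "?p1 \<cdot> k \<cdot> f' = f" "?p2 \<cdot> k \<cdot> f' = Zero A (Dom A f) (Dom A a)" by blast
  from f'0 have f'2: "f' \<in> Arr A" "Dom A f' = Dom A f" "Cod A f' = Dom A k" by simp_all
  have f'h: "?h \<cdot> f' = f" "?g' \<cdot> f' = Zero A (Dom A f) (Dom A a)"
    using f'1 f'2 ka(1) kP ob by simp_all
  have "monic A f'"
  proof (rule monicI[OF f'2(1)])
    fix z assume z: "z \<in> Arr A" "Cod A z = Dom A f'" "f' \<cdot> z = Zero A (Dom A z) (Cod A f')"
    have "f \<cdot> z = ?h \<cdot> (f' \<cdot> z)"
      by (rule sym[OF Cmp_eq_extend[OF f'h(1)]]) (use f'2 z(1,2) hg in simp_all)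
    also have "\<dots> = f \<cdot> Zero A (Dom A z) (Dom A f)" unfolding z(3) using f'2 z(1,2) hg fg(1) by simp
    finally show "z = Zero A (Dom A z) (Dom A f')"
      unfolding f'2(2) by (rule monicD[OF fg(5)]) (use z(1,2) f'2 fg(1) in auto)
  qed
  have "is_kernel A f' ?g'"
  proof (rule kernelI)
    fix z assume z: "z \<in> Arr A" "Cod A z = Dom A ?g'" "?g' \<cdot> z = Zero A (Dom A z) (Cod A ?g')"
    have "g \<cdot> (?h \<cdot> z) = (a \<cdot> ?g') \<cdot> z"
      by (rule Cmp_eq_extend[OF sq]) (use z(1,2) hg fg(2,3) in simp_all)
    also have "\<dots> = a \<cdot> (?g' \<cdot> z)" using z(1,2) hg a by (intro Cmp_assoc') simp_all
    also have "\<dots> = Zero A (Dom A z) (Cod A g)" unfolding z(3) using hg a z(1,2) by simp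
    finally obtain w where w: "w \<in> Arr A" "Dom A w = Dom A z" "Cod A w = Dom A f" "f \<cdot> w = ?h \<cdot> z"
      using short_exact_lift[OF E, of "?h \<cdot> z"] z(1,2) hg by auto
    have 1: "?h \<cdot> (f' \<cdot> w) = f \<cdot> w"
      by (rule Cmp_eq_extend[OF f'h(1)]) (use f'2 w(1-3) hg in simp_all)
    have "?g' \<cdot> (f' \<cdot> w) = Zero A (Dom A f) (Dom A a) \<cdot> w"
      by (rule Cmp_eq_extend[OF f'h(2)]) (use f'2 w(1-3) hg in simp_all)
    then have 2: "?g' \<cdot> (f' \<cdot> w) = Zero A (Dom A z) (Dom A a)" using w(1-3) a by simp
    have "f' \<cdot> w = z"
    proof (rule joint)
      have "?h \<cdot> (f' \<cdot> w) = ?h \<cdot> z" using 1 w(4) by simp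
      then show "?p1 \<cdot> k \<cdot> f' \<cdot> w = ?p1 \<cdot> k \<cdot> z" using w(1-3) z(1,2) f'2 ka(1) kP ob hg by simp
      have "?g' \<cdot> (f' \<cdot> w) = ?g' \<cdot> z" using 2 z(3) hg by simp
      then show "?p2 \<cdot> k \<cdot> f' \<cdot> w = ?p2 \<cdot> k \<cdot> z" using w(1-3) z(1,2) f'2 ka(1) kP ob hg by simp
    qed (use w(1-3) z(1,2) f'2 hg in simp_all)
    then show "\<exists>u. u \<in> Hom A (Dom A z) (Dom A f') \<and> f' \<cdot> u = z" using w(1-3) f'2 by auto
  qed (use f'2 f'h hg \<open>monic A f'\<close> in simp_all)
  moreover have "epic A ?g'"
  proof -
    \<comment> \<open>\<open>m\<close> restricts to the epimorphism \<open>g\<close> on the first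
      summand. Once \<open>m\<close> is epic it is the cokernel of its kernel \<open>k\<close>,
      which allows maps that kill \<open>k\<close> to be factored.\<close>
    have "epic A m"
    proof (rule epicI)
      fix z assume z: "z \<in> Arr A" "Dom A z = Cod A m" "z \<cdot> m = Zero A (Dom A m) (Cod A z)"
      have "z \<cdot> g = (z \<cdot> m) \<cdot> ?i1" using mi z(1,2) m ob by simp
      also have "\<dots> = Zero A (Cod A g) (Cod A z) \<cdot> g" unfolding z(3) using z m ob fg by simp
      finally show "z = Zero A (Cod A m) (Cod A z)"
        unfolding m(3) by (rule epicD[OF fg(6)]) (use z m fg in auto)
    qed (rule m)
    then have mc: "is_cokernel A m k" using epic_cokernel k by blast
    show ?thesis
    proof (rule epicI)
      fix u assume u: "u \<in> Arr A" "Dom A u = Cod A ?g'" "u \<cdot> ?g' = Zero A (Dom A ?g') (Cod A u)"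
      \<comment> \<open>Since \<open>u \<cdot> ?p2\<close> kills \<open>k\<close>, it equals
        \<open>v \<cdot> m\<close> for some \<open>v\<close>. On the first summand this reads
        \<open>v \<cdot> g\<close> equals zero, so \<open>v\<close> vanishes; restricting to the
        second summand then gives that \<open>u\<close> vanishes.\<close>
      have "(u \<cdot> ?p2) \<cdot> k = Zero A (Dom A k) (Cod A u)" using u hg ka kP ob by simp
      then obtain v where v: "v \<in> Arr A" "Dom A v = Cod A m" "Cod A v = Cod A u" "v \<cdot> m = u \<cdot> ?p2"
        using cokernelE[OF mc, of "u \<cdot> ?p2"] u hg ka kP ob by auto
      have "v \<cdot> g = (u \<cdot> ?p2) \<cdot> ?i1" using v m ob mi by (simp flip: v(4))
      also have "\<dots> = Zero A (Cod A g) (Cod A u) \<cdot> g" using u hg ob fg by simp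
      finally have "v = Zero A (Cod A g) (Cod A u)"
        by (rule epicD[OF fg(6)]) (use v m u fg in auto)
      then have "u \<cdot> ?p2 = Zero A ?P (Cod A u)" using v m u by auto
      then have "(u \<cdot> ?p2) \<cdot> ?i2 = Zero A (Dom A a) (Cod A u)" using ob u by simp
      then show "u = Zero A (Cod A ?g') (Cod A u)" using ob u hg by simp
    qed (rule hg)
  qed
  ultimately have SE: "short_exact A f' ?g'" using epic_cokernel by (simp add: short_exact_def)
  show thesis
  proof (rule that[OF SE, of ?h])
    fix u v assume "u \<in> Arr A" "v \<in> Arr A" "Dom A v = Dom A u" "Cod A u = Cod A f"
        "Cod A v = Dom A a"
      "g \<cdot> u = a \<cdot> v"
    from pair[OF this] obtain w where "w \<in> Hom A (Dom A u) (Dom A k)" "?p1 \<cdot> k \<cdot> w = u"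
        "?p2 \<cdot> k \<cdot> w = v"
      by blast
    then show "\<exists>w\<in>Hom A (Dom A u) (Cod A f'). ?h \<cdot> w = u \<and> ?g' \<cdot> w = v"
      using f'2 ka(1) kP ob by (intro bexI[of _ w]) simp_all
  qed (use f'2 f'h sq hg in simp_all)
qed

end

section \<open>Yoneda extensions\<close>

abbreviation is_ext :: "('o, 'a) additive_data \<Rightarrow> 'a \<times> 'a \<Rightarrow> bool" where
  "is_ext A E \<equiv> short_exact A (fst E) (snd E)"

abbreviation sub :: "('o, 'a) additive_data \<Rightarrow> 'a \<times> 'a \<Rightarrow> 'o" where
  "sub A E \<equiv> Dom A (fst E)"

abbreviation quo :: "('o, 'a) additive_data \<Rightarrow> 'a \<times> 'a \<Rightarrow> 'o" where
  "quo A E \<equiv> Cod A (snd E)"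

abbreviation mid :: "('o, 'a) additive_data \<Rightarrow> 'a \<times> 'a \<Rightarrow> 'o" where
  "mid A E \<equiv> Cod A (fst E)"

text \<open>The middle component is hidden by an existential: it is in general not determined by the
  outer ones, and only its existence is used.\<close>

definition ext_mor ::
    "('o, 'a) additive_data \<Rightarrow> 'a \<times> 'a \<Rightarrow> 'a \<times> 'a \<Rightarrow> 'a \<Rightarrow> 'a \<Rightarrow> bool" where
  "ext_mor A E E' \<alpha> \<gamma> \<longleftrightarrow> \<alpha> \<in> Hom A (sub A E) (sub A E') \<and> \<gamma> \<in> Hom A (quo A E) (quo A E') \<and>
     (\<exists>h\<in>Hom A (mid A E) (mid A E'). Cmp A h (fst E) = Cmp A (fst E') \<alpha> \<and> Cmp A (snd E') h = Cmp A \<gamma>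
         (snd E))"

lemma ext_morI:
  assumes "h \<in> Hom A (mid A E) (mid A E')" "Cmp A h (fst E) = Cmp A (fst E') \<alpha>"
    "Cmp A (snd E') h = Cmp A \<gamma> (snd E)" "\<alpha> \<in> Hom A (sub A E) (sub A E')"
      "\<gamma> \<in> Hom A (quo A E) (quo A E')"
  shows "ext_mor A E E' \<alpha> \<gamma>"
  using assms unfolding ext_mor_def by blast

lemma ext_morE:
  assumes "ext_mor A E E' \<alpha> \<gamma>"
  obtains h where "h \<in> Arr A" "Dom A h = mid A E" "Cod A h = mid A E'"
    "Cmp A h (fst E) = Cmp A (fst E') \<alpha>" "Cmp A (snd E') h = Cmp A \<gamma> (snd E)"
  using assms unfolding ext_mor_def by auto

lemma ext_mor_arr:
  assumes "ext_mor A E E' \<alpha> \<gamma>"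
  shows "\<alpha> \<in> Arr A" "Dom A \<alpha> = sub A E" "Cod A \<alpha> = sub A E'" "\<gamma> \<in> Arr A" "Dom A \<gamma> = quo A E"
    "Cod A \<gamma> = quo A E'"
  using assms by (auto simp: ext_mor_def)

lemma (in abelian_category) ext_mor_opp:
  assumes "is_ext A E" "is_ext A E'"
  shows "ext_mor (opp A) (prod.swap E') (prod.swap E) \<gamma> \<alpha> \<longleftrightarrow> ext_mor A E E' \<alpha> \<gamma>"
  using short_exact_arr(3)[OF assms(1)] short_exact_arr(3)[OF assms(2)]
  by (auto simp: ext_mor_def)

context abelian_category
begin

section \<open>Morphisms of extensions and Yoneda classes\<close>

lemma ext_arr:
  assumes "is_ext A E"
  shows "fst E \<in> Arr A" "snd E \<in> Arr A" "Dom A (snd E) = mid A E"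
  using short_exact_arr[OF assms] by auto

lemma ext_mor_Id: "is_ext A E \<Longrightarrow> ext_mor A E E (Id A (sub A E)) (Id A (quo A E))"
  by (rule ext_morI[of "Id A (mid A E)"]) (simp_all add: ext_arr)

lemma ext_mor_comp:
  assumes E: "is_ext A E" "is_ext A E'" "is_ext A E''" and m: "ext_mor A E E' \<alpha> \<gamma>"
    "ext_mor A E' E'' \<alpha>' \<gamma>'"
  shows "ext_mor A E E'' (\<alpha>' \<cdot> \<alpha>) (\<gamma>' \<cdot> \<gamma>)"
proof -
  note [simp] = ext_mor_arr[OF m(1)] ext_mor_arr[OF m(2)] ext_arr[OF E(1)] ext_arr[OF E(2)]
      ext_arr[OF E(3)]
  obtain h where h[simp]: "h \<in> Arr A" "Dom A h = mid A E" "Cod A h = mid A E'"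
    and h1: "h \<cdot> fst E = fst E' \<cdot> \<alpha>" "snd E' \<cdot> h = \<gamma> \<cdot> snd E" using ext_morE[OF m(1)] by metis
  obtain k where k[simp]: "k \<in> Arr A" "Dom A k = mid A E'" "Cod A k = mid A E''"
    and k1: "k \<cdot> fst E' = fst E'' \<cdot> \<alpha>'" "snd E'' \<cdot> k = \<gamma>' \<cdot> snd E'" using ext_morE[OF m(2)] by metis
  show ?thesis
  proof (rule ext_morI[of "k \<cdot> h"])
    have "(k \<cdot> h) \<cdot> fst E = (k \<cdot> fst E') \<cdot> \<alpha>" by (simp add: h1)
    then show "(k \<cdot> h) \<cdot> fst E = fst E'' \<cdot> \<alpha>' \<cdot> \<alpha>" unfolding k1 by simp
    have "snd E'' \<cdot> k \<cdot> h = (snd E'' \<cdot> k) \<cdot> h" by simp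
    also have "\<dots> = \<gamma>' \<cdot> (snd E' \<cdot> h)" unfolding k1 by simp
    finally show "snd E'' \<cdot> k \<cdot> h = (\<gamma>' \<cdot> \<gamma>) \<cdot> snd E" unfolding h1 by simp
  qed simp_all
qed

text \<open>The middle map is an isomorphism by the short five lemma, and its inverse is a morphism
  back.\<close>

lemma ext_mor_sym:
  assumes E: "is_ext A E" "is_ext A E'" and m: "ext_mor A E E' (Id A Y) (Id A X)"
    and YX: "sub A E = Y" "quo A E = X"
  shows "ext_mor A E' E (Id A Y) (Id A X)"
proof -
  note [simp] = ext_arr[OF E(1)] ext_arr[OF E(2)]
  have XY: "Y \<in> Obj A" "X \<in> Obj A" unfolding YX[symmetric] by simp_all
  have e: "sub A E = Y" "sub A E' = Y" "quo A E = X" "quo A E' = X" using ext_mor_arr[OF m] XY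
      by auto
  obtain h where h: "h \<in> Arr A" "Dom A h = mid A E" "Cod A h = mid A E'"
    and "h \<cdot> fst E = fst E' \<cdot> Id A Y" "snd E' \<cdot> h = Id A X \<cdot> snd E" using ext_morE[OF m] by metis
  then have h1: "h \<cdot> fst E = fst E'" "snd E' \<cdot> h = snd E" using e by auto
  have "is_iso A h" using short_exact_middle_iso[OF E, of h] h h1 e by auto
  then obtain k where k: "k \<in> Arr A" "Dom A k = mid A E'" "Cod A k = mid A E"
    "k \<cdot> h = Id A (mid A E)" "h \<cdot> k = Id A (mid A E')" using h by (auto simp: is_iso_def)
  show ?thesis
  proof (rule ext_morI[of k])
    have "k \<cdot> fst E' = (k \<cdot> h) \<cdot> fst E" using k(1-3) h by (simp add: h1)
    then show "k \<cdot> fst E' = fst E \<cdot> Id A Y" using k(4) e by simp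
    have "snd E \<cdot> k = snd E' \<cdot> (h \<cdot> k)" unfolding h1(2)[symmetric] using k(1-3) h by simp
    then show "snd E \<cdot> k = Id A X \<cdot> snd E'" using k(5) e by simp
  qed (use k e XY in auto)
qed

text \<open>In the last clause, a morphism to \<open>E\<close> whose quotient component factors
  through \<open>a\<close> factors through the pullback \<open>B\<close>, with unchanged component
  on subobjects. This factorisation is the source of the exchange rule.\<close>

lemma ext_pullback:
  assumes E: "is_ext A E" and a: "a \<in> Arr A" "Cod A a = quo A E"
  obtains B where "is_ext A B" "sub A B = sub A E" "quo A B = Dom A a"
      "ext_mor A B E (Id A (sub A E)) a"
    "\<And>P \<beta> c. \<lbrakk>is_ext A P; ext_mor A P E \<beta> (a \<cdot> c); c \<in> Arr A; Dom A c = quo A P; Cod A c =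
      Dom A a\<rbrakk> \<Longrightarrow>
      ext_mor A P B \<beta> c"
proof -
  obtain f' g' h where B: "short_exact A f' g'" "Dom A f' = Dom A (fst E)" "Cod A g' = Dom A a"
    and h: "h \<in> Hom A (Cod A f') (Cod A (fst E))" and h1: "h \<cdot> f' = fst E" "snd E \<cdot> h = a \<cdot> g'"
    and univ: "\<And>u v. \<lbrakk>u \<in> Arr A; v \<in> Arr A; Dom A v = Dom A u; Cod A u = Cod A (fst E); Cod A v =
      Dom A a;
      snd E \<cdot> u = a \<cdot> v\<rbrakk> \<Longrightarrow> \<exists>w\<in>Hom A (Dom A u) (Cod A f'). h \<cdot> w = u \<and> g' \<cdot> w = v"
    using pullback_extension[OF E a] by metis
  note Ba = short_exact_arr[OF B(1)]
  note Ea = ext_arr[OF E]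
  show thesis
  proof (rule that[of "(f', g')"])
    show "ext_mor A (f', g') E (Id A (sub A E)) a"
      by (rule ext_morI[of h]) (use h h1 B a Ea in auto)
    fix P \<beta> c assume P: "is_ext A P" and m: "ext_mor A P E \<beta> (a \<cdot> c)"
      and c: "c \<in> Arr A" "Dom A c = quo A P" "Cod A c = Dom A a"
    note Pa = short_exact_arr[OF P] and ma = ext_mor_arr[OF m]
    obtain u where u: "u \<in> Arr A" "Dom A u = mid A P" "Cod A u = mid A E"
      and u1: "u \<cdot> fst P = fst E \<cdot> \<beta>" "snd E \<cdot> u = (a \<cdot> c) \<cdot> snd P" using ext_morE[OF m] by metis
    have "\<exists>w\<in>Hom A (Dom A u) (Cod A f'). h \<cdot> w = u \<and> g' \<cdot> w = c \<cdot> snd P"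
      by (rule univ) (use u u1(2) c a Pa(1-3) in simp_all)
    then obtain w where w0: "w \<in> Hom A (Dom A u) (Cod A f')"
        and w1: "h \<cdot> w = u" "g' \<cdot> w = c \<cdot> snd P" by blast
    then have w: "w \<in> Arr A" "Dom A w = mid A P" "Cod A w = Cod A f'" using u by auto
    \<comment> \<open>The universal property controls \<open>w\<close> only after composing with
      \<open>h\<close> and \<open>g'\<close>. Its restriction to the subobject of \<open>P\<close>
      lands in the kernel of \<open>g'\<close>, hence is some \<open>z\<close> followed by
      \<open>f'\<close>; cancelling the monic \<open>fst E\<close> identifies \<open>z\<close> with
      \<beta>.\<close>
    have "g' \<cdot> (w \<cdot> fst P) = (c \<cdot> snd P) \<cdot> fst P"
      by (rule Cmp_eq_extend[OF w1(2)]) (use w Pa(1-3) Ba(1-3) in simp_all)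
    also have "\<dots> = c \<cdot> (snd P \<cdot> fst P)" using c Pa(1-3) by simp
    also have "\<dots> = Zero A (sub A P) (Cod A g')" unfolding Pa(4) using c B Pa(1-3) by simp
    finally obtain z where z: "z \<in> Arr A" "Dom A z = sub A P" "Cod A z = Dom A f'"
        "f' \<cdot> z = w \<cdot> fst P"
      using short_exact_lift[OF B(1), of "w \<cdot> fst P"] w Pa(1-3) by auto
    have "fst E \<cdot> z = h \<cdot> (f' \<cdot> z)" unfolding h1(1)[symmetric] using z(1-3) Ba(1-3) h by simp
    also have "\<dots> = u \<cdot> fst P" unfolding z(4) w1(1)[symmetric] using w Pa(1-3) h by simp
    also have "\<dots> = fst E \<cdot> \<beta>" by (rule u1)
    finally have z\<beta>: "z = \<beta>"
      by (rule monicD[OF short_exact_arr(5)[OF E]]) (use z(1-3) ma B Ea in auto)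
    show "ext_mor A P (f', g') \<beta> c"
      by (rule ext_morI[of w]) (use w w1 z[unfolded z\<beta>] c B in simp_all)
  qed (use B in auto)
qed

lemma ext_pushout:
  assumes E: "is_ext A E" and b: "b \<in> Arr A" "Dom A b = sub A E"
  obtains B where "is_ext A B" "quo A B = quo A E" "sub A B = Cod A b"
      "ext_mor A E B b (Id A (quo A E))"
    "\<And>P \<gamma> c. \<lbrakk>is_ext A P; ext_mor A E P (c \<cdot> b) \<gamma>; c \<in> Arr A; Cod A c = sub A P; Dom A c =
      Cod A b\<rbrakk> \<Longrightarrow>
      ext_mor A B P c \<gamma>"
proof -
  interpret op: abelian_category "opp A" by (rule abelian_opp)
  have "is_ext (opp A) (prod.swap E)" using E by simp
  moreover have "b \<in> Arr (opp A)" "Cod (opp A) b = quo (opp A) (prod.swap E)" using b by auto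
  ultimately obtain B where B: "is_ext (opp A) B" "sub (opp A) B = sub (opp A) (prod.swap E)"
    "quo (opp A) B = Dom (opp A) b"
    "ext_mor (opp A) B (prod.swap E) (Id (opp A) (sub (opp A) (prod.swap E))) b"
    and u: "\<And>P \<beta> c. \<lbrakk>is_ext (opp A) P; ext_mor (opp A) P (prod.swap E) \<beta> (Cmp (opp A) b c); c \<in> Arr
      (opp A);
      Dom (opp A) c = quo (opp A) P; Cod (opp A) c = Dom (opp A) b\<rbrakk> \<Longrightarrow> ext_mor (opp A) P B \<beta> c"
    using op.ext_pullback[of "prod.swap E" b] by metis
  define D where "D = prod.swap B"
  have BD: "B = prod.swap D" by (simp add: D_def)
  have D: "is_ext A D" using B(1) by (simp add: BD)
  show thesis
  proof (rule that[OF D])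
    show "ext_mor A E D b (Id A (quo A E))" using B(4) ext_mor_opp[OF E D] by (simp add: BD)
    fix P \<gamma> c assume P: "is_ext A P" and "ext_mor A E P (c \<cdot> b) \<gamma>" "c \<in> Arr A" "Cod A c = sub A P"
        "Dom A c = Cod A b"
    then show "ext_mor A D P c \<gamma>"
      using u[of "prod.swap P" \<gamma> c] ext_mor_opp[OF E P] ext_mor_opp[OF D P] by (simp add: BD)
  qed (use B in \<open>auto simp: BD\<close>)
qed

lemma extensions_iff: "E \<in> extensions A X Y \<longleftrightarrow> is_ext A E \<and> sub A E = Y \<and> quo A E = X"
  by (auto simp: extensions_def)

text \<open>Yoneda equivalence is defined with an isomorphism in the middle; by the short five lemma
  every morphism with identity ends has one.\<close>

lemma ext_equiv_iff:
  "(E, E') \<in> ext_equiv A X Y \<longleftrightarrow> E \<in> extensions A X Y \<and> E' \<in> extensions A X Y \<and>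
    ext_mor A E E' (Id A Y) (Id A X)"
proof (cases "E \<in> extensions A X Y \<and> E' \<in> extensions A X Y")
  case True
  then have E: "is_ext A E" "sub A E = Y" "quo A E = X" and E': "is_ext A E'" "sub A E' = Y"
      "quo A E' = X"
    by (auto simp: extensions_iff)
  note a = ext_arr[OF E(1)] ext_arr[OF E'(1)]
  have "X \<in> Obj A" "Y \<in> Obj A" using E a by auto
  moreover have "fst E' \<cdot> Id A Y = fst E'" "Id A X \<cdot> snd E = snd E" using a E E' by auto
  moreover have "is_iso A h" if "h \<in> Hom A (mid A E) (mid A E')" "h \<cdot> fst E = fst E'"
      "snd E' \<cdot> h = snd E" for h
    using short_exact_middle_iso[OF E(1) E'(1) that(1)] that E E' by auto
  ultimately show ?thesis
    using True E E' unfolding ext_equiv_def ext_mor_def case_prod_unfold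
      by (auto simp del: mem_Hom simp: extensions_iff) auto
next
  case False
  then show ?thesis by (auto simp: ext_equiv_def)
qed

lemma equiv_ext_equiv: "equiv (extensions A X Y) (ext_equiv A X Y)"
proof (rule equivI)
  show "ext_equiv A X Y \<subseteq> extensions A X Y \<times> extensions A X Y" by (auto simp: ext_equiv_iff)
  show "refl_on (extensions A X Y) (ext_equiv A X Y)"
    by (rule refl_onI) (use ext_mor_Id in \<open>auto simp: ext_equiv_iff extensions_iff\<close>)
  show "sym (ext_equiv A X Y)"
    by (rule symI) (use ext_mor_sym in \<open>auto simp: ext_equiv_iff extensions_iff\<close>)
  show "trans (ext_equiv A X Y)"
  proof (rule transI)
    fix E E' E'' assume "(E, E') \<in> ext_equiv A X Y" "(E', E'') \<in> ext_equiv A X Y"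
    moreover from this have "X \<in> Obj A" "Y \<in> Obj A"
        by (auto simp: ext_equiv_iff extensions_iff ext_arr)
    ultimately show "(E, E'') \<in> ext_equiv A X Y"
      using ext_mor_comp[of E E' E'' "Id A Y" "Id A X" "Id A Y" "Id A X"]
      by (auto simp: ext_equiv_iff extensions_iff)
  qed
qed

lemma mem_ext_class:
  assumes "is_ext A E" "sub A E = Y" "quo A E = X"
  shows "E' \<in> ext_class A E \<longleftrightarrow> is_ext A E' \<and> sub A E' = Y \<and> quo A E' = X \<and>
    ext_mor A E E' (Id A Y) (Id A X)"
  using assms by (auto simp: ext_class_def ext_equiv_iff extensions_iff)

lemma ext_class_eq:
  assumes "is_ext A E" "is_ext A E'" "ext_mor A E E' (Id A (sub A E)) (Id A (quo A E))"
  shows "ext_class A E = ext_class A E'"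
proof -
  have e: "sub A E' = sub A E" "quo A E' = quo A E"
    using ext_mor_arr[OF assms(3)] ext_arr[OF assms(1)] by auto
  show ?thesis unfolding ext_class_def e
    by (rule equiv_class_eq[OF equiv_ext_equiv])
      (use assms e in \<open>auto simp: ext_equiv_iff extensions_iff\<close>)
qed

lemma ext_class_self: "is_ext A E \<Longrightarrow> E \<in> ext_class A E"
  using mem_ext_class ext_mor_Id by blast

lemma ext_class_in_Ext1: "is_ext A E \<Longrightarrow> ext_class A E \<in> carrier (Ext1 A (quo A E) (sub A E))"
  by (auto simp: Ext1_def ext_class_def extensions_iff intro: quotientI)

lemma Ext1E:
  assumes "\<xi> \<in> carrier (Ext1 A X Y)"
  obtains E where "is_ext A E" "quo A E = X" "sub A E = Y" "\<xi> = ext_class A E"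
  using assms by (auto simp: Ext1_def extensions_iff ext_class_def elim!: quotientE)

text \<open>\<open>ext_pull\<close> and \<open>ext_push\<close> admit any representative of the
  given class. This lemma and the next one move a morphism from an arbitrary representative to a
  fixed one.\<close>

lemma ext_mor_transfer_right:
  assumes E: "is_ext A E" and P: "is_ext A P" "E' \<in> ext_class A E" "ext_mor A P E' \<alpha> \<gamma>"
  shows "ext_mor A P E \<alpha> \<gamma>"
proof -
  have E': "is_ext A E'" "sub A E' = sub A E" "quo A E' = quo A E"
    "ext_mor A E E' (Id A (sub A E)) (Id A (quo A E))" using mem_ext_class[OF E] P by auto
  note ext_mor_comp[OF P(1) E'(1) E P(3) ext_mor_sym[OF E E'(1,4) refl refl]]
  then show ?thesis using ext_mor_arr[OF P(3)] E' by simp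
qed

lemma ext_mor_transfer_left:
  assumes E: "is_ext A E" and P: "is_ext A P" "E' \<in> ext_class A E" "ext_mor A E' P \<alpha> \<gamma>"
  shows "ext_mor A E P \<alpha> \<gamma>"
proof -
  have E': "is_ext A E'" "sub A E' = sub A E" "quo A E' = quo A E"
    "ext_mor A E E' (Id A (sub A E)) (Id A (quo A E))" using mem_ext_class[OF E] P by auto
  note ext_mor_comp[OF E E'(1) P(1) E'(4) P(3)]
  then show ?thesis using ext_mor_arr[OF P(3)] E' by simp
qed

text \<open>Both extensions map with identity ends to the pullback of \<open>E\<close> along
  \<open>a\<close>, and such morphisms can be reversed.\<close>

lemma ext_mor_pull_unique:
  assumes E: "is_ext A E" "is_ext A P" "is_ext A P'" and m: "ext_mor A P E (Id A (sub A E)) a"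
    "ext_mor A P' E (Id A (sub A E)) a"
  shows "ext_mor A P P' (Id A (sub A E)) (Id A (Dom A a))"
proof -
  note ma = ext_mor_arr[OF m(1)] ext_mor_arr[OF m(2)]
  obtain B where B: "is_ext A B" "sub A B = sub A E" "quo A B = Dom A a" and
    u: "\<And>P \<beta> c. \<lbrakk>is_ext A P; ext_mor A P E \<beta> (a \<cdot> c); c \<in> Arr A; Dom A c = quo A P; Cod A c =
        Dom A a\<rbrakk> \<Longrightarrow>
      ext_mor A P B \<beta> c"
    using ext_pullback[OF E(1), of a] ma by metis
  have o: "sub A E \<in> Obj A" "Dom A a \<in> Obj A" "sub A P' = sub A E"
    using ext_mor_arr(1-3)[OF m(2)] ext_arr[OF E(1)] ext_arr[OF E(3)] ma(4) by auto
  have "a \<cdot> Id A (Dom A a) = a" "Id A (Dom A a) \<in> Arr A" "Dom A (Id A (Dom A a)) = Dom A a"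
    "Cod A (Id A (Dom A a)) = Dom A a" "quo A P = Dom A a" "quo A P' = Dom A a"
      using ma(4) ma(5) ma(11) o by (simp_all only: Cmp_Id Id_arr)
  then have mP: "ext_mor A P B (Id A (sub A E)) (Id A (Dom A a))"
      "ext_mor A P' B (Id A (sub A E)) (Id A (Dom A a))"
    using u[OF E(2), of "Id A (sub A E)" "Id A (Dom A a)"]
      u[OF E(3), of "Id A (sub A E)" "Id A (Dom A a)"] m by simp_all
  have "ext_mor A P P' (Id A (sub A E) \<cdot> Id A (sub A E)) (Id A (Dom A a) \<cdot> Id A (Dom A a))"
    by (rule ext_mor_comp[OF E(2) B(1) E(3) mP(1) ext_mor_sym[OF E(3) B(1) mP(2)]])
      (use ma o in simp_all)
  then show ?thesis using o by simp
qed

text \<open>Computing \<open>ext_pull\<close> is hereby reduced to exhibiting one morphism of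
  extensions. One inclusion is uniqueness of pullbacks, the other is composition of
  morphisms.\<close>

lemma ext_pull_class:
  assumes E: "is_ext A E" and P: "is_ext A P" and m: "ext_mor A P E (Id A (sub A E)) a"
  shows "ext_pull A a (ext_class A E) = ext_class A P"
proof -
  note ma = ext_mor_arr[OF m] ext_arr[OF E]
  have sP: "sub A P = sub A E" using ma by simp
  show ?thesis
  proof (intro equalityI subsetI)
    fix P' assume "P' \<in> ext_pull A a (ext_class A E)"
    then obtain E' h where P': "is_ext A P'" "quo A P' = Dom A a" "sub A P' = sub A E'"
        and E': "E' \<in> ext_class A E"
      and h: "h \<in> Hom A (mid A P') (mid A E')" "h \<cdot> fst P' = fst E'" "snd E' \<cdot> h = a \<cdot> snd P'"
      by (auto simp: ext_pull_def)
    have E'': "is_ext A E'" "sub A E' = sub A E" "quo A E' = quo A E" using E' mem_ext_class[OF E]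
        by auto
    have "sub A E \<in> Obj A" using ext_arr[OF E] by simp
    then have "ext_mor A P' E' (Id A (sub A E)) a"
      by (intro ext_morI[of h]) (use h P' E'' ma(4-6) ext_arr[OF E''(1)] in auto)
    then have "ext_mor A P' E (Id A (sub A E)) a" using ext_mor_transfer_right[OF E P'(1) E']
        by blast
    then have "ext_mor A P P' (Id A (sub A E)) (Id A (Dom A a))"
        using ext_mor_pull_unique[OF E P P'(1) m] by blast
    then show "P' \<in> ext_class A P" using mem_ext_class[OF P] P' E'' ma sP by simp
  next
    fix P' assume P'0: "P' \<in> ext_class A P"
    then have P': "is_ext A P'" "sub A P' = sub A E" "quo A P' = Dom A a"
        using mem_ext_class[OF P] ma sP by auto
    have "ext_mor A P P' (Id A (sub A E)) (Id A (Dom A a))" using P'0 mem_ext_class[OF P] ma sP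
        by auto
    note ext_mor_comp[OF P'(1) P E ext_mor_sym[OF P P'(1) this] m, OF sP ma(5)[symmetric]]
    then have "ext_mor A P' E (Id A (sub A E)) a" using ma sP by simp
    then obtain h where "h \<in> Arr A" "Dom A h = mid A P'" "Cod A h = mid A E"
        "h \<cdot> fst P' = fst E \<cdot> Id A (sub A E)"
      "snd E \<cdot> h = a \<cdot> snd P'" using ext_morE by metis
    moreover from this have "h \<cdot> fst P' = fst E" using ma by simp
    ultimately show "P' \<in> ext_pull A a (ext_class A E)"
      using P' ext_class_self[OF E]
        by (auto simp: ext_pull_def case_prod_unfold intro!: bexI[of _ E] bexI[of _ h])
  qed
qed

lemma ext_mor_push_unique:
  assumes E: "is_ext A E" "is_ext A P" "is_ext A P'" and m: "ext_mor A E P b (Id A (quo A E))"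
    "ext_mor A E P' b (Id A (quo A E))"
  shows "ext_mor A P P' (Id A (Cod A b)) (Id A (quo A E))"
proof -
  note ma = ext_mor_arr[OF m(1)] ext_mor_arr[OF m(2)]
  obtain B where B: "is_ext A B" "quo A B = quo A E" "sub A B = Cod A b" and
    u: "\<And>P \<gamma> c. \<lbrakk>is_ext A P; ext_mor A E P (c \<cdot> b) \<gamma>; c \<in> Arr A; Cod A c = sub A P; Dom A c =
        Cod A b\<rbrakk> \<Longrightarrow>
      ext_mor A B P c \<gamma>"
    using ext_pushout[OF E(1), of b] ma by metis
  have o: "quo A E \<in> Obj A" "Cod A b \<in> Obj A" "quo A P = quo A E"
    using ext_mor_arr(4-6)[OF m(1)] ext_arr[OF E(1)] ext_arr[OF E(2)] ma(1) by auto
  have "Id A (Cod A b) \<cdot> b = b" "Id A (Cod A b) \<in> Arr A" "Dom A (Id A (Cod A b)) = Cod A b"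
    "Cod A (Id A (Cod A b)) = Cod A b" "sub A P = Cod A b" "sub A P' = Cod A b"
      using ma(1) ma(3) ma(9) o by (simp_all only: Cmp_Id Id_arr)
  then have mP: "ext_mor A B P (Id A (Cod A b)) (Id A (quo A E))"
      "ext_mor A B P' (Id A (Cod A b)) (Id A (quo A E))"
    using u[OF E(2), of "Id A (Cod A b)" "Id A (quo A E)"]
      u[OF E(3), of "Id A (Cod A b)" "Id A (quo A E)"] m by simp_all
  have "ext_mor A P P' (Id A (Cod A b) \<cdot> Id A (Cod A b)) (Id A (quo A E) \<cdot> Id A (quo A E))"
    by (rule ext_mor_comp[OF E(2) B(1) E(3) ext_mor_sym[OF B(1) E(2) mP(1)] mP(2)])
      (use B in simp_all)
  then show ?thesis using o by simp
qed

lemma ext_push_class: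
  assumes E: "is_ext A E" and P: "is_ext A P" and m: "ext_mor A E P b (Id A (quo A E))"
  shows "ext_push A b (ext_class A E) = ext_class A P"
proof -
  note ma = ext_mor_arr[OF m] ext_arr[OF E]
  have sP: "quo A P = quo A E" using ma by simp
  show ?thesis
  proof (intro equalityI subsetI)
    fix P' assume "P' \<in> ext_push A b (ext_class A E)"
    then obtain E' h where P': "is_ext A P'" "sub A P' = Cod A b" "quo A P' = quo A E'"
        and E': "E' \<in> ext_class A E"
      and h: "h \<in> Hom A (mid A E') (mid A P')" "h \<cdot> fst E' = fst P' \<cdot> b" "snd P' \<cdot> h = snd E'"
      by (auto simp: ext_push_def)
    have E'': "is_ext A E'" "sub A E' = sub A E" "quo A E' = quo A E" using E' mem_ext_class[OF E]
        by auto
    have "quo A E \<in> Obj A" using ext_arr[OF E] by simp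
    then have "ext_mor A E' P' b (Id A (quo A E))"
      by (intro ext_morI[of h]) (use h P' E'' ma(1-3) ext_arr[OF E''(1)] in auto)
    then have "ext_mor A E P' b (Id A (quo A E))" using ext_mor_transfer_left[OF E P'(1) E']
        by blast
    then have "ext_mor A P P' (Id A (Cod A b)) (Id A (quo A E))"
        using ext_mor_push_unique[OF E P P'(1) m] by blast
    then show "P' \<in> ext_class A P" using mem_ext_class[OF P] P' E'' ma sP by simp
  next
    fix P' assume P'0: "P' \<in> ext_class A P"
    then have P': "is_ext A P'" "quo A P' = quo A E" "sub A P' = Cod A b"
        using mem_ext_class[OF P] ma sP by auto
    have "ext_mor A P P' (Id A (Cod A b)) (Id A (quo A E))" using P'0 mem_ext_class[OF P] ma sP
        by auto
    note ext_mor_comp[OF E P P'(1) m this]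
    then have "ext_mor A E P' b (Id A (quo A E))" using ma sP by simp
    then obtain h where "h \<in> Arr A" "Dom A h = mid A E" "Cod A h = mid A P'"
        "h \<cdot> fst E = fst P' \<cdot> b"
      "snd P' \<cdot> h = Id A (quo A E) \<cdot> snd E" using ext_morE by metis
    moreover from this have "snd P' \<cdot> h = snd E" using ma by simp
    ultimately show "P' \<in> ext_push A b (ext_class A E)"
      using P' ext_class_self[OF E]
        by (auto simp: ext_push_def case_prod_unfold intro!: bexI[of _ E] bexI[of _ h])
  qed
qed

end

section \<open>The exchange rule and the functoriality of \<open>Ext1\<close>\<close>

context abelian_category
begin

text \<open>The morphism factors through the pullback \<open>B\<close> of \<open>E'\<close> along
  \<gamma>. Its first part, from \<open>E\<close> to \<open>B\<close>, is the identity on quotients,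
  so \<open>B\<close> also represents the pushout of \<open>E\<close> along \<alpha>.\<close>

lemma push_eq_pull:
  assumes E: "is_ext A E" "is_ext A E'" and m: "ext_mor A E E' \<alpha> \<gamma>"
  shows "ext_push A \<alpha> (ext_class A E) = ext_pull A \<gamma> (ext_class A E')"
proof -
  note ma = ext_mor_arr[OF m] ext_arr[OF E(1)] ext_arr[OF E(2)]
  obtain B where B: "is_ext A B" "sub A B = sub A E'" "quo A B = Dom A \<gamma>"
      "ext_mor A B E' (Id A (sub A E')) \<gamma>" and
    u: "\<And>P \<beta> c. \<lbrakk>is_ext A P; ext_mor A P E' \<beta> (\<gamma> \<cdot> c); c \<in> Arr A; Dom A c = quo A P; Cod A c =
        Dom A \<gamma>\<rbrakk> \<Longrightarrow>
      ext_mor A P B \<beta> c"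
    using ext_pullback[OF E(2), of \<gamma>] ma by metis
  have "quo A E \<in> Obj A" using ma by simp
  then have "ext_mor A E B \<alpha> (Id A (quo A E))" using u[OF E(1)] m ma(4-6) by simp
  then show ?thesis using ext_push_class[OF E(1) B(1)] ext_pull_class[OF E(2) B(1,4)] by simp
qed

lemma ext_pull_ext:
  assumes "is_ext A E" "a \<in> Arr A" "Cod A a = quo A E"
  obtains P where "is_ext A P" "quo A P = Dom A a" "sub A P = sub A E"
      "ext_mor A P E (Id A (sub A E)) a"
    "ext_pull A a (ext_class A E) = ext_class A P"
  using ext_pullback[OF assms] ext_pull_class[OF assms(1)] by metis

lemma ext_push_ext:
  assumes "is_ext A E" "b \<in> Arr A" "Dom A b = sub A E"
  obtains P where "is_ext A P" "quo A P = quo A E" "sub A P = Cod A b"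
      "ext_mor A E P b (Id A (quo A E))"
    "ext_push A b (ext_class A E) = ext_class A P"
  using ext_pushout[OF assms] ext_push_class[OF assms(1)] by metis

lemma ext_pull_closed:
  "\<xi> \<in> carrier (Ext1 A X Y) \<Longrightarrow> a \<in> Hom A X' X \<Longrightarrow> ext_pull A a \<xi> \<in> carrier (Ext1 A X' Y)"
  by (elim Ext1E) (metis ext_pull_ext ext_class_in_Ext1 mem_Hom)

lemma ext_push_closed:
  "\<xi> \<in> carrier (Ext1 A X Y) \<Longrightarrow> b \<in> Hom A Y Y' \<Longrightarrow> ext_push A b \<xi> \<in> carrier (Ext1 A X Y')"
  by (elim Ext1E) (metis ext_push_ext ext_class_in_Ext1 mem_Hom)

lemma ext_pull_Id:
  assumes "\<xi> \<in> carrier (Ext1 A X Y)" shows "ext_pull A (Id A X) \<xi> = \<xi>"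
  using assms by (elim Ext1E) (use ext_pull_class ext_mor_Id in blast)

lemma ext_push_Id:
  assumes "\<xi> \<in> carrier (Ext1 A X Y)" shows "ext_push A (Id A Y) \<xi> = \<xi>"
  using assms by (elim Ext1E) (use ext_push_class ext_mor_Id in blast)

lemma ext_pull_comp:
  assumes \<xi>: "\<xi> \<in> carrier (Ext1 A X Y)" and a: "a \<in> Hom A X' X" "a' \<in> Hom A X'' X'"
  shows "ext_pull A a' (ext_pull A a \<xi>) = ext_pull A (a \<cdot> a') \<xi>"
proof -
  obtain E where E: "is_ext A E" "quo A E = X" "sub A E = Y" "\<xi> = ext_class A E" using Ext1E[OF \<xi>] .
  obtain P where P: "is_ext A P" "quo A P = X'" "sub A P = Y" "ext_mor A P E (Id A Y) a"
      "ext_pull A a \<xi> = ext_class A P"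
    using ext_pull_ext[OF E(1), of a] E a by auto
  obtain Q where Q: "is_ext A Q" "quo A Q = X''" "sub A Q = Y" "ext_mor A Q P (Id A Y) a'"
    "ext_pull A a' (ext_class A P) = ext_class A Q"
    using ext_pull_ext[OF P(1), of a'] P a by auto
  have "Y \<in> Obj A" using E ext_arr[OF E(1)] by auto
  then have "ext_mor A Q E (Id A Y) (a \<cdot> a')" using ext_mor_comp[OF Q(1) P(1) E(1) Q(4) P(4)]
      by simp
  then show ?thesis using ext_pull_class[OF E(1) Q(1)] E P Q by simp
qed

lemma ext_push_comp:
  assumes \<xi>: "\<xi> \<in> carrier (Ext1 A X Y)" and b: "b \<in> Hom A Y Y'" "b' \<in> Hom A Y' Y''"
  shows "ext_push A b' (ext_push A b \<xi>) = ext_push A (b' \<cdot> b) \<xi>"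
proof -
  obtain E where E: "is_ext A E" "quo A E = X" "sub A E = Y" "\<xi> = ext_class A E" using Ext1E[OF \<xi>] .
  obtain P where P: "is_ext A P" "quo A P = X" "sub A P = Y'" "ext_mor A E P b (Id A X)"
      "ext_push A b \<xi> = ext_class A P"
    using ext_push_ext[OF E(1), of b] E b by auto
  obtain Q where Q: "is_ext A Q" "quo A Q = X" "sub A Q = Y''" "ext_mor A P Q b' (Id A X)"
    "ext_push A b' (ext_class A P) = ext_class A Q"
    using ext_push_ext[OF P(1), of b'] P b by auto
  have "X \<in> Obj A" using E ext_arr[OF E(1)] by auto
  then have "ext_mor A E Q (b' \<cdot> b) (Id A X)" using ext_mor_comp[OF E(1) P(1) Q(1) P(4) Q(4)]
      by simp
  then show ?thesis using ext_push_class[OF E(1) Q(1)] E P Q by simp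
qed

text \<open>The pulled back extension maps to \<open>E\<close> and \<open>E\<close> maps to the
  pushed out one; the composite has ends \<open>b\<close> and \<open>a\<close>, and the exchange
  rule applies to it.\<close>

lemma ext_push_pull:
  assumes \<xi>: "\<xi> \<in> carrier (Ext1 A X Y)" and a: "a \<in> Hom A X' X" and b: "b \<in> Hom A Y Y'"
  shows "ext_push A b (ext_pull A a \<xi>) = ext_pull A a (ext_push A b \<xi>)"
proof -
  obtain E where E: "is_ext A E" "quo A E = X" "sub A E = Y" "\<xi> = ext_class A E" using Ext1E[OF \<xi>] .
  obtain P where P: "is_ext A P" "quo A P = X'" "sub A P = Y" "ext_mor A P E (Id A Y) a"
      "ext_pull A a \<xi> = ext_class A P"
    using ext_pull_ext[OF E(1), of a] E a by auto
  obtain Q where Q: "is_ext A Q" "quo A Q = X" "sub A Q = Y'" "ext_mor A E Q b (Id A X)"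
      "ext_push A b \<xi> = ext_class A Q"
    using ext_push_ext[OF E(1), of b] E b by auto
  have "ext_mor A P Q b a" using ext_mor_comp[OF P(1) E(1) Q(1) P(4) Q(4)] a b by simp
  then show ?thesis using push_eq_pull[OF P(1) Q(1)] P Q by simp
qed

section \<open>Split extensions and exactness at Hom\<close>

lemma split_section_retraction:
  assumes E: "is_ext A E"
  shows "(\<exists>s\<in>Hom A (quo A E) (mid A E). snd E \<cdot> s = Id A (quo A E)) \<longleftrightarrow>
    (\<exists>s r. s \<in> Hom A (quo A E) (mid A E) \<and> r \<in> Hom A (mid A E) (sub A E) \<and> snd E \<cdot> s = Id A (quo A
        E) \<and>
      r \<cdot> fst E = Id A (sub A E) \<and> r \<cdot> s = Zero A (quo A E) (sub A E))"
    (is "?L \<longleftrightarrow> ?R")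
proof
  note Ea = short_exact_arr[OF E]
  assume ?L
  then obtain s where s: "s \<in> Arr A" "Dom A s = quo A E" "Cod A s = mid A E"
      and s1: "snd E \<cdot> s = Id A (quo A E)" by auto
  \<comment> \<open>The idempotent complementary to \<open>s \<cdot> snd E\<close>. It is killed by
    \<open>snd E\<close>, so it lifts through \<open>fst E\<close>, and the lift is the
    retraction.\<close>
  define t where "t = Id A (mid A E) \<oplus> Neg (s \<cdot> snd E)"
  have t: "t \<in> Arr A" "Dom A t = mid A E" "Cod A t = mid A E" using s Ea(1-3) by (auto simp: t_def)
  have "snd E \<cdot> (s \<cdot> snd E) = Id A (quo A E) \<cdot> snd E"
    by (rule Cmp_eq_extend[OF s1]) (use s Ea(1-3) in simp_all)
  then have "snd E \<cdot> t = Zero A (mid A E) (quo A E)"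
    using s Ea(1-3) by (simp add: t_def)
  then obtain r where r: "r \<in> Arr A" "Dom A r = mid A E" "Cod A r = sub A E" "fst E \<cdot> r = t"
    using short_exact_lift[OF E, of t] t by auto
  have "fst E \<cdot> (r \<cdot> fst E) = t \<cdot> fst E"
    by (rule Cmp_eq_extend[OF r(4)]) (use r Ea in simp_all)
  also have "\<dots> = fst E \<cdot> Id A (sub A E)" using s Ea by (simp add: t_def)
  finally have 1: "r \<cdot> fst E = Id A (sub A E)" by (rule monicD[OF Ea(5)]) (use r Ea in simp_all)
  have "fst E \<cdot> (r \<cdot> s) = t \<cdot> s"
    by (rule Cmp_eq_extend[OF r(4)]) (use r s Ea in simp_all)
  also have "\<dots> = fst E \<cdot> Zero A (quo A E) (sub A E)" using s Ea s1 by (simp add: t_def)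
  finally have "r \<cdot> s = Zero A (quo A E) (sub A E)"
      by (rule monicD[OF Ea(5)]) (use r s Ea in simp_all)
  with 1 s1 s r(1-3) show ?R by (intro exI[of _ s] exI[of _ r]) simp
qed auto

lemma split_retraction_section:
  assumes E: "is_ext A E"
  shows "(\<exists>s\<in>Hom A (quo A E) (mid A E). snd E \<cdot> s = Id A (quo A E)) \<longleftrightarrow>
    (\<exists>r\<in>Hom A (mid A E) (sub A E). r \<cdot> fst E = Id A (sub A E))" (is "?L \<longleftrightarrow> ?R")
proof
  note Ea = short_exact_arr[OF E]
  show "?L \<Longrightarrow> ?R" using split_section_retraction[OF E] by blast
  assume ?R
  interpret op: abelian_category "opp A" by (rule abelian_opp)
  show ?L
    using op.split_section_retraction[of "prod.swap E"] \<open>?R\<close> E Ea by (auto simp del: mem_Hom)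
qed

text \<open>A retraction \<open>r\<close> and \<open>snd S\<close> act as the two coordinates on the
  middle of \<open>S\<close>; the comparison map feeds them into \<open>fst T\<close> and the
  section \<open>t\<close>.\<close>

lemma ext_mor_split:
  assumes S: "is_ext A S" "s \<in> Hom A (quo A S) (mid A S)" "snd S \<cdot> s = Id A (quo A S)"
    and T: "is_ext A T" "t \<in> Hom A (quo A T) (mid A T)" "snd T \<cdot> t = Id A (quo A T)"
    and e: "sub A S = Y" "sub A T = Y" "quo A S = X" "quo A T = X"
  shows "ext_mor A S T (Id A Y) (Id A X)"
proof -
  note Sa = short_exact_arr[OF S(1)] and Ta = short_exact_arr[OF T(1)]
  have "\<exists>s r. s \<in> Hom A (quo A S) (mid A S) \<and> r \<in> Hom A (mid A S) (sub A S) \<and> snd S \<cdot> s =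
      Id A (quo A S) \<and>
      r \<cdot> fst S = Id A (sub A S) \<and> r \<cdot> s = Zero A (quo A S) (sub A S)"
    using split_section_retraction[OF S(1)] S by blast
  then obtain r where r: "r \<in> Arr A" "Dom A r = mid A S" "Cod A r = sub A S"
      and r1: "r \<cdot> fst S = Id A (sub A S)"
    by auto
  have ob: "X \<in> Obj A" "Y \<in> Obj A" using Sa(1,2) e by auto
  let ?h = "fst T \<cdot> r \<oplus> t \<cdot> snd S"
  show ?thesis
  proof (rule ext_morI[of ?h])
    show "?h \<cdot> fst S = fst T \<cdot> Id A Y" using r r1 T(2) Sa Ta e ob by simp
    have "snd T \<cdot> ?h = (snd T \<cdot> fst T) \<cdot> r \<oplus> (snd T \<cdot> t) \<cdot> snd S"
      using r T(2) Sa(1-3) Ta(1-3) e by simp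
    also have "\<dots> = Id A X \<cdot> snd S" unfolding Ta(4) T(3) using r Sa(1-3) Ta(1-3) e by auto
    finally show "snd T \<cdot> ?h = Id A X \<cdot> snd S" .
  qed (use r T(2) Sa Ta e in auto)
qed

lemma one_Ext1: "\<one>\<^bsub>Ext1 A X Y\<^esub> = split_extensions A X Y"
  by (simp add: Ext1_def)

lemma mem_split_extensions:
  "S \<in> split_extensions A X Y \<longleftrightarrow> is_ext A S \<and> quo A S = X \<and> sub A S = Y \<and>
    (\<exists>s\<in>Hom A X (mid A S). snd S \<cdot> s = Id A X)"
  using short_exact_arr(3)[of "fst S" "snd S"]
  by (auto simp: split_extensions_def extensions_iff)

text \<open>The zero element is the set of all split extensions, so an equality of sets is at stake:
  splittings pass along Yoneda equivalence, and any two split extensions with the same ends are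
  equivalent.\<close>

lemma ext_class_eq_one:
  assumes E: "is_ext A E" "quo A E = X" "sub A E = Y"
  shows "ext_class A E = \<one>\<^bsub>Ext1 A X Y\<^esub> \<longleftrightarrow> (\<exists>s\<in>Hom A X (mid A E). snd E \<cdot> s = Id A X)"
proof
  assume "ext_class A E = \<one>\<^bsub>Ext1 A X Y\<^esub>"
  then show "\<exists>s\<in>Hom A X (mid A E). snd E \<cdot> s = Id A X"
    using ext_class_self[OF E(1)] mem_split_extensions[of E X Y]
      by (simp add: one_Ext1 del: mem_Hom)
next
  assume "\<exists>s\<in>Hom A X (mid A E). snd E \<cdot> s = Id A X"
  then obtain s where s: "s \<in> Hom A X (mid A E)" "snd E \<cdot> s = Id A X" by blast
  show "ext_class A E = \<one>\<^bsub>Ext1 A X Y\<^esub>" unfolding one_Ext1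
  proof (intro equalityI subsetI)
    fix E' assume "E' \<in> ext_class A E"
    then have E': "is_ext A E'" "quo A E' = X" "sub A E' = Y" "ext_mor A E E' (Id A Y) (Id A X)"
      using mem_ext_class[OF E(1)] E by auto
    obtain h where h: "h \<in> Arr A" "Dom A h = mid A E" "Cod A h = mid A E'"
        "snd E' \<cdot> h = Id A X \<cdot> snd E"
      using ext_morE[OF E'(4)] by metis
    have "snd E' \<cdot> (h \<cdot> s) = (Id A X \<cdot> snd E) \<cdot> s"
      by (rule Cmp_eq_extend[OF h(4)]) (use h(1-3) s(1) ext_arr[OF E'(1)] in simp_all)
    also have "\<dots> = Id A X" using s ext_arr[OF E(1)] E by auto
    finally show "E' \<in> split_extensions A X Y"
      using E' h(1-3) s(1) by (auto simp: mem_split_extensions)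
  next
    fix E' assume "E' \<in> split_extensions A X Y"
    then obtain t where E': "is_ext A E'" "quo A E' = X" "sub A E' = Y" and "t \<in> Hom A X (mid A E')"
        "snd E' \<cdot> t = Id A X"
      unfolding mem_split_extensions by blast
    then have "ext_mor A E E' (Id A Y) (Id A X)"
      by (intro ext_mor_split[OF E(1) _ _ E'(1)]) (use E s in simp_all)
    then show "E' \<in> ext_class A E" using E E' by (simp add: mem_ext_class)
  qed
qed

lemma ext_class_eq_one':
  assumes E: "is_ext A E" "quo A E = X" "sub A E = Y"
  shows "ext_class A E = \<one>\<^bsub>Ext1 A X Y\<^esub> \<longleftrightarrow> (\<exists>r\<in>Hom A (mid A E) Y. r \<cdot> fst E = Id A Y)"
  using ext_class_eq_one[OF E] split_retraction_section[OF E(1)] E by (simp del: mem_Hom)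

lemma split_ext_exists:
  assumes "X \<in> Obj A" "Y \<in> Obj A"
  obtains S s r where "is_ext A S" "quo A S = X" "sub A S = Y" "s \<in> Arr A" "Dom A s = X"
      "Cod A s = mid A S"
    "r \<in> Arr A" "Dom A r = mid A S" "Cod A r = Y" "snd S \<cdot> s = Id A X" "r \<cdot> fst S = Id A Y"
    "r \<cdot> s = Zero A X Y" "ext_class A S = \<one>\<^bsub>Ext1 A X Y\<^esub>"
proof -
  let ?i1 = "inl A Y X" and ?i2 = "inr A Y X" and ?p1 = "prl A Y X" and ?p2 = "prr A Y X"
  have "is_kernel A ?i1 ?p2"
  proof (rule kernelI)
    show "monic A ?i1"
    proof (rule monicI)
      fix z assume z: "z \<in> Arr A" "Cod A z = Dom A ?i1" "?i1 \<cdot> z = Zero A (Dom A z) (Cod A ?i1)"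
      have "z = ?p1 \<cdot> (?i1 \<cdot> z)" using z(1,2) assms by simp
      then show "z = Zero A (Dom A z) (Dom A ?i1)" unfolding z(3) using z(1,2) assms by simp
    qed (use assms in simp)
    fix g assume g: "g \<in> Arr A" "Cod A g = Dom A ?p2" "?p2 \<cdot> g = Zero A (Dom A g) (Cod A ?p2)"
    have "?i1 \<cdot> ?p1 \<cdot> g = g" by (rule biproduct_eqI[OF assms(2,1)]) (use g assms in simp_all)
    then show "\<exists>u. u \<in> Hom A (Dom A g) (Dom A ?i1) \<and> ?i1 \<cdot> u = g"
      using g(1,2) assms by (intro exI[of _ "?p1 \<cdot> g"]) simp
  qed (use assms in simp_all)
  moreover have "epic A ?p2"
  proof (rule epicI)
    fix z assume z: "z \<in> Arr A" "Dom A z = Cod A ?p2" "z \<cdot> ?p2 = Zero A (Dom A ?p2) (Cod A z)"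
    have "z = (z \<cdot> ?p2) \<cdot> ?i2" using z(1,2) assms by simp
    then show "z = Zero A (Cod A ?p2) (Cod A z)" unfolding z(3) using z(1,2) assms by simp
  qed (use assms in simp)
  ultimately have S: "is_ext A (?i1, ?p2)" using epic_cokernel by (simp add: short_exact_def)
  show ?thesis
    by (rule that[OF S, of ?i2 ?p1]) (use assms ext_class_eq_one[OF S, of X Y] bexI[of _ ?i2 "Hom A
      X (oplus_obj A Y X)"] in auto)
qed

lemma one_in_Ext1: "X \<in> Obj A \<Longrightarrow> Y \<in> Obj A \<Longrightarrow> \<one>\<^bsub>Ext1 A X Y\<^esub> \<in> carrier (Ext1 A X Y)"
  by (metis split_ext_exists ext_class_in_Ext1)

text \<open>Exactness of \<open>Hom(X', mid)\<close>, \<open>Hom(X', X)\<close>,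
  \<open>Ext1(X', Y)\<close> at the middle term: a section of the pulled back extension is the same
  as a lift of \<open>a\<close> to the middle of \<open>E\<close>.\<close>

lemma ext_pull_eq_one:
  assumes E: "is_ext A E" "quo A E = X" "sub A E = Y" and a: "a \<in> Hom A X' X"
  shows "ext_pull A a (ext_class A E) = \<one>\<^bsub>Ext1 A X' Y\<^esub> \<longleftrightarrow> (\<exists>u\<in>Hom A X' (mid A E). snd E \<cdot> u = a)"
proof
  note Ea = short_exact_arr[OF E(1)]
  assume L: "ext_pull A a (ext_class A E) = \<one>\<^bsub>Ext1 A X' Y\<^esub>"
  obtain P where P: "is_ext A P" "quo A P = X'" "sub A P = Y" "ext_mor A P E (Id A Y) a"
    "ext_pull A a (ext_class A E) = ext_class A P"
    using ext_pull_ext[OF E(1), of a] E a by auto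
  obtain s where s: "s \<in> Arr A" "Dom A s = X'" "Cod A s = mid A P" "snd P \<cdot> s = Id A X'"
    using L ext_class_eq_one[OF P(1-3)] P(5) by auto
  obtain h where h: "h \<in> Arr A" "Dom A h = mid A P" "Cod A h = mid A E" "snd E \<cdot> h = a \<cdot> snd P"
    using ext_morE[OF P(4)] by metis
  have "snd E \<cdot> (h \<cdot> s) = (a \<cdot> snd P) \<cdot> s"
    by (rule Cmp_eq_extend[OF h(4)]) (use h(1-3) s Ea in simp_all)
  also have "\<dots> = a" using a s ext_arr[OF P(1)] P(2) by auto
  finally show "\<exists>u\<in>Hom A X' (mid A E). snd E \<cdot> u = a" using h(1-3) s
      by (intro bexI[of _ "h \<cdot> s"]) simp_all
next
  note Ea = short_exact_arr[OF E(1)]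
  assume "\<exists>u\<in>Hom A X' (mid A E). snd E \<cdot> u = a"
  then obtain u where u: "u \<in> Arr A" "Dom A u = X'" "Cod A u = mid A E" "snd E \<cdot> u = a" by auto
  have ob: "X' \<in> Obj A" "Y \<in> Obj A" using a E Ea by auto
  obtain S s r where S: "is_ext A S" "quo A S = X'" "sub A S = Y" "r \<in> Arr A" "Dom A r = mid A S"
      "Cod A r = Y"
    "r \<cdot> fst S = Id A Y" "ext_class A S = \<one>\<^bsub>Ext1 A X' Y\<^esub>"
    using split_ext_exists[OF ob] by metis
  note Sa = short_exact_arr[OF S(1)]
  \<comment> \<open>On the split extension \<open>S\<close>, the coordinate \<open>r\<close> goes to
    \<open>E\<close> by \<open>fst E\<close> and the coordinate \<open>snd S\<close> by the lift
    \<open>u\<close>.\<close>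
  let ?h = "fst E \<cdot> r \<oplus> u \<cdot> snd S"
  have "ext_mor A S E (Id A Y) a"
  proof (rule ext_morI[of ?h])
    show "?h \<cdot> fst S = fst E \<cdot> Id A Y" using S Sa Ea E u(1-3) ob by simp
    have "snd E \<cdot> ?h = (snd E \<cdot> fst E) \<cdot> r \<oplus> (snd E \<cdot> u) \<cdot> snd S"
        using S(1-6) Sa(1-3) Ea(1-3) E(2,3) u(1-3) by simp
    also have "\<dots> = a \<cdot> snd S" unfolding Ea(4) u(4) using S(1-6) Sa(1-3) Ea(1-3) E a ob by auto
    finally show "snd E \<cdot> ?h = a \<cdot> snd S" .
  qed (use S E u(1-3) Sa(1-3) Ea(1-3) a ob in auto)
  then show "ext_pull A a (ext_class A E) = \<one>\<^bsub>Ext1 A X' Y\<^esub>"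
    using ext_pull_class[OF E(1) S(1)] E S by simp
qed

text \<open>The dual exactness, at \<open>Hom(Y, Y')\<close>: a retraction of the pushed out
  extension is the same as an extension of \<open>b\<close> over the middle of
  \<open>E\<close>.\<close>

lemma ext_push_eq_one:
  assumes E: "is_ext A E" "quo A E = X" "sub A E = Y" and b: "b \<in> Hom A Y Y'"
  shows "ext_push A b (ext_class A E) = \<one>\<^bsub>Ext1 A X Y'\<^esub> \<longleftrightarrow> (\<exists>u\<in>Hom A (mid A E) Y'. u \<cdot> fst E = b)"
proof
  note Ea = short_exact_arr[OF E(1)]
  assume L: "ext_push A b (ext_class A E) = \<one>\<^bsub>Ext1 A X Y'\<^esub>"
  obtain P where P: "is_ext A P" "quo A P = X" "sub A P = Y'" "ext_mor A E P b (Id A X)"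
    "ext_push A b (ext_class A E) = ext_class A P"
    using ext_push_ext[OF E(1), of b] E b by auto
  obtain r where r: "r \<in> Arr A" "Dom A r = mid A P" "Cod A r = Y'" "r \<cdot> fst P = Id A Y'"
    using L ext_class_eq_one'[OF P(1-3)] P(5) by auto
  obtain h where h: "h \<in> Arr A" "Dom A h = mid A E" "Cod A h = mid A P" "h \<cdot> fst E = fst P \<cdot> b"
    using ext_morE[OF P(4)] by metis
  have "r \<cdot> (h \<cdot> fst E) = (r \<cdot> fst P) \<cdot> b" unfolding h(4) using r(1-3) b P(3) ext_arr[OF P(1)]
      by simp
  then have "(r \<cdot> h) \<cdot> fst E = b" unfolding r(4) using r(1-3) h(1-3) b Ea(1-3) by auto
  then show "\<exists>u\<in>Hom A (mid A E) Y'. u \<cdot> fst E = b" using h(1-3) r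
      by (intro bexI[of _ "r \<cdot> h"]) simp_all
next
  note Ea = short_exact_arr[OF E(1)]
  assume "\<exists>u\<in>Hom A (mid A E) Y'. u \<cdot> fst E = b"
  then obtain u where u: "u \<in> Arr A" "Dom A u = mid A E" "Cod A u = Y'" "u \<cdot> fst E = b" by auto
  have ob: "X \<in> Obj A" "Y' \<in> Obj A" and obY: "Y \<in> Obj A" using b E Ea by auto
  obtain S s r where S: "is_ext A S" "quo A S = X" "sub A S = Y'" "s \<in> Arr A" "Dom A s = X"
      "Cod A s = mid A S"
    "snd S \<cdot> s = Id A X" "ext_class A S = \<one>\<^bsub>Ext1 A X Y'\<^esub>"
    using split_ext_exists[OF ob] by metis
  note Sa = short_exact_arr[OF S(1)]
  let ?h = "fst S \<cdot> u \<oplus> s \<cdot> snd E"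
  have "ext_mor A E S b (Id A X)"
  proof (rule ext_morI[of ?h])
    show "?h \<cdot> fst E = fst S \<cdot> b" using S Sa Ea E u ob obY b by simp
    have "snd S \<cdot> ?h = (snd S \<cdot> fst S) \<cdot> u \<oplus> (snd S \<cdot> s) \<cdot> snd E"
        using S(1-6) Sa(1-3) Ea(1-3) E(2,3) u(1-3) by simp
    also have "\<dots> = Id A X \<cdot> snd E" unfolding Sa(4) S(7) using S(1-6) Sa(1-3) Ea(1-3) E u(1-3) ob
        by auto
    finally show "snd S \<cdot> ?h = Id A X \<cdot> snd E" .
  qed (use S E u(1-3) Sa(1-3) Ea(1-3) b ob in auto)
  then show "ext_push A b (ext_class A E) = \<one>\<^bsub>Ext1 A X Y'\<^esub>"
    using ext_push_class[OF E(1) S(1)] E S by simp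
qed

end

subsection \<open>The Baer sum\<close>

definition ext_sum :: "('o, 'a) additive_data \<Rightarrow> 'a \<times> 'a \<Rightarrow> 'a \<times> 'a \<Rightarrow> 'a \<times> 'a" where
  "ext_sum A E F = (oplus_arr A (fst E) (fst F), oplus_arr A (snd E) (snd F))"

context abelian_category
begin

lemma oplus_arr_eq:
  "oplus_arr A f g = inl A (Cod A f) (Cod A g) \<cdot> f \<cdot> prl A (Dom A f) (Dom A g) \<oplus>
    inr A (Cod A f) (Cod A g) \<cdot> g \<cdot> prr A (Dom A f) (Dom A g)"
  by (simp add: oplus_arr_def inl_def inr_def prl_def prr_def split: prod.split)

lemma diagonal_eq: "diagonal A X = inl A X X \<oplus> inr A X X"
  by (simp add: diagonal_def inl_def inr_def split: prod.split)

lemma codiagonal_eq: "codiagonal A X = prl A X X \<oplus> prr A X X"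
  by (simp add: codiagonal_def prl_def prr_def split: prod.split)

lemma diagonal_arr [simp]:
  assumes "X \<in> Obj A"
  shows "diagonal A X \<in> Arr A" "Dom A (diagonal A X) = X" "Cod A (diagonal A X) = oplus_obj A X X"
    "codiagonal A X \<in> Arr A" "Dom A (codiagonal A X) = oplus_obj A X X" "Cod A (codiagonal A X) = X"
  using assms by (simp_all add: diagonal_eq codiagonal_eq)

lemma oplus_arr [simp]:
  assumes "f \<in> Arr A" "g \<in> Arr A"
  shows "oplus_arr A f g \<in> Arr A" "Dom A (oplus_arr A f g) = oplus_obj A (Dom A f) (Dom A g)"
    "Cod A (oplus_arr A f g) = oplus_obj A (Cod A f) (Cod A g)"
  using assms by (simp_all add: oplus_arr_eq)

lemma oplus_arr_pr [simp]:
  assumes "f \<in> Arr A" "g \<in> Arr A" "Cod A f = X" "Cod A g = Y"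
  shows "prl A X Y \<cdot> oplus_arr A f g = f \<cdot> prl A (Dom A f) (Dom A g)"
    "prr A X Y \<cdot> oplus_arr A f g = g \<cdot> prr A (Dom A f) (Dom A g)"
proof -
  have "X \<in> Obj A" "Y \<in> Obj A" using assms by auto
  then show "prl A X Y \<cdot> oplus_arr A f g = f \<cdot> prl A (Dom A f) (Dom A g)"
    "prr A X Y \<cdot> oplus_arr A f g = g \<cdot> prr A (Dom A f) (Dom A g)"
    using assms by (simp_all add: oplus_arr_eq)
qed

lemma oplus_arr_pr_comp [simp]:
  assumes "f \<in> Arr A" "g \<in> Arr A" "Cod A f = X" "Cod A g = Y" "x \<in> Arr A"
    "Cod A x = oplus_obj A (Dom A f) (Dom A g)"
  shows "prl A X Y \<cdot> oplus_arr A f g \<cdot> x = f \<cdot> prl A (Dom A f) (Dom A g) \<cdot> x"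
    "prr A X Y \<cdot> oplus_arr A f g \<cdot> x = g \<cdot> prr A (Dom A f) (Dom A g) \<cdot> x"
proof -
  have o: "X \<in> Obj A" "Y \<in> Obj A" using assms by auto
  show "prl A X Y \<cdot> oplus_arr A f g \<cdot> x = f \<cdot> prl A (Dom A f) (Dom A g) \<cdot> x"
    using Cmp_eq_extend[OF oplus_arr_pr(1)[OF assms(1-4)], of x] assms o by simp
  show "prr A X Y \<cdot> oplus_arr A f g \<cdot> x = g \<cdot> prr A (Dom A f) (Dom A g) \<cdot> x"
    using Cmp_eq_extend[OF oplus_arr_pr(2)[OF assms(1-4)], of x] assms o by simp
qed

lemma oplus_arr_in [simp]:
  assumes "f \<in> Arr A" "g \<in> Arr A" "Dom A f = X" "Dom A g = Y"
  shows "oplus_arr A f g \<cdot> inl A X Y = inl A (Cod A f) (Cod A g) \<cdot> f"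
    "oplus_arr A f g \<cdot> inr A X Y = inr A (Cod A f) (Cod A g) \<cdot> g"
proof -
  have o: "X \<in> Obj A" "Y \<in> Obj A" using assms by auto
  then show "oplus_arr A f g \<cdot> inl A X Y = inl A (Cod A f) (Cod A g) \<cdot> f"
    "oplus_arr A f g \<cdot> inr A X Y = inr A (Cod A f) (Cod A g) \<cdot> g"
    using assms by (auto simp: oplus_arr_eq)
qed

lemma oplus_arr_comp:
  assumes "f \<in> Arr A" "g \<in> Arr A" "f' \<in> Arr A" "g' \<in> Arr A" "Cod A f = Dom A f'"
    "Cod A g = Dom A g'"
  shows "oplus_arr A f' g' \<cdot> oplus_arr A f g = oplus_arr A (f' \<cdot> f) (g' \<cdot> g)"
  by (rule biproduct_eqI[of "Cod A f'" "Cod A g'"]) (use assms in simp_all)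

lemma short_exact_oplus:
  assumes E: "short_exact A f g" "short_exact A f' g'"
  shows "short_exact A (oplus_arr A f f') (oplus_arr A g g')"
proof -
  note a = short_exact_arr[OF E(1)] short_exact_arr[OF E(2)]
  have "is_kernel A (oplus_arr A f f') (oplus_arr A g g')"
  proof (rule kernelI)
    show "oplus_arr A g g' \<cdot> oplus_arr A f f' = Zero A (Dom A (oplus_arr A f f')) (Cod A (oplus_arr
        A g g'))"
      by (rule biproduct_eqI[of "Cod A g" "Cod A g'"])
        (use a Cmp_eq_extend[OF a(4)] Cmp_eq_extend[OF a(10)] in simp_all)
    show "monic A (oplus_arr A f f')"
    proof (rule monicI)
      fix z assume z: "z \<in> Arr A" "Cod A z = Dom A (oplus_arr A f f')"
        "oplus_arr A f f' \<cdot> z = Zero A (Dom A z) (Cod A (oplus_arr A f f'))"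
      have "f \<cdot> prl A (Dom A f) (Dom A f') \<cdot> z = prl A (Cod A f) (Cod A f') \<cdot> oplus_arr A f f' \<cdot> z"
        "f' \<cdot> prr A (Dom A f) (Dom A f') \<cdot> z = prr A (Cod A f) (Cod A f') \<cdot> oplus_arr A f f' \<cdot> z"
        using z(1,2) a by simp_all
      then have eq: "f \<cdot> prl A (Dom A f) (Dom A f') \<cdot> z = f \<cdot> Zero A (Dom A z) (Dom A f)"
        "f' \<cdot> prr A (Dom A f) (Dom A f') \<cdot> z = f' \<cdot> Zero A (Dom A z) (Dom A f')"
        unfolding z(3) using z(1,2) a by simp_all
      have "prl A (Dom A f) (Dom A f') \<cdot> z = Zero A (Dom A z) (Dom A f)"
        by (rule monicD[OF a(5) eq(1)]) (use z(1,2) a in simp_all)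
      moreover have "prr A (Dom A f) (Dom A f') \<cdot> z = Zero A (Dom A z) (Dom A f')"
        by (rule monicD[OF a(11) eq(2)]) (use z(1,2) a in simp_all)
      ultimately show "z = Zero A (Dom A z) (Dom A (oplus_arr A f f'))"
        by - (rule biproduct_eqI[of "Dom A f" "Dom A f'"], use z(1,2) a in simp_all)
    qed (use a in simp)
    fix z assume z: "z \<in> Arr A" "Cod A z = Dom A (oplus_arr A g g')"
        "oplus_arr A g g' \<cdot> z = Zero A (Dom A z) (Cod A (oplus_arr A g g'))"
    have "g \<cdot> prl A (Dom A g) (Dom A g') \<cdot> z = prl A (Cod A g) (Cod A g') \<cdot> oplus_arr A g g' \<cdot> z"
      "g' \<cdot> prr A (Dom A g) (Dom A g') \<cdot> z = prr A (Cod A g) (Cod A g') \<cdot> oplus_arr A g g' \<cdot> z"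
      using z(1,2) a by simp_all
    then have eq: "g \<cdot> prl A (Dom A g) (Dom A g') \<cdot> z = Zero A (Dom A z) (Cod A g)"
      "g' \<cdot> prr A (Dom A g) (Dom A g') \<cdot> z = Zero A (Dom A z) (Cod A g')"
      unfolding z(3) using z(1,2) a by simp_all
    obtain v where v: "v \<in> Arr A" "Dom A v = Dom A z" "Cod A v = Dom A f"
        "f \<cdot> v = prl A (Dom A g) (Dom A g') \<cdot> z"
      using short_exact_lift[OF E(1), of "prl A (Dom A g) (Dom A g') \<cdot> z"] eq z(1,2) a by auto
    obtain w where w: "w \<in> Arr A" "Dom A w = Dom A z" "Cod A w = Dom A f'"
        "f' \<cdot> w = prr A (Dom A g) (Dom A g') \<cdot> z"
      using short_exact_lift[OF E(2), of "prr A (Dom A g) (Dom A g') \<cdot> z"] eq z(1,2) a by auto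
    let ?u = "inl A (Dom A f) (Dom A f') \<cdot> v \<oplus> inr A (Dom A f) (Dom A f') \<cdot> w"
    have "oplus_arr A f f' \<cdot> ?u = z"
      by (rule biproduct_eqI[of "Cod A f" "Cod A f'"]) (use v w z(1,2) a in simp_all)
    then show "\<exists>u. u \<in> Hom A (Dom A z) (Dom A (oplus_arr A f f')) \<and> oplus_arr A f f' \<cdot> u = z"
      using v(1-3) w(1-3) a by (intro exI[of _ ?u]) simp
  qed (use a in simp_all)
  moreover have "epic A (oplus_arr A g g')"
  proof (rule epicI)
    fix z assume z: "z \<in> Arr A" "Dom A z = Cod A (oplus_arr A g g')"
      "z \<cdot> oplus_arr A g g' = Zero A (Dom A (oplus_arr A g g')) (Cod A z)"
    have "(z \<cdot> inl A (Cod A g) (Cod A g')) \<cdot> g = (z \<cdot> oplus_arr A g g') \<cdot> inl A (Dom A g) (Dom A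
        g')"
      "(z \<cdot> inr A (Cod A g) (Cod A g')) \<cdot> g' = (z \<cdot> oplus_arr A g g') \<cdot> inr A (Dom A g) (Dom A g')"
      using z(1,2) a by simp_all
    then have eq: "(z \<cdot> inl A (Cod A g) (Cod A g')) \<cdot> g = Zero A (Cod A g) (Cod A z) \<cdot> g"
      "(z \<cdot> inr A (Cod A g) (Cod A g')) \<cdot> g' = Zero A (Cod A g') (Cod A z) \<cdot> g'"
      unfolding z(3) using z(1,2) a by (simp_all del: Cmp_assoc')
    have "z \<cdot> inl A (Cod A g) (Cod A g') = Zero A (Cod A g) (Cod A z)"
      by (rule epicD[OF a(6) eq(1)]) (use z(1,2) a in simp_all)
    moreover have "z \<cdot> inr A (Cod A g) (Cod A g') = Zero A (Cod A g') (Cod A z)"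
      by (rule epicD[OF a(12) eq(2)]) (use z(1,2) a in simp_all)
    ultimately show "z = Zero A (Cod A (oplus_arr A g g')) (Cod A z)"
      by - (rule biproduct_coeqI[of "Cod A g" "Cod A g'"], use z(1,2) a in simp_all)
  qed (use a in simp)
  ultimately show ?thesis using epic_cokernel by (simp add: short_exact_def)
qed

lemma ext_sum_simps [simp]:
  assumes "is_ext A E" "is_ext A F"
  shows "is_ext A (ext_sum A E F)" "sub A (ext_sum A E F) = oplus_obj A (sub A E) (sub A F)"
    "quo A (ext_sum A E F) = oplus_obj A (quo A E) (quo A F)"
      "mid A (ext_sum A E F) = oplus_obj A (mid A E) (mid A F)"
  using assms short_exact_oplus ext_arr[OF assms(1)] ext_arr[OF assms(2)]
    by (auto simp: ext_sum_def)

lemma ext_mor_sum: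
  assumes E: "is_ext A E" "is_ext A F" "is_ext A E'" "is_ext A F'"
    and m: "ext_mor A E E' \<alpha> \<gamma>" "ext_mor A F F' \<alpha>' \<gamma>'"
  shows "ext_mor A (ext_sum A E F) (ext_sum A E' F') (oplus_arr A \<alpha> \<alpha>') (oplus_arr A \<gamma> \<gamma>')"
proof -
  note [simp] = ext_mor_arr[OF m(1)] ext_mor_arr[OF m(2)] ext_arr[OF E(1)] ext_arr[OF E(2)]
      ext_arr[OF E(3)] ext_arr[OF E(4)]
  obtain h where [simp]: "h \<in> Arr A" "Dom A h = mid A E" "Cod A h = mid A E'"
    and 1: "h \<cdot> fst E = fst E' \<cdot> \<alpha>" "snd E' \<cdot> h = \<gamma> \<cdot> snd E" using ext_morE[OF m(1)] by metis
  obtain k where [simp]: "k \<in> Arr A" "Dom A k = mid A F" "Cod A k = mid A F'"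
    and 2: "k \<cdot> fst F = fst F' \<cdot> \<alpha>'" "snd F' \<cdot> k = \<gamma>' \<cdot> snd F" using ext_morE[OF m(2)] by metis
  show ?thesis
    by (rule ext_morI[of "oplus_arr A h k"]) (simp_all add: ext_sum_def oplus_arr_comp 1 2)
qed

lemma oplus_arr_Id: "X \<in> Obj A \<Longrightarrow> Y \<in> Obj A \<Longrightarrow> oplus_arr A (Id A X) (Id A Y) = Id A (oplus_obj A X Y)"
  by (simp add: oplus_arr_eq)

text \<open>\<open>ext_oplus\<close> is a union over all pairs of representatives. Sums of
  equivalent extensions are equivalent, so every member of the union is the same class.\<close>

lemma ext_oplus_class:
  assumes E: "is_ext A E" "is_ext A F"
  shows "ext_oplus A (ext_class A E) (ext_class A F) = ext_class A (ext_sum A E F)"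
proof -
  have *: "ext_class A (ext_sum A E' F') = ext_class A (ext_sum A E F)"
    if "E' \<in> ext_class A E" "F' \<in> ext_class A F" for E' F'
  proof -
    have E': "is_ext A E'" "sub A E' = sub A E" "quo A E' = quo A E"
        "ext_mor A E E' (Id A (sub A E)) (Id A (quo A E))"
      using that mem_ext_class[OF E(1)] by auto
    have F': "is_ext A F'" "sub A F' = sub A F" "quo A F' = quo A F"
        "ext_mor A F F' (Id A (sub A F)) (Id A (quo A F))"
      using that mem_ext_class[OF E(2)] by auto
    have "ext_mor A (ext_sum A E F) (ext_sum A E' F') (Id A (sub A (ext_sum A E F))) (Id A (quo A
        (ext_sum A E F)))"
      using ext_mor_sum[OF E E'(1) F'(1) E'(4) F'(4)] E ext_arr[OF E(1)] ext_arr[OF E(2)]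
      by (simp add: oplus_arr_Id)
    then show ?thesis using ext_class_eq[of "ext_sum A E F" "ext_sum A E' F'"] E E' F' by simp
  qed
  have "ext_class A E \<noteq> {}" "ext_class A F \<noteq> {}" using ext_class_self E by blast+
  have "ext_oplus A (ext_class A E) (ext_class A F) =
      (\<Union>E'\<in>ext_class A E. \<Union>F'\<in>ext_class A F. ext_class A (ext_sum A E' F'))"
    unfolding ext_oplus_def ext_sum_def case_prod_unfold ..
  also have "\<dots> = (\<Union>E'\<in>ext_class A E. ext_class A (ext_sum A E F))"
    by (rule SUP_cong[OF refl], rule SUP_eq_const) (use * \<open>ext_class A F \<noteq> {}\<close> in auto)
  also have "\<dots> = ext_class A (ext_sum A E F)" using \<open>ext_class A E \<noteq> {}\<close> by simp
  finally show ?thesis .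
qed

lemma baer_sum_class:
  assumes E: "is_ext A E" "is_ext A F"
  shows "baer_sum A X Y (ext_class A E) (ext_class A F) =
    ext_pull A (diagonal A X) (ext_push A (codiagonal A Y) (ext_class A (ext_sum A E F)))"
  by (simp add: baer_sum_def ext_oplus_class E)

text \<open>The two morphisms to \<open>E\<close> combine to one from the direct sum, with the
  codiagonal on subobjects and the row \<open>?c\<close> of \<open>a\<close> and \<open>b\<close> on
  quotients. The exchange rule turns the pushout in the Baer sum into a pullback along
  \<open>?c\<close>, and \<open>?c\<close> after the diagonal is
  \<open>a \<oplus> b\<close>.\<close>

lemma ext_pull_plus:
  assumes \<xi>: "\<xi> \<in> carrier (Ext1 A X Y)" and a: "a \<in> Hom A X' X" "b \<in> Hom A X' X"
  shows "ext_pull A (a \<oplus> b) \<xi> = ext_pull A a \<xi> \<otimes>\<^bsub>Ext1 A X' Y\<^esub> ext_pull A b \<xi>"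
proof -
  obtain E where E: "is_ext A E" "quo A E = X" "sub A E = Y" and \<xi>E: "\<xi> = ext_class A E"
      using Ext1E[OF \<xi>] .
  obtain P where P: "is_ext A P" "quo A P = X'" "sub A P = Y" "ext_mor A P E (Id A Y) a"
      "ext_pull A a \<xi> = ext_class A P"
    using ext_pull_ext[OF E(1), of a] E a \<xi>E by auto
  obtain Q where Q: "is_ext A Q" "quo A Q = X'" "sub A Q = Y" "ext_mor A Q E (Id A Y) b"
      "ext_pull A b \<xi> = ext_class A Q"
    using ext_pull_ext[OF E(1), of b] E a \<xi>E by auto
  have ob: "X' \<in> Obj A" "Y \<in> Obj A" "X \<in> Obj A" using a E ext_arr[OF E(1)] by auto
  note arr = ext_arr[OF E(1)] ext_arr[OF P(1)] ext_arr[OF Q(1)]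
  obtain h where h: "h \<in> Arr A" "Dom A h = mid A P" "Cod A h = mid A E"
    and 1: "h \<cdot> fst P = fst E \<cdot> Id A Y" "snd E \<cdot> h = a \<cdot> snd P" using ext_morE[OF P(4)] by metis
  obtain k where k: "k \<in> Arr A" "Dom A k = mid A Q" "Cod A k = mid A E"
    and 2: "k \<cdot> fst Q = fst E \<cdot> Id A Y" "snd E \<cdot> k = b \<cdot> snd Q" using ext_morE[OF Q(4)] by metis
  let ?p = "prl A (mid A P) (mid A Q)" and ?q = "prr A (mid A P) (mid A Q)"
  let ?c = "a \<cdot> prl A X' X' \<oplus> b \<cdot> prr A X' X'"
  have m: "ext_mor A (ext_sum A P Q) E (codiagonal A Y) ?c"
  proof (rule ext_morI[of "h \<cdot> ?p \<oplus> k \<cdot> ?q"])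
    have "(h \<cdot> ?p \<oplus> k \<cdot> ?q) \<cdot> fst (ext_sum A P Q) = (h \<cdot> fst P) \<cdot> prl A Y Y \<oplus> (k \<cdot> fst Q) \<cdot> prr A Y
        Y"
      using h k arr P(2,3) Q(2,3) ob by (simp add: ext_sum_def)
    then show "(h \<cdot> ?p \<oplus> k \<cdot> ?q) \<cdot> fst (ext_sum A P Q) = fst E \<cdot> codiagonal A Y"
      unfolding 1 2 using arr E ob by (simp add: codiagonal_eq)
    have "snd E \<cdot> (h \<cdot> ?p \<oplus> k \<cdot> ?q) = (snd E \<cdot> h) \<cdot> ?p \<oplus> (snd E \<cdot> k) \<cdot> ?q"
      using h k arr P(2,3) Q(2,3) ob by simp
    then show "snd E \<cdot> (h \<cdot> ?p \<oplus> k \<cdot> ?q) = ?c \<cdot> snd (ext_sum A P Q)"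
      unfolding 1 2 using h k arr P(2,3) Q(2,3) E a ob by (simp add: ext_sum_def)
  qed (use h k arr P Q E a ob in simp_all)
  have S: "is_ext A (ext_sum A P Q)" using P Q by simp
  have "ext_push A (codiagonal A Y) (ext_class A (ext_sum A P Q)) = ext_pull A ?c \<xi>"
    using push_eq_pull[OF S E(1) m] \<xi>E by simp
  then have "ext_pull A a \<xi> \<otimes>\<^bsub>Ext1 A X' Y\<^esub> ext_pull A b \<xi> = ext_pull A (diagonal A X') (ext_pull A
      ?c \<xi>)"
    by (simp add: Ext1_def P(5) Q(5) baer_sum_class P(1) Q(1))
  also have "\<dots> = ext_pull A (?c \<cdot> diagonal A X') \<xi>"
    by (rule ext_pull_comp[OF \<xi>]) (use a ob in simp_all)
  also have "?c \<cdot> diagonal A X' = a \<oplus> b" using a ob by (simp add: diagonal_eq)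
  finally show ?thesis by simp
qed

text \<open>Dually, \<open>E\<close> maps to the direct sum with the column \<open>?c\<close> on
  subobjects and the diagonal on quotients. The Baer sum pulls back last, so pullback and pushout
  are interchanged before the exchange rule can absorb the diagonal.\<close>

lemma ext_push_plus:
  assumes \<xi>: "\<xi> \<in> carrier (Ext1 A X Y)" and a: "a \<in> Hom A Y Y'" "b \<in> Hom A Y Y'"
  shows "ext_push A (a \<oplus> b) \<xi> = ext_push A a \<xi> \<otimes>\<^bsub>Ext1 A X Y'\<^esub> ext_push A b \<xi>"
proof -
  obtain E where E: "is_ext A E" "quo A E = X" "sub A E = Y" and \<xi>E: "\<xi> = ext_class A E"
      using Ext1E[OF \<xi>] .
  obtain P where P: "is_ext A P" "quo A P = X" "sub A P = Y'" "ext_mor A E P a (Id A X)"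
      "ext_push A a \<xi> = ext_class A P"
    using ext_push_ext[OF E(1), of a] E a \<xi>E by auto
  obtain Q where Q: "is_ext A Q" "quo A Q = X" "sub A Q = Y'" "ext_mor A E Q b (Id A X)"
      "ext_push A b \<xi> = ext_class A Q"
    using ext_push_ext[OF E(1), of b] E a \<xi>E by auto
  have ob: "X \<in> Obj A" "Y' \<in> Obj A" "Y \<in> Obj A" using a E ext_arr[OF E(1)] by auto
  note arr = ext_arr[OF E(1)] ext_arr[OF P(1)] ext_arr[OF Q(1)]
  obtain h where h: "h \<in> Arr A" "Dom A h = mid A E" "Cod A h = mid A P"
    and 1: "h \<cdot> fst E = fst P \<cdot> a" "snd P \<cdot> h = Id A X \<cdot> snd E" using ext_morE[OF P(4)] by metis
  obtain k where k: "k \<in> Arr A" "Dom A k = mid A E" "Cod A k = mid A Q"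
    and 2: "k \<cdot> fst E = fst Q \<cdot> b" "snd Q \<cdot> k = Id A X \<cdot> snd E" using ext_morE[OF Q(4)] by metis
  let ?i = "inl A (mid A P) (mid A Q)" and ?j = "inr A (mid A P) (mid A Q)"
  let ?c = "inl A Y' Y' \<cdot> a \<oplus> inr A Y' Y' \<cdot> b"
  let ?h = "?i \<cdot> h \<oplus> ?j \<cdot> k"
  have ha: "?h \<in> Arr A" "Dom A ?h = mid A E" "Cod A ?h = oplus_obj A (mid A P) (mid A Q)"
    using h k arr by simp_all
  have m: "ext_mor A E (ext_sum A P Q) ?c (diagonal A X)"
  proof (rule ext_morI[of ?h])
    have "?h \<cdot> fst E = ?i \<cdot> (h \<cdot> fst E) \<oplus> ?j \<cdot> (k \<cdot> fst E)"
      using h k arr by simp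
    also have "\<dots> = ?i \<cdot> fst P \<cdot> a \<oplus> ?j \<cdot> fst Q \<cdot> b" unfolding 1 2 ..
    also have "\<dots> = oplus_arr A (fst P) (fst Q) \<cdot> ?c"
      by (rule biproduct_eqI[of "mid A P" "mid A Q"]) (use arr P(2,3) Q(2,3) a ob in simp_all)
    finally show "?h \<cdot> fst E = fst (ext_sum A P Q) \<cdot> ?c" by (simp add: ext_sum_def)
    have "oplus_arr A (snd P) (snd Q) \<cdot> ?h = diagonal A X \<cdot> snd E"
    proof (rule biproduct_eqI[of X X])
      show "prl A X X \<cdot> oplus_arr A (snd P) (snd Q) \<cdot> ?h = prl A X X \<cdot> diagonal A X \<cdot> snd E"
        "prr A X X \<cdot> oplus_arr A (snd P) (snd Q) \<cdot> ?h = prr A X X \<cdot> diagonal A X \<cdot> snd E"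
        using h k 1(2) 2(2) arr P(2,3) Q(2,3) E a ob by (simp_all add: diagonal_eq)
    qed (use ha arr P(2,3) Q(2,3) E ob in simp_all)
    then show "snd (ext_sum A P Q) \<cdot> ?h = diagonal A X \<cdot> snd E" by (simp add: ext_sum_def)
  qed (use ha arr P Q E a ob in simp_all)
  have S: "is_ext A (ext_sum A P Q)" using P Q by simp
  have SX: "ext_class A (ext_sum A P Q) \<in> carrier (Ext1 A (oplus_obj A X X) (oplus_obj A Y' Y'))"
    using ext_class_in_Ext1[OF S] P Q by simp
  have "ext_push A a \<xi> \<otimes>\<^bsub>Ext1 A X Y'\<^esub> ext_push A b \<xi> =
      ext_pull A (diagonal A X) (ext_push A (codiagonal A Y') (ext_class A (ext_sum A P Q)))"
    by (simp add: Ext1_def P(5) Q(5) baer_sum_class P(1) Q(1))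
  also have "\<dots> = ext_push A (codiagonal A Y') (ext_pull A (diagonal A X) (ext_class A (ext_sum A P
      Q)))"
    by (rule ext_push_pull[OF SX, symmetric]) (use ob in simp_all)
  also have "\<dots> = ext_push A (codiagonal A Y') (ext_push A ?c \<xi>)"
    using push_eq_pull[OF E(1) S m] \<xi>E by simp
  also have "\<dots> = ext_push A (codiagonal A Y' \<cdot> ?c) \<xi>"
    by (rule ext_push_comp[OF \<xi>]) (use a ob in simp_all)
  also have "codiagonal A Y' \<cdot> ?c = a \<oplus> b" using a ob by (simp add: codiagonal_eq)
  finally show ?thesis by simp
qed

end

section \<open>Maps induced on quotient groups\<close>

text \<open>No law is presupposed for \<open>H\<close>; each one is read off on preimages under
  \<open>d\<close>. This is how the Baer sum acquires its group axioms.\<close>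

lemma comm_group_surj_image:
  assumes G: "comm_group G" and surj: "d ` carrier G = carrier H"
    and mult: "\<And>x y. x \<in> carrier G \<Longrightarrow> y \<in> carrier G \<Longrightarrow> d (x \<otimes>\<^bsub>G\<^esub> y) = d x \<otimes>\<^bsub>H\<^esub> d y"
    and one: "d \<one>\<^bsub>G\<^esub> = \<one>\<^bsub>H\<^esub>"
  shows "comm_group H"
proof -
  interpret comm_group G by (rule G)
  have dc: "d x \<in> carrier H" if "x \<in> carrier G" for x using that surj by blast
  have ex: "\<exists>u\<in>carrier G. x = d u" if "x \<in> carrier H" for x using that surj by blast
  show ?thesis
  proof (rule comm_groupI)
    fix x y assume "x \<in> carrier H" "y \<in> carrier H"
    then obtain u v where u: "u \<in> carrier G" "v \<in> carrier G" and [simp]: "x = d u" "y = d v"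
        using ex by metis
    show "x \<otimes>\<^bsub>H\<^esub> y \<in> carrier H" using u dc by (simp flip: mult)
    show "x \<otimes>\<^bsub>H\<^esub> y = y \<otimes>\<^bsub>H\<^esub> x" using u by (simp add: m_comm flip: mult)
  next
    fix x y z assume "x \<in> carrier H" "y \<in> carrier H" "z \<in> carrier H"
    then obtain u v w where "u \<in> carrier G" "v \<in> carrier G" "w \<in> carrier G"
        and [simp]: "x = d u" "y = d v" "z = d w"
      using ex by metis
    then show "x \<otimes>\<^bsub>H\<^esub> y \<otimes>\<^bsub>H\<^esub> z = x \<otimes>\<^bsub>H\<^esub> (y \<otimes>\<^bsub>H\<^esub> z)" by (simp add: m_assoc flip: mult)
  next
    show "\<one>\<^bsub>H\<^esub> \<in> carrier H" using dc by (simp flip: one)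
  next
    fix x assume "x \<in> carrier H"
    then obtain u where u: "u \<in> carrier G" and [simp]: "x = d u" using ex by metis
    show "\<one>\<^bsub>H\<^esub> \<otimes>\<^bsub>H\<^esub> x = x" using u by (simp flip: mult one)
    have "d (inv\<^bsub>G\<^esub> u) \<otimes>\<^bsub>H\<^esub> x = \<one>\<^bsub>H\<^esub>" using u by (simp flip: mult one)
    then show "\<exists>y\<in>carrier H. y \<otimes>\<^bsub>H\<^esub> x = \<one>\<^bsub>H\<^esub>" using u dc by blast
  qed
qed

lemma comm_group_subgroup:
  assumes "comm_group G" "subgroup K G" shows "comm_group (G\<lparr>carrier := K\<rparr>)"
proof -
  interpret comm_group G by (rule assms)
  interpret K: group "G\<lparr>carrier := K\<rparr>"
      by (rule subgroup.subgroup_is_group[OF assms(2) group_axioms])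
  show ?thesis
    by (rule K.group_comm_groupI) (use subgroup.mem_carrier[OF assms(2)] m_comm in auto)
qed

text \<open>The shape of \<open>deltaV\<close> and \<open>deltaW\<close>: \<open>the_elem\<close> of
  an image is the common value of \<open>d\<close> on a coset, constant because \<open>d\<close>
  kills \<open>F\<close>.\<close>

lemma Mod_induced_map:
  fixes G (structure)
  assumes G: "comm_group G" and F: "subgroup F G" and d: "d \<in> hom G H" and H: "group H"
    and ker: "\<And>x. x \<in> F \<Longrightarrow> d x = \<one>\<^bsub>H\<^esub>"
  shows "x \<in> carrier G \<Longrightarrow> the_elem (d ` (F #>\<^bsub>G\<^esub> x)) = d x"
    and "(\<lambda>c. the_elem (d ` c)) \<in> hom (G Mod F) H"
proof -
  interpret comm_group G by (rule G)
  interpret H: group H by (rule H)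
  interpret F: normal F G by (rule subgroup_imp_normal[OF F])
  show *: "the_elem (d ` (F #>\<^bsub>G\<^esub> x)) = d x" if x: "x \<in> carrier G" for x
  proof (rule the_elem_image_unique)
    show "F #> x \<noteq> {}" using rcos_self[OF x F] by blast
    fix y assume "y \<in> F #> x"
    then obtain f where f: "f \<in> F" "y = f \<otimes> x" by (auto simp: r_coset_def)
    have "f \<in> carrier G" "d x \<in> carrier H" using subgroup.mem_carrier[OF F f(1)] d x
        by (auto simp: hom_def)
    then show "d y = d x" using f x hom_mult[OF d] ker by simp
  qed
  show "(\<lambda>c. the_elem (d ` c)) \<in> hom (G Mod F) H"
  proof (rule homI)
    fix a assume "a \<in> carrier (G Mod F)"
    then show "the_elem (d ` a) \<in> carrier H" using * d by (auto simp: carrier_FactGroup hom_def)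
  next
    fix a b assume "a \<in> carrier (G Mod F)" "b \<in> carrier (G Mod F)"
    then obtain x y where "x \<in> carrier G" "y \<in> carrier G" "a = F #> x" "b = F #> y"
        by (auto simp: carrier_FactGroup)
    then show "the_elem (d ` (a \<otimes>\<^bsub>G Mod F\<^esub> b)) = the_elem (d ` a) \<otimes>\<^bsub>H\<^esub> the_elem (d ` b)"
      using * hom_mult[OF d] by (simp add: F.rcos_sum)
  qed
qed

text \<open>The shape of \<open>betaV\<close> and \<open>betaW\<close>. As \<open>d\<close> is onto
  with kernel inside \<open>F\<close>, \<open>H\<close> is \<open>G\<close> modulo that kernel and
  projects to \<open>G Mod F\<close>; concretely, all preimages of an element lie in one coset of
  \<open>F\<close>.\<close>

lemma Mod_section_map:
  fixes G (structure)
  assumes G: "comm_group G" and F: "subgroup F G" and d: "d \<in> hom G H" and H: "group H"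
    and surj: "d ` carrier G = carrier H" and ker: "\<And>x. x \<in> carrier G \<Longrightarrow> d x = \<one>\<^bsub>H\<^esub> \<Longrightarrow> x \<in> F"
  shows "x \<in> carrier G \<Longrightarrow> the_elem ((\<lambda>y. F #>\<^bsub>G\<^esub> y) ` {y \<in> carrier G. d y = d x}) = F #>\<^bsub>G\<^esub> x"
    and "(\<lambda>\<xi>. the_elem ((\<lambda>y. F #>\<^bsub>G\<^esub> y) ` {y \<in> carrier G. d y = \<xi>})) \<in> hom H (G Mod F)"
proof -
  interpret comm_group G by (rule G)
  interpret H: group H by (rule H)
  interpret F: normal F G by (rule subgroup_imp_normal[OF F])
  interpret d: group_hom G H d by unfold_locales (rule d)
  show *: "the_elem ((\<lambda>y. F #> y) ` {y \<in> carrier G. d y = d x}) = F #> x" if x: "x \<in> carrier G"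
      for x
  proof (rule the_elem_image_unique)
    show "{y \<in> carrier G. d y = d x} \<noteq> {}" using x by blast
    fix y assume "y \<in> {y \<in> carrier G. d y = d x}"
    then have y: "y \<in> carrier G" "d y = d x" by auto
    then have "d (y \<otimes> inv x) = \<one>\<^bsub>H\<^esub>" using x by simp
    then have "y \<otimes> inv x \<in> F" using ker x y by simp
    then have "y \<in> F #> x" using subgroup.rcos_module[OF F group_axioms x] y by blast
    then show "F #> y = F #> x" using repr_independence[OF _ x F] by simp
  qed
  show "(\<lambda>\<xi>. the_elem ((\<lambda>y. F #> y) ` {y \<in> carrier G. d y = \<xi>})) \<in> hom H (G Mod F)"
  proof (rule homI)
    fix \<xi> assume "\<xi> \<in> carrier H"
    then obtain x where "x \<in> carrier G" "\<xi> = d x" using surj by blast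
    then show "the_elem ((\<lambda>y. F #> y) ` {y \<in> carrier G. d y = \<xi>}) \<in> carrier (G Mod F)"
      using * by (auto simp: carrier_FactGroup)
  next
    fix \<xi> \<eta> assume "\<xi> \<in> carrier H" "\<eta> \<in> carrier H"
    then obtain x y where xy: "x \<in> carrier G" "\<xi> = d x" "y \<in> carrier G" "\<eta> = d y" using surj
        by blast
    then have "\<xi> \<otimes>\<^bsub>H\<^esub> \<eta> = d (x \<otimes> y)" by simp
    then show "the_elem ((\<lambda>y. F #> y) ` {y \<in> carrier G. d y = \<xi> \<otimes>\<^bsub>H\<^esub> \<eta>}) =
        the_elem ((\<lambda>y. F #> y) ` {y \<in> carrier G. d y = \<xi>}) \<otimes>\<^bsub>G Mod F\<^esub>
        the_elem ((\<lambda>y. F #> y) ` {y \<in> carrier G. d y = \<eta>})"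
      using xy *[of "x \<otimes> y"] *[of x] *[of y] by (simp add: F.rcos_sum)
  qed
qed

section \<open>Stable Hom groups\<close>

context abelian_category
begin

lemma inv_Hom_group [simp]: "f \<in> Hom A X Y \<Longrightarrow> inv\<^bsub>Hom_group A X Y\<^esub> f = Neg f"
  by (auto simp: Neg_def)

lemma subgroup_Hom_groupI:
  assumes "X \<in> Obj A" "Y \<in> Obj A" "K \<subseteq> Hom A X Y" "Zero A X Y \<in> K"
    "\<And>f g. f \<in> K \<Longrightarrow> g \<in> K \<Longrightarrow> f \<oplus> g \<in> K" "\<And>f. f \<in> K \<Longrightarrow> Neg f \<in> K"
  shows "subgroup K (Hom_group A X Y)"
proof -
  interpret comm_group "Hom_group A X Y" using assms Hom_comm_group by blast
  show ?thesis
    by (rule subgroupI) (use assms in \<open>auto simp del: mem_Hom\<close>)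
qed

text \<open>A sum of two such morphisms factors through a biproduct of the intermediate objects, and
  additivity of \<open>V\<close> supplies one inside \<open>V\<close>. For a negative the
  intermediate object stays the same.\<close>

lemma subgroup_factoring_through:
  assumes V: "additive_subcategory A V" and ob: "X \<in> Obj A" "Y \<in> Obj A"
  shows "subgroup (factoring_through A V X Y) (Hom_group A X Y)"
proof (rule subgroup_Hom_groupI[OF ob])
  show "factoring_through A V X Y \<subseteq> Hom A X Y" by (auto simp: factoring_through_def)
  obtain Z where Z: "Z \<in> V" "Z \<in> Obj A" using V by (auto simp: additive_subcategory_def)
  show "Zero A X Y \<in> factoring_through A V X Y"
    unfolding factoring_through_def using Z ob
    by (intro CollectI bexI[of _ Z] bexI[of _ "Zero A X Z"] bexI[of _ "Zero A Z Y"]) simp_all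
next
  fix f g assume "f \<in> factoring_through A V X Y" "g \<in> factoring_through A V X Y"
  then obtain Z u v Z' u' v' where Z: "Z \<in> V" "Z' \<in> V"
    and uv: "u \<in> Hom A X Z" "v \<in> Hom A Z Y" "u' \<in> Hom A X Z'" "v' \<in> Hom A Z' Y"
    and fg: "f = v \<cdot> u" "g = v' \<cdot> u'" unfolding factoring_through_def by blast
  have "\<exists>P. is_biproduct A Z Z' P \<and> fst P \<in> V" using V Z unfolding additive_subcategory_def by blast
  then obtain P i1 i2 p1 p2 where "is_biproduct A Z Z' (P, i1, i2, p1, p2)" and P: "P \<in> V"
    by (metis fst_conv prod_cases5)
  then have bp: "P \<in> Obj A" "i1 \<in> Arr A" "Dom A i1 = Z" "Cod A i1 = P"
    "i2 \<in> Arr A" "Dom A i2 = Z'" "Cod A i2 = P"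
    "p1 \<in> Arr A" "Dom A p1 = P" "Cod A p1 = Z" "p2 \<in> Arr A" "Dom A p2 = P" "Cod A p2 = Z'"
    and bpe: "p1 \<cdot> i1 = Id A Z" "p2 \<cdot> i2 = Id A Z'" "p2 \<cdot> i1 = Zero A Z Z'" "p1 \<cdot> i2 = Zero A Z' Z"
    unfolding is_biproduct_def by auto
  have ob': "Z \<in> Obj A" "Z' \<in> Obj A" using uv by auto
  have "(v \<cdot> p1 \<oplus> v' \<cdot> p2) \<cdot> (i1 \<cdot> u \<oplus> i2 \<cdot> u') = f \<oplus> g"
    using uv bp ob ob'
      by (simp add: fg Cmp_eq_extend[OF bpe(1)] Cmp_eq_extend[OF bpe(2)] Cmp_eq_extend[OF bpe(3)]
        Cmp_eq_extend[OF bpe(4)])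
  then show "f \<oplus> g \<in> factoring_through A V X Y"
    unfolding factoring_through_def using P uv bp
    by (intro CollectI bexI[of _ P] bexI[of _ "i1 \<cdot> u \<oplus> i2 \<cdot> u'"] bexI[of _ "v \<cdot> p1 \<oplus> v' \<cdot> p2"])
      simp_all
next
  fix f assume "f \<in> factoring_through A V X Y"
  then obtain Z u v where uv: "Z \<in> V" "u \<in> Hom A X Z" "v \<in> Hom A Z Y" "f = v \<cdot> u"
    unfolding factoring_through_def by blast
  then have "Neg f = v \<cdot> Neg u" "Neg u \<in> Hom A X Z" by auto
  then show "Neg f \<in> factoring_through A V X Y" using uv unfolding factoring_through_def by blast
qed

lemma stable_class_eq:
  "f \<in> Hom A X Y \<Longrightarrow> stable_class A V f = factoring_through A V X Y #>\<^bsub>Hom_group A X Y\<^esub> f"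
  by (simp add: stable_class_def)

lemma carrier_stable_Hom: "carrier (stable_Hom A V X Y) = stable_class A V ` Hom A X Y"
  by (auto simp: stable_Hom_def carrier_FactGroup stable_class_eq)

lemma comm_group_stable_Hom:
  assumes "additive_subcategory A V" "X \<in> Obj A" "Y \<in> Obj A"
  shows "comm_group (stable_Hom A V X Y)"
  unfolding stable_Hom_def
  by (rule comm_group.abelian_FactGroup[OF Hom_comm_group[OF assms(2,3)]
    subgroup_factoring_through[OF assms]])

lemma factoring_through_comp:
  assumes "f \<in> factoring_through A V X Y" "a \<in> Hom A X' X" "b \<in> Hom A Y Y'"
  shows "b \<cdot> f \<cdot> a \<in> factoring_through A V X' Y'"
proof -
  obtain Z u v where uv: "Z \<in> V" "u \<in> Hom A X Z" "v \<in> Hom A Z Y" "f = v \<cdot> u"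
    using assms(1) unfolding factoring_through_def by blast
  then have "b \<cdot> f \<cdot> a = (b \<cdot> v) \<cdot> (u \<cdot> a)" "u \<cdot> a \<in> Hom A X' Z" "b \<cdot> v \<in> Hom A Z Y'" using assms
      by auto
  then show ?thesis using uv unfolding factoring_through_def by blast
qed

text \<open>Independence of the representative: morphisms through \<open>V\<close> form a two-sided
  ideal, by \<open>factoring_through_comp\<close>.\<close>

lemma stable_act_class:
  assumes V: "additive_subcategory A V" and x: "x \<in> Hom A X Y" and a: "a \<in> Hom A X' X"
    and b: "b \<in> Hom A Y Y'"
  shows "stable_act A V a b (stable_class A V x) = stable_class A V (b \<cdot> x \<cdot> a)"
  unfolding stable_act_def
proof (rule the_elem_image_unique)
  have ob: "X \<in> Obj A" "Y \<in> Obj A" "X' \<in> Obj A" "Y' \<in> Obj A" using x a b by auto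
  interpret G: comm_group "Hom_group A X Y" using Hom_comm_group ob by blast
  interpret G': comm_group "Hom_group A X' Y'" using Hom_comm_group ob by blast
  note F = subgroup_factoring_through[OF V ob(1,2)]
      and F' = subgroup_factoring_through[OF V ob(3,4)]
  have "x \<in> stable_class A V x" using G.rcos_self[OF _ F, of x] x by (simp add: stable_class_eq)
  then show "stable_class A V x \<noteq> {}" by blast
  fix y assume "y \<in> stable_class A V x"
  then obtain f where f: "f \<in> factoring_through A V X Y" "y = f \<oplus> x"
    using x by (auto simp: stable_class_eq r_coset_def)
  have fH: "f \<in> Hom A X Y" using subgroup.mem_carrier[OF F f(1)] by simp
  have "b \<cdot> y \<cdot> a = b \<cdot> f \<cdot> a \<oplus> b \<cdot> x \<cdot> a" using f fH x a b by auto
  then have "b \<cdot> y \<cdot> a \<in> factoring_through A V X' Y' #>\<^bsub>Hom_group A X' Y'\<^esub> (b \<cdot> x \<cdot> a)"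
    using factoring_through_comp[OF f(1) a b] by (auto simp: r_coset_def)
  then have "factoring_through A V X' Y' #>\<^bsub>Hom_group A X' Y'\<^esub> (b \<cdot> x \<cdot> a) =
      factoring_through A V X' Y' #>\<^bsub>Hom_group A X' Y'\<^esub> (b \<cdot> y \<cdot> a)"
    by (rule G'.repr_independence) (use x a b F' in auto)
  then show "stable_class A V (b \<cdot> y \<cdot> a) = stable_class A V (b \<cdot> x \<cdot> a)"
    using f fH x a b by (simp add: stable_class_eq[of _ X' Y'])
qed

section \<open>Connecting maps\<close>

lemma ext_pull_Zero:
  assumes "\<xi> \<in> carrier (Ext1 A X Y)" "X' \<in> Obj A"
  shows "ext_pull A (Zero A X' X) \<xi> = \<one>\<^bsub>Ext1 A X' Y\<^esub>"
proof -
  obtain E where E: "is_ext A E" "quo A E = X" "sub A E = Y" "\<xi> = ext_class A E"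
      using Ext1E[OF assms(1)] .
  have "snd E \<cdot> Zero A X' (mid A E) = Zero A X' X" "Zero A X' (mid A E) \<in> Hom A X' (mid A E)"
      "Zero A X' X \<in> Hom A X' X"
    using ext_arr[OF E(1)] E assms by auto
  then show ?thesis using ext_pull_eq_one[OF E(1-3)] E(4) by blast
qed

lemma ext_push_Zero:
  assumes "\<xi> \<in> carrier (Ext1 A X Y)" "Y' \<in> Obj A"
  shows "ext_push A (Zero A Y Y') \<xi> = \<one>\<^bsub>Ext1 A X Y'\<^esub>"
proof -
  obtain E where E: "is_ext A E" "quo A E = X" "sub A E = Y" "\<xi> = ext_class A E"
      using Ext1E[OF assms(1)] .
  have "Zero A (mid A E) Y' \<cdot> fst E = Zero A Y Y'" "Zero A (mid A E) Y' \<in> Hom A (mid A E) Y'"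
      "Zero A Y Y' \<in> Hom A Y Y'"
    using ext_arr[OF E(1)] E assms by auto
  then show ?thesis using ext_push_eq_one[OF E(1-3)] E(4) by blast
qed

text \<open>The zero class is itself a pushout along a zero morphism. Interchanging that pushout
  with the pullback gives zero again.\<close>

lemma ext_pull_one:
  assumes "a \<in> Hom A X' X" "Y \<in> Obj A" shows "ext_pull A a \<one>\<^bsub>Ext1 A X Y\<^esub> = \<one>\<^bsub>Ext1 A X' Y\<^esub>"
proof -
  have X: "X \<in> Obj A" "X' \<in> Obj A" using assms by auto
  have c: "\<one>\<^bsub>Ext1 A X Y\<^esub> \<in> carrier (Ext1 A X Y)" by (rule one_in_Ext1[OF X(1) assms(2)])
  have Z: "\<one>\<^bsub>Ext1 A X Y\<^esub> = ext_push A (Zero A Y Y) \<one>\<^bsub>Ext1 A X Y\<^esub>" using ext_push_Zero[OF c assms(2)]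
      by simp
  have "ext_pull A a (ext_push A (Zero A Y Y) \<one>\<^bsub>Ext1 A X Y\<^esub>) =
      ext_push A (Zero A Y Y) (ext_pull A a \<one>\<^bsub>Ext1 A X Y\<^esub>)"
    by (rule ext_push_pull[OF c assms(1), symmetric]) (use assms in simp)
  also have "\<dots> = \<one>\<^bsub>Ext1 A X' Y\<^esub>" by (rule ext_push_Zero[OF ext_pull_closed[OF c assms(1)] assms(2)])
  finally show ?thesis using Z by simp
qed

lemma ext_push_one:
  assumes "b \<in> Hom A Y Y'" "X \<in> Obj A" shows "ext_push A b \<one>\<^bsub>Ext1 A X Y\<^esub> = \<one>\<^bsub>Ext1 A X Y'\<^esub>"
proof -
  have Y: "Y \<in> Obj A" "Y' \<in> Obj A" using assms by auto
  have c: "\<one>\<^bsub>Ext1 A X Y\<^esub> \<in> carrier (Ext1 A X Y)" by (rule one_in_Ext1[OF assms(2) Y(1)])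
  have Z: "\<one>\<^bsub>Ext1 A X Y\<^esub> = ext_pull A (Zero A X X) \<one>\<^bsub>Ext1 A X Y\<^esub>" using ext_pull_Zero[OF c assms(2)]
      by simp
  have "ext_push A b (ext_pull A (Zero A X X) \<one>\<^bsub>Ext1 A X Y\<^esub>) =
      ext_pull A (Zero A X X) (ext_push A b \<one>\<^bsub>Ext1 A X Y\<^esub>)"
    by (rule ext_push_pull[OF c _ assms(1)]) (use assms in simp)
  also have "\<dots> = \<one>\<^bsub>Ext1 A X Y'\<^esub>" by (rule ext_pull_Zero[OF ext_push_closed[OF c assms(1)] assms(2)])
  finally show ?thesis using Z by simp
qed

section \<open>Vanishing and exactness at \<open>Ext1\<close>\<close>

lemma left_perp_trivial: "X \<in> left_perp A V \<Longrightarrow> Y \<in> V \<Longrightarrow> \<xi> \<in> carrier (Ext1 A X Y) \<Longrightarrow> \<xi> = \<one>\<^bsub>Ext1 A X Y\<^esub>"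
  by (auto simp: left_perp_def)

lemma right_perp_trivial: "Y \<in> right_perp A W \<Longrightarrow> X \<in> W \<Longrightarrow> \<xi> \<in> carrier (Ext1 A X Y) \<Longrightarrow> \<xi> =
  \<one>\<^bsub>Ext1 A X Y\<^esub>"
  by (auto simp: right_perp_def)

text \<open>Exactness of \<open>Hom(X, quo D)\<close>, \<open>Ext1(X, sub D)\<close>,
  \<open>Ext1(X, mid D)\<close> at the middle term. If the class of \<open>F\<close> dies in the
  last group, \<open>fst D\<close> extends along \<open>fst F\<close> to a map \<open>u\<close> of
  middle terms, and the map it induces on quotients is the preimage.\<close>

lemma ext_pull_surj:
  assumes D: "is_ext A D" and \<xi>: "\<xi> \<in> carrier (Ext1 A X (sub A D))"
    and z: "ext_push A (fst D) \<xi> = \<one>\<^bsub>Ext1 A X (mid A D)\<^esub>"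
  shows "\<exists>h\<in>Hom A X (quo A D). ext_pull A h (ext_class A D) = \<xi>"
proof -
  note Da = short_exact_arr[OF D]
  obtain F where F: "is_ext A F" "quo A F = X" "sub A F = sub A D" "\<xi> = ext_class A F"
      using Ext1E[OF \<xi>] .
  note Fa = short_exact_arr[OF F(1)]
  have "fst D \<in> Hom A (sub A D) (mid A D)" using Da by simp
  from ext_push_eq_one[OF F(1-3) this] z F(4) obtain u where u: "u \<in> Arr A" "Dom A u = mid A F"
      "Cod A u = mid A D" and u1: "u \<cdot> fst F = fst D"
    by auto
  have "(snd D \<cdot> u) \<cdot> fst F = snd D \<cdot> (u \<cdot> fst F)" using u Da Fa by simp
  also have "\<dots> = Zero A (sub A F) (quo A D)" unfolding u1 using Da F by simp
  finally obtain g where g: "g \<in> Arr A" "Dom A g = X" "Cod A g = quo A D" "g \<cdot> snd F = snd D \<cdot> u"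
    using short_exact_colift[OF F(1), of "snd D \<cdot> u"] u Da Fa(1-3) F(2) by auto
  have ob: "sub A D \<in> Obj A" using Da by simp
  have m: "ext_mor A F D (Id A (sub A D)) g"
    by (rule ext_morI[of u]) (use u u1 g Da Fa F ob in auto)
  have "ext_pull A g (ext_class A D) = \<xi>"
    using push_eq_pull[OF F(1) D m] ext_push_Id[OF \<xi>] F(4) by simp
  then show ?thesis using g by auto
qed

text \<open>The contravariant counterpart: if the class dies after pullback along
  \<open>snd E\<close>, that morphism lifts to the middle of \<open>F\<close>, and the lift
  restricts to the required map of subobjects.\<close>

lemma ext_push_surj:
  assumes E: "is_ext A E" and \<xi>: "\<xi> \<in> carrier (Ext1 A (quo A E) Y)"
    and z: "ext_pull A (snd E) \<xi> = \<one>\<^bsub>Ext1 A (mid A E) Y\<^esub>"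
  shows "\<exists>h\<in>Hom A (sub A E) Y. ext_push A h (ext_class A E) = \<xi>"
proof -
  note Ea = short_exact_arr[OF E]
  obtain F where F: "is_ext A F" "quo A F = quo A E" "sub A F = Y" "\<xi> = ext_class A F"
      using Ext1E[OF \<xi>] .
  note Fa = short_exact_arr[OF F(1)]
  have "snd E \<in> Hom A (mid A E) (quo A E)" using Ea by simp
  from ext_pull_eq_one[OF F(1-3) this] z F(4) obtain u where u: "u \<in> Arr A" "Dom A u = mid A E"
      "Cod A u = mid A F" and u1: "snd F \<cdot> u = snd E"
    by auto
  have "snd F \<cdot> (u \<cdot> fst E) = snd E \<cdot> fst E"
      by (rule Cmp_eq_extend[OF u1]) (use u Ea Fa in simp_all)
  then obtain g where g: "g \<in> Arr A" "Dom A g = sub A E" "Cod A g = Y" "fst F \<cdot> g = u \<cdot> fst E"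
    using short_exact_lift[OF F(1), of "u \<cdot> fst E"] u Ea Fa(1-3) F(2,3) by auto
  have ob: "quo A E \<in> Obj A" using Ea by simp
  have m: "ext_mor A E F g (Id A (quo A E))"
    by (rule ext_morI[of u]) (use u u1 g Ea Fa F ob in auto)
  have "ext_push A g (ext_class A E) = \<xi>"
    using push_eq_pull[OF E F(1) m] ext_pull_Id[OF \<xi>] F(4) by simp
  then show ?thesis using g by auto
qed

end

text \<open>One piece of the zigzag. \<open>E\<close> comes from the coresolution of
  \<open>M\<close> and \<open>D\<close> from that of \<open>N\<close>; stable Hom of the subobjects
  goes by \<delta> to \<open>Ext1 A (quo A E) (sub A D)\<close>, and from there by \<beta> to stable
  Hom of the quotients.\<close>

locale V_step = abelian_category A for A :: "('o, 'a) additive_data" +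
  fixes V E D
  assumes V: "additive_subcategory A V"
    and E: "is_ext A E" "mid A E \<in> V" "quo A E \<in> left_perp A V"
    and D: "is_ext A D" "mid A D \<in> V"
begin

abbreviation G where "G \<equiv> Hom_group A (quo A E) (quo A D)"
abbreviation H where "H \<equiv> Ext1 A (quo A E) (sub A D)"
abbreviation F where "F \<equiv> factoring_through A V (quo A E) (quo A D)"
abbreviation conn where "conn h \<equiv> ext_pull A h (ext_class A D)"

lemma Ea: "fst E \<in> Arr A" "snd E \<in> Arr A" "Dom A (snd E) = mid A E" "fst D \<in> Arr A" "snd D \<in> Arr A"
  "Dom A (snd D) = mid A D"
  using ext_arr[OF E(1)] ext_arr[OF D(1)] by auto

lemma obs: "sub A E \<in> Obj A" "quo A E \<in> Obj A" "sub A D \<in> Obj A" "quo A D \<in> Obj A" "mid A E \<in> Obj A"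
  "mid A D \<in> Obj A"
  using Ea by auto

lemma classes: "ext_class A D \<in> carrier (Ext1 A (quo A D) (sub A D))"
  "ext_class A E \<in> carrier (Ext1 A (quo A E) (sub A E))"
  using ext_class_in_Ext1 E D by auto

text \<open>The obstruction lies in \<open>Ext1 A (quo A E) (mid A D)\<close>, which is trivial:
  \<open>quo A E\<close> is left orthogonal to \<open>V\<close> and \<open>mid A D\<close> is in
  \<open>V\<close>.\<close>

lemma conn_surj: "conn ` carrier G = carrier H"
proof
  show "conn ` carrier G \<subseteq> carrier H"
    using ext_pull_closed[OF classes(1)] by (auto simp del: mem_Hom)
  show "carrier H \<subseteq> conn ` carrier G"
  proof
    fix \<xi> assume \<xi>: "\<xi> \<in> carrier H"
    have "ext_push A (fst D) \<xi> \<in> carrier (Ext1 A (quo A E) (mid A D))"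
      by (rule ext_push_closed[OF \<xi>]) (use Ea in simp)
    from left_perp_trivial[OF E(3) D(2) this] ext_pull_surj[OF D(1) \<xi>]
    show "\<xi> \<in> conn ` carrier G" by auto
  qed
qed

lemma comm_group_Ext: "comm_group H"
  by (rule comm_group_surj_image[OF Hom_comm_group conn_surj])
    (use obs ext_pull_plus[OF classes(1)] ext_pull_Zero[OF classes(1)] in auto)

lemma conn_hom: "conn \<in> hom G H"
  by (rule homI) (use ext_pull_plus[OF classes(1)] ext_pull_closed[OF classes(1)] in \<open>auto simp del:
    mem_Hom\<close>)

lemma group_Ext: "group H"
  by (rule comm_group.axioms(2)[OF comm_group_Ext])

text \<open>A morphism with trivial image lifts to \<open>mid A D\<close>, an object of
  \<open>V\<close>. This makes \<beta> well defined.\<close>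

lemma conn_ker:
  assumes "h \<in> Hom A (quo A E) (quo A D)" "conn h = \<one>\<^bsub>H\<^esub>"
  shows "h \<in> F"
proof -
  obtain u where "u \<in> Hom A (quo A E) (mid A D)" "snd D \<cdot> u = h"
    using ext_pull_eq_one[OF D(1) refl refl assms(1)] assms(2) by blast
  moreover have "snd D \<in> Hom A (mid A D) (quo A D)" using Ea by simp
  ultimately show ?thesis unfolding factoring_through_def using D(2) by blast
qed

lemma betaV_eq:
  "betaV A V (quo A E) D = (\<lambda>\<xi>. the_elem ((\<lambda>h. F #>\<^bsub>G\<^esub> h)
      ` {h \<in> carrier G. conn h = \<xi>}))"
proof
  fix \<xi>
  have "stable_class A V ` {h \<in> Hom A (quo A E) (quo A D). conn h = \<xi>} =
      (\<lambda>h. F #>\<^bsub>G\<^esub> h) ` {h \<in> Hom A (quo A E) (quo A D). conn h = \<xi>}"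
    by (rule image_cong) (auto simp: stable_class_eq)
  then show "betaV A V (quo A E) D \<xi> = the_elem ((\<lambda>h. F #>\<^bsub>G\<^esub> h)
      ` {h \<in> carrier G. conn h = \<xi>})"
    by (simp add: betaV_def connecting_pull_def)
qed

lemmas section_facts = Mod_section_map[OF Hom_comm_group[OF obs(2,4)] subgroup_factoring_through[OF
    V obs(2,4)]
  conn_hom group_Ext conn_surj]

lemma betaV_hom: "betaV A V (quo A E) D \<in> hom H (stable_Hom A V (quo A E) (quo A D))"
  unfolding betaV_eq stable_Hom_def by (rule section_facts(2)) (use conn_ker in simp)

lemma betaV_conn:
  assumes "h \<in> Hom A (quo A E) (quo A D)" shows
    "betaV A V (quo A E) D (conn h) = stable_class A V h"
  unfolding betaV_eq stable_class_eq[OF assms]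
    by (rule section_facts(1)) (use conn_ker assms in simp_all)

lemma Ext_conn:
  assumes "\<xi> \<in> carrier H"
  obtains h where "h \<in> Hom A (quo A E) (quo A D)" "\<xi> = conn h"
  using assms conn_surj by (auto simp del: mem_Hom)

lemma push_hom: "(\<lambda>f. ext_push A f (ext_class A E)) \<in> hom (Hom_group A (sub A E) (sub A D)) H"
  by (rule homI) (use ext_push_plus[OF classes(2)] ext_push_closed[OF classes(2)] in \<open>auto simp del:
    mem_Hom\<close>)

text \<open>Already the pushout to the intermediate object is trivial, by left orthogonality of
  \<open>quo A E\<close>. This makes \<delta> well defined.\<close>

lemma push_factoring:
  assumes "f \<in> factoring_through A V (sub A E) (sub A D)"
  shows "ext_push A f (ext_class A E) = \<one>\<^bsub>H\<^esub>"
proof -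
  obtain Z u v where Z: "Z \<in> V" and u: "u \<in> Hom A (sub A E) Z" and v: "v \<in> Hom A Z (sub A D)"
      and f: "f = v \<cdot> u"
    using assms unfolding factoring_through_def by blast
  have "ext_push A u (ext_class A E) = \<one>\<^bsub>Ext1 A (quo A E) Z\<^esub>"
    by (rule left_perp_trivial[OF E(3) Z ext_push_closed[OF classes(2) u]])
  then show ?thesis using ext_push_comp[OF classes(2) u v] ext_push_one[OF v obs(2)] f by simp
qed

lemma deltaV_eq: "deltaV A E = (\<lambda>c. the_elem ((\<lambda>f. ext_push A f (ext_class A E)) ` c))"
  by (simp add: deltaV_def connecting_push_def fun_eq_iff)

lemmas induced_facts = Mod_induced_map[OF Hom_comm_group[OF obs(1,3)] subgroup_factoring_through[OF
    V obs(1,3)]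
  push_hom group_Ext push_factoring]

lemma deltaV_hom: "deltaV A E \<in> hom (stable_Hom A V (sub A E) (sub A D)) H"
  unfolding deltaV_eq stable_Hom_def by (rule induced_facts(2))

lemma deltaV_class:
  assumes "f \<in> Hom A (sub A E) (sub A D)" shows
    "deltaV A E (stable_class A V f) = ext_push A f (ext_class A E)"
  unfolding deltaV_eq stable_class_eq[OF assms]
    by (rule induced_facts(1), assumption, use assms in simp)

definition sat where
  "sat = {\<xi> \<in> carrier H. ext_pull A (snd E) \<xi> = \<one>\<^bsub>Ext1 A (mid A E) (sub A D)\<^esub>}"

lemma satelliteV_eq: "satelliteV A E (sub A D) = H\<lparr>carrier := sat\<rparr>"
  using Ea by (simp add: satelliteV_def sat_def kernel_def Let_def)

lemma pull_conn: "h \<in> Hom A (quo A E) (quo A D) \<Longrightarrow> ext_pull A (snd E) (conn h) = conn (h \<cdot> snd E)"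
  by (rule ext_pull_comp[OF classes(1)]) (use Ea in auto)

lemma subgroup_sat: "subgroup sat H"
proof -
  \<comment> \<open>By \<open>pull_conn\<close> and \<open>ext_pull_eq_one\<close>, the class
    \<open>conn h\<close> dies on \<open>mid A E\<close> exactly when \<open>h \<cdot> snd E\<close>
    lifts through \<open>snd D\<close>.\<close>
  let ?K = "{h \<in> Hom A (quo A E) (quo A D). \<exists>u\<in>Hom A (mid A E) (mid A D). snd D \<cdot> u = h \<cdot> snd E}"
  interpret c: group_hom G H conn
    by (intro group_hom.intro group_hom_axioms.intro conn_hom group_Ext comm_group.axioms(2)[OF
      Hom_comm_group[OF obs(2,4)]])
  have *: "conn h \<in> sat \<longleftrightarrow> h \<in> ?K" if h: "h \<in> Hom A (quo A E) (quo A D)" for h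
    using ext_pull_closed[OF classes(1) h] pull_conn[OF h]
      ext_pull_eq_one[OF D(1) refl refl, of "h \<cdot> snd E" "mid A E"] h Ea
    by (simp add: sat_def)
  have im: "conn ` ?K = sat"
  proof (intro equalityI subsetI)
    fix \<xi> assume "\<xi> \<in> sat"
    moreover from this obtain h where "h \<in> Hom A (quo A E) (quo A D)" "\<xi> = conn h" using Ext_conn
        unfolding sat_def by blast
    ultimately show "\<xi> \<in> conn ` ?K" using * by blast
  qed (use * in blast)
  have "subgroup ?K G"
  proof (rule subgroup_Hom_groupI[OF obs(2,4)])
    show "Zero A (quo A E) (quo A D) \<in> ?K" using Ea obs
        by (intro CollectI conjI bexI[of _ "Zero A (mid A E) (mid A D)"]) simp_all
  next
    fix h k assume "h \<in> ?K" "k \<in> ?K"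
    then obtain u v where "u \<in> Hom A (mid A E) (mid A D)" "v \<in> Hom A (mid A E) (mid A D)"
      "snd D \<cdot> u = h \<cdot> snd E" "snd D \<cdot> v = k \<cdot> snd E" "h \<in> Hom A (quo A E) (quo A D)"
        "k \<in> Hom A (quo A E) (quo A D)" by blast
    then show "h \<oplus> k \<in> ?K" using Ea by (intro CollectI conjI bexI[of _ "u \<oplus> v"]) auto
  next
    fix h assume "h \<in> ?K"
    then obtain u where "u \<in> Hom A (mid A E) (mid A D)" "snd D \<cdot> u = h \<cdot> snd E"
        "h \<in> Hom A (quo A E) (quo A D)" by blast
    then show "Neg h \<in> ?K" using Ea by (intro CollectI conjI bexI[of _ "Neg u"]) auto
  qed auto
  from c.subgroup_img_is_subgroup[OF this] show ?thesis unfolding im .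
qed

lemma comm_group_satelliteV: "comm_group (satelliteV A E (sub A D))"
  unfolding satelliteV_eq by (rule comm_group_subgroup[OF comm_group_Ext subgroup_sat])

text \<open>An extension pulled back along its own epimorphism splits, since the identity lifts
  \<open>snd E\<close>. Pushing out along \<open>f\<close> preserves this.\<close>

lemma deltaV_sat:
  assumes "c \<in> carrier (stable_Hom A V (sub A E) (sub A D))" shows "deltaV A E c \<in> sat"
proof -
  obtain f where f: "f \<in> Hom A (sub A E) (sub A D)" "c = stable_class A V f" using assms
      by (auto simp: carrier_stable_Hom simp del: mem_Hom)
  have sE: "snd E \<in> Hom A (mid A E) (quo A E)" using Ea by simp
  have "Id A (mid A E) \<in> Hom A (mid A E) (mid A E)" "snd E \<cdot> Id A (mid A E) = snd E" using Ea
      by auto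
  then have "ext_pull A (snd E) (ext_class A E) = \<one>\<^bsub>Ext1 A (mid A E) (sub A E)\<^esub>"
    using ext_pull_eq_one[OF E(1) refl refl sE] by blast
  then have "ext_pull A (snd E) (ext_push A f (ext_class A E)) = \<one>\<^bsub>Ext1 A (mid A E) (sub A D)\<^esub>"
    using ext_push_pull[OF classes(2) sE f(1)] ext_push_one[OF f(1) obs(5)] by simp
  then show ?thesis using f ext_push_closed[OF classes(2) f(1)] deltaV_class[OF f(1)]
      by (simp add: sat_def)
qed

end

text \<open>The dual piece: \<delta> now pulls back the extension \<open>D\<close> on the side of
  \<open>N\<close>, and \<beta> inverts pushing out the extension \<open>E\<close> on the side of
  \<open>M\<close>. The zigzag leads from stable Hom of the quotients through
  \<open>Ext1 A (quo A E) (sub A D)\<close> to stable Hom of the subobjects.\<close>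

locale W_step = abelian_category A for A :: "('o, 'a) additive_data" +
  fixes W E D
  assumes W: "additive_subcategory A W"
    and E: "is_ext A E" "mid A E \<in> W"
    and D: "is_ext A D" "mid A D \<in> W" "sub A D \<in> right_perp A W"
begin

abbreviation G where "G \<equiv> Hom_group A (sub A E) (sub A D)"
abbreviation H where "H \<equiv> Ext1 A (quo A E) (sub A D)"
abbreviation F where "F \<equiv> factoring_through A W (sub A E) (sub A D)"
abbreviation conn where "conn h \<equiv> ext_push A h (ext_class A E)"

lemma Ea: "fst E \<in> Arr A" "snd E \<in> Arr A" "Dom A (snd E) = mid A E" "fst D \<in> Arr A" "snd D \<in> Arr A"
  "Dom A (snd D) = mid A D"
  using ext_arr[OF E(1)] ext_arr[OF D(1)] by auto

lemma obs: "sub A E \<in> Obj A" "quo A E \<in> Obj A" "sub A D \<in> Obj A" "quo A D \<in> Obj A" "mid A E \<in> Obj A"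
  "mid A D \<in> Obj A"
  using Ea by auto

lemma classes: "ext_class A D \<in> carrier (Ext1 A (quo A D) (sub A D))"
  "ext_class A E \<in> carrier (Ext1 A (quo A E) (sub A E))"
  using ext_class_in_Ext1 E D by auto

text \<open>The obstruction lies in \<open>Ext1 A (mid A E) (sub A D)\<close>, trivial because
  \<open>mid A E\<close> is in \<open>W\<close> and \<open>sub A D\<close> is right orthogonal to
  \<open>W\<close>.\<close>

lemma conn_surj: "conn ` carrier G = carrier H"
proof
  show "conn ` carrier G \<subseteq> carrier H"
    using ext_push_closed[OF classes(2)] by (auto simp del: mem_Hom)
  show "carrier H \<subseteq> conn ` carrier G"
  proof
    fix \<xi> assume \<xi>: "\<xi> \<in> carrier H"
    have "ext_pull A (snd E) \<xi> \<in> carrier (Ext1 A (mid A E) (sub A D))"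
      by (rule ext_pull_closed[OF \<xi>]) (use Ea in simp)
    from right_perp_trivial[OF D(3) E(2) this] ext_push_surj[OF E(1) \<xi>]
    show "\<xi> \<in> conn ` carrier G" by auto
  qed
qed

lemma comm_group_Ext: "comm_group H"
  by (rule comm_group_surj_image[OF Hom_comm_group conn_surj])
    (use obs ext_push_plus[OF classes(2)] ext_push_Zero[OF classes(2)] in auto)

lemma conn_hom: "conn \<in> hom G H"
  by (rule homI) (use ext_push_plus[OF classes(2)] ext_push_closed[OF classes(2)] in \<open>auto simp del:
    mem_Hom\<close>)

lemma group_Ext: "group H"
  by (rule comm_group.axioms(2)[OF comm_group_Ext])

lemma conn_ker:
  assumes "h \<in> Hom A (sub A E) (sub A D)" "conn h = \<one>\<^bsub>H\<^esub>"
  shows "h \<in> F"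
proof -
  obtain u where "u \<in> Hom A (mid A E) (sub A D)" "u \<cdot> fst E = h"
    using ext_push_eq_one[OF E(1) refl refl assms(1)] assms(2) by blast
  moreover have "fst E \<in> Hom A (sub A E) (mid A E)" using Ea by simp
  ultimately show ?thesis unfolding factoring_through_def using E(2) by blast
qed

lemma betaW_eq:
  "betaW A W (sub A D) E = (\<lambda>\<xi>. the_elem ((\<lambda>h. F #>\<^bsub>G\<^esub> h)
      ` {h \<in> carrier G. conn h = \<xi>}))"
proof
  fix \<xi>
  have "stable_class A W ` {h \<in> Hom A (sub A E) (sub A D). conn h = \<xi>} =
      (\<lambda>h. F #>\<^bsub>G\<^esub> h) ` {h \<in> Hom A (sub A E) (sub A D). conn h = \<xi>}"
    by (rule image_cong) (auto simp: stable_class_eq)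
  then show "betaW A W (sub A D) E \<xi> = the_elem ((\<lambda>h. F #>\<^bsub>G\<^esub> h)
      ` {h \<in> carrier G. conn h = \<xi>})"
    by (simp add: betaW_def connecting_push_def)
qed

lemmas section_facts = Mod_section_map[OF Hom_comm_group[OF obs(1,3)] subgroup_factoring_through[OF
    W obs(1,3)]
  conn_hom group_Ext conn_surj]

lemma betaW_hom: "betaW A W (sub A D) E \<in> hom H (stable_Hom A W (sub A E) (sub A D))"
  unfolding betaW_eq stable_Hom_def by (rule section_facts(2)) (use conn_ker in simp)

lemma betaW_conn:
  assumes "h \<in> Hom A (sub A E) (sub A D)" shows
    "betaW A W (sub A D) E (conn h) = stable_class A W h"
  unfolding betaW_eq stable_class_eq[OF assms]
    by (rule section_facts(1)) (use conn_ker assms in simp_all)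

lemma Ext_conn:
  assumes "\<xi> \<in> carrier H"
  obtains h where "h \<in> Hom A (sub A E) (sub A D)" "\<xi> = conn h"
  using assms conn_surj by (auto simp del: mem_Hom)

lemma pull_hom: "(\<lambda>f. ext_pull A f (ext_class A D)) \<in> hom (Hom_group A (quo A E) (quo A D)) H"
  by (rule homI) (use ext_pull_plus[OF classes(1)] ext_pull_closed[OF classes(1)] in \<open>auto simp del:
    mem_Hom\<close>)

text \<open>Already the pullback to the intermediate object is trivial, by right orthogonality of
  \<open>sub A D\<close>.\<close>

lemma pull_factoring:
  assumes "f \<in> factoring_through A W (quo A E) (quo A D)"
  shows "ext_pull A f (ext_class A D) = \<one>\<^bsub>H\<^esub>"
proof -
  obtain Z u v where Z: "Z \<in> W" and u: "u \<in> Hom A (quo A E) Z" and v: "v \<in> Hom A Z (quo A D)"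
      and f: "f = v \<cdot> u"
    using assms unfolding factoring_through_def by blast
  have "ext_pull A v (ext_class A D) = \<one>\<^bsub>Ext1 A Z (sub A D)\<^esub>"
    by (rule right_perp_trivial[OF D(3) Z ext_pull_closed[OF classes(1) v]])
  then show ?thesis using ext_pull_comp[OF classes(1) v u] ext_pull_one[OF u obs(3)] f by simp
qed

lemma deltaW_eq: "deltaW A D = (\<lambda>c. the_elem ((\<lambda>f. ext_pull A f (ext_class A D)) ` c))"
  by (simp add: deltaW_def connecting_pull_def fun_eq_iff)

lemmas induced_facts = Mod_induced_map[OF Hom_comm_group[OF obs(2,4)] subgroup_factoring_through[OF
    W obs(2,4)]
  pull_hom group_Ext pull_factoring]

lemma deltaW_hom: "deltaW A D \<in> hom (stable_Hom A W (quo A E) (quo A D)) H"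
  unfolding deltaW_eq stable_Hom_def by (rule induced_facts(2))

lemma deltaW_class:
  assumes "f \<in> Hom A (quo A E) (quo A D)" shows
    "deltaW A D (stable_class A W f) = ext_pull A f (ext_class A D)"
  unfolding deltaW_eq stable_class_eq[OF assms]
    by (rule induced_facts(1), assumption, use assms in simp)

definition sat where
  "sat = {\<xi> \<in> carrier H. ext_push A (fst D) \<xi> = \<one>\<^bsub>Ext1 A (quo A E) (mid A D)\<^esub>}"

lemma satelliteW_eq: "satelliteW A (quo A E) D = H\<lparr>carrier := sat\<rparr>"
  using Ea by (simp add: satelliteW_def sat_def kernel_def Let_def)

lemma push_conn: "h \<in> Hom A (sub A E) (sub A D) \<Longrightarrow> ext_push A (fst D) (conn h) = conn (fst D \<cdot> h)"
  by (rule ext_push_comp[OF classes(2)]) (use Ea in auto)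

text \<open>As in the \<open>V\<close>-case, \<open>sat\<close> is an image of a subgroup of Hom;
  here \<open>?K\<close> consists of the \<open>h\<close> for which \<open>fst D \<cdot> h\<close>
  extends along \<open>fst E\<close>.\<close>

lemma subgroup_sat: "subgroup sat H"
proof -
  let ?K = "{h \<in> Hom A (sub A E) (sub A D). \<exists>u\<in>Hom A (mid A E) (mid A D). u \<cdot> fst E = fst D \<cdot> h}"
  interpret c: group_hom G H conn
    by (intro group_hom.intro group_hom_axioms.intro conn_hom group_Ext comm_group.axioms(2)[OF
      Hom_comm_group[OF obs(1,3)]])
  have *: "conn h \<in> sat \<longleftrightarrow> h \<in> ?K" if h: "h \<in> Hom A (sub A E) (sub A D)" for h
    using ext_push_closed[OF classes(2) h] push_conn[OF h]
      ext_push_eq_one[OF E(1) refl refl, of "fst D \<cdot> h" "mid A D"] h Ea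
    by (simp add: sat_def)
  have im: "conn ` ?K = sat"
  proof (intro equalityI subsetI)
    fix \<xi> assume "\<xi> \<in> sat"
    moreover from this obtain h where "h \<in> Hom A (sub A E) (sub A D)" "\<xi> = conn h" using Ext_conn
        unfolding sat_def by blast
    ultimately show "\<xi> \<in> conn ` ?K" using * by blast
  qed (use * in blast)
  have "subgroup ?K G"
  proof (rule subgroup_Hom_groupI[OF obs(1,3)])
    show "Zero A (sub A E) (sub A D) \<in> ?K" using Ea obs
        by (intro CollectI conjI bexI[of _ "Zero A (mid A E) (mid A D)"]) simp_all
  next
    fix h k assume "h \<in> ?K" "k \<in> ?K"
    then obtain u v where "u \<in> Hom A (mid A E) (mid A D)" "v \<in> Hom A (mid A E) (mid A D)"
      "u \<cdot> fst E = fst D \<cdot> h" "v \<cdot> fst E = fst D \<cdot> k" "h \<in> Hom A (sub A E) (sub A D)"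
        "k \<in> Hom A (sub A E) (sub A D)" by blast
    then show "h \<oplus> k \<in> ?K" using Ea by (intro CollectI conjI bexI[of _ "u \<oplus> v"]) auto
  next
    fix h assume "h \<in> ?K"
    then obtain u where "u \<in> Hom A (mid A E) (mid A D)" "u \<cdot> fst E = fst D \<cdot> h"
        "h \<in> Hom A (sub A E) (sub A D)" by blast
    then show "Neg h \<in> ?K" using Ea by (intro CollectI conjI bexI[of _ "Neg u"]) auto
  qed auto
  from c.subgroup_img_is_subgroup[OF this] show ?thesis unfolding im .
qed

lemma comm_group_satelliteW: "comm_group (satelliteW A (quo A E) D)"
  unfolding satelliteW_eq by (rule comm_group_subgroup[OF comm_group_Ext subgroup_sat])

text \<open>An extension pushed out along its own monomorphism splits, and pulling back along
  \<open>f\<close> preserves this.\<close>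

lemma deltaW_sat:
  assumes "c \<in> carrier (stable_Hom A W (quo A E) (quo A D))" shows "deltaW A D c \<in> sat"
proof -
  obtain f where f: "f \<in> Hom A (quo A E) (quo A D)" "c = stable_class A W f" using assms
      by (auto simp: carrier_stable_Hom simp del: mem_Hom)
  have fD: "fst D \<in> Hom A (sub A D) (mid A D)" using Ea by simp
  have "Id A (mid A D) \<in> Hom A (mid A D) (mid A D)" "Id A (mid A D) \<cdot> fst D = fst D" using Ea
      by auto
  then have "ext_push A (fst D) (ext_class A D) = \<one>\<^bsub>Ext1 A (quo A D) (mid A D)\<^esub>"
    using ext_push_eq_one[OF D(1) refl refl fD] by blast
  then have "ext_push A (fst D) (ext_pull A f (ext_class A D)) = \<one>\<^bsub>Ext1 A (quo A E) (mid A D)\<^esub>"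
    using ext_push_pull[OF classes(1) f(1) fD] ext_pull_one[OF f(1) obs(6)] by simp
  then show ?thesis using f ext_pull_closed[OF classes(1) f(1)] deltaW_class[OF f(1)]
      by (simp add: sat_def)
qed

end

section \<open>Naturality\<close>

text \<open>For \<delta> the exchange rule of \<open>E'\<close> to \<open>E\<close> trades
  \<open>f\<close> for \<open>f1\<close>; for \<beta> that of \<open>D\<close> to \<open>D'\<close>
  trades \<open>g\<close> for \<open>g1\<close>. For the satellites, the middle component
  \<open>h\<close> turns the pullback along \<open>f1 \<cdot> snd E'\<close> into one along
  \<open>snd E \<cdot> h\<close>, where the class is already trivial.\<close>

lemma V_step_natural:
  assumes "V_step A V E D" "V_step A V E' D'" and m: "ext_mor A E' E f f1" "ext_mor A D D' g g1"
  shows "c \<in> carrier (stable_Hom A V (sub A E) (sub A D)) \<Longrightarrow>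
      stable_act A V f g c \<in> carrier (stable_Hom A V (sub A E') (sub A D')) \<and>
      deltaV A E' (stable_act A V f g c) = ext_act A f1 g (deltaV A E c)" (is "_ \<Longrightarrow> ?p1")
    and "y \<in> carrier (Ext1 A (quo A E) (sub A D)) \<Longrightarrow>
      ext_act A f1 g y \<in> carrier (Ext1 A (quo A E') (sub A D')) \<and>
      betaV A V (quo A E') D' (ext_act A f1 g y) = stable_act A V f1 g1
          (betaV A V (quo A E) D y)" (is "_ \<Longrightarrow> ?p2")
    and "y \<in> V_step.sat A E D \<Longrightarrow> ext_act A f1 g y \<in> V_step.sat A E' D'"
proof -
  interpret s: V_step A V E D by fact
  interpret s': V_step A V E' D' by fact
  have f: "f \<in> Hom A (sub A E') (sub A E)" and f1: "f1 \<in> Hom A (quo A E') (quo A E)"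
    and g: "g \<in> Hom A (sub A D) (sub A D')" and g1: "g1 \<in> Hom A (quo A D) (quo A D')"
    using m by (auto simp: ext_mor_def)
  note [simp del] = mem_Hom
  show ?p1
    if c: "c \<in> carrier (stable_Hom A V (sub A E) (sub A D))"
  proof -
    obtain x where x: "x \<in> Hom A (sub A E) (sub A D)" "c = stable_class A V x" using c
        by (auto simp: s.carrier_stable_Hom)
    have a: "stable_act A V f g c = stable_class A V (Cmp A g (Cmp A x f))"
      using s.stable_act_class[OF s.V x(1) f g] x by simp
    have xf: "Cmp A x f \<in> Hom A (sub A E') (sub A D)" by (rule s.Cmp_closed[OF f x(1)])
    have gxf: "Cmp A g (Cmp A x f) \<in> Hom A (sub A E') (sub A D')" by (rule s.Cmp_closed[OF xf g])
    have "ext_push A (Cmp A g (Cmp A x f)) (ext_class A E') = ext_push A g (ext_push A x (ext_push A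
        f (ext_class A E')))"
      using s.ext_push_comp[OF s'.classes(2) f x(1)] s.ext_push_comp[OF s'.classes(2) xf g] by simp
    also have "\<dots> = ext_push A g (ext_push A x (ext_pull A f1 (ext_class A E)))"
      using s.push_eq_pull[OF s'.E(1) s.E(1) m(1)] by simp
    also have "\<dots> = ext_act A f1 g (ext_push A x (ext_class A E))"
      using s.ext_push_pull[OF s.classes(2) f1 x(1)] by (simp add: ext_act_def)
    finally show ?thesis
      using a x gxf s.deltaV_class[OF x(1)] s'.deltaV_class[OF gxf]
        by (simp add: s.carrier_stable_Hom)
  qed
  have act: "ext_act A f1 g y \<in> carrier (Ext1 A (quo A E') (sub A D'))"
    if "y \<in> carrier (Ext1 A (quo A E) (sub A D))" for y
    using s.ext_push_closed[OF s.ext_pull_closed[OF that f1] g] by (simp add: ext_act_def)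
  show ?p2
    if y: "y \<in> carrier (Ext1 A (quo A E) (sub A D))"
  proof -
    obtain h where h: "h \<in> Hom A (quo A E) (quo A D)" "y = s.conn h" using s.Ext_conn[OF y] .
    have hf: "Cmp A h f1 \<in> Hom A (quo A E') (quo A D)" by (rule s.Cmp_closed[OF f1 h(1)])
    have ghf: "Cmp A g1 (Cmp A h f1) \<in> Hom A (quo A E') (quo A D')" by (rule s.Cmp_closed[OF hf g1])
    have "ext_act A f1 g y = ext_push A g (ext_pull A (Cmp A h f1) (ext_class A D))"
      using s.ext_pull_comp[OF s.classes(1) h(1) f1] h by (simp add: ext_act_def)
    also have "\<dots> = ext_pull A (Cmp A h f1) (ext_push A g (ext_class A D))"
      by (rule s.ext_push_pull[OF s.classes(1) hf g])
    also have "\<dots> = ext_pull A (Cmp A h f1) (ext_pull A g1 (ext_class A D'))"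
      using s.push_eq_pull[OF s.D(1) s'.D(1) m(2)] by simp
    also have "\<dots> = s'.conn (Cmp A g1 (Cmp A h f1))"
        by (rule s.ext_pull_comp[OF s'.classes(1) g1 hf])
    finally show ?thesis
      using act[OF y] s'.betaV_conn[OF ghf] s.betaV_conn[OF h(1)]
        s.stable_act_class[OF s.V h(1) f1 g1] h(2) by simp
  qed
  show "ext_act A f1 g y \<in> s'.sat" if y: "y \<in> s.sat"
  proof -
    have y': "y \<in> carrier (Ext1 A (quo A E) (sub A D))"
        "ext_pull A (snd E) y = \<one>\<^bsub>Ext1 A (mid A E) (sub A D)\<^esub>"
      using y by (auto simp: s.sat_def)
    obtain h where h: "h \<in> Hom A (mid A E') (mid A E)" "Cmp A (snd E) h = Cmp A f1 (snd E')"
      using m(1) unfolding ext_mor_def by blast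
    have sE: "snd E \<in> Hom A (mid A E) (quo A E)" "snd E' \<in> Hom A (mid A E') (quo A E')"
      using s.Ea s'.Ea by (simp_all add: mem_Hom)
    have "ext_pull A (snd E') (ext_act A f1 g y) = ext_push A g (ext_pull A (snd E') (ext_pull A f1
        y))"
      using s.ext_push_pull[OF s.ext_pull_closed[OF y'(1) f1] sE(2) g] by (simp add: ext_act_def)
    also have "\<dots> = ext_push A g (ext_pull A h (ext_pull A (snd E) y))"
      using s.ext_pull_comp[OF y'(1) f1 sE(2)] s.ext_pull_comp[OF y'(1) sE(1) h(1)] h(2) by simp
    also have "\<dots> = \<one>\<^bsub>Ext1 A (mid A E') (sub A D')\<^esub>"
      using y'(2) s.ext_pull_one[OF h(1) s.obs(3)] s.ext_push_one[OF g s'.obs(5)] by simp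
    finally show ?thesis using act[OF y'(1)] by (simp add: s'.sat_def)
  qed
qed

text \<open>The exchange rules change places: \<delta> uses the morphism from \<open>D\<close> to
  \<open>D'\<close> and \<beta> the one from \<open>E'\<close> to \<open>E\<close>. The satellites
  use the middle component of the morphism from \<open>D\<close> to \<open>D'\<close>.\<close>

lemma W_step_natural:
  assumes "W_step A W E D" "W_step A W E' D'" and m: "ext_mor A E' E f1 f" "ext_mor A D D' g1 g"
  shows "c \<in> carrier (stable_Hom A W (quo A E) (quo A D)) \<Longrightarrow>
      stable_act A W f g c \<in> carrier (stable_Hom A W (quo A E') (quo A D')) \<and>
      deltaW A D' (stable_act A W f g c) = ext_act A f g1 (deltaW A D c)" (is "_ \<Longrightarrow> ?p1")
    and "y \<in> carrier (Ext1 A (quo A E) (sub A D)) \<Longrightarrow>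
      ext_act A f g1 y \<in> carrier (Ext1 A (quo A E') (sub A D')) \<and>
      betaW A W (sub A D') E' (ext_act A f g1 y) = stable_act A W f1 g1
          (betaW A W (sub A D) E y)" (is "_ \<Longrightarrow> ?p2")
    and "y \<in> W_step.sat A E D \<Longrightarrow> ext_act A f g1 y \<in> W_step.sat A E' D'"
proof -
  interpret s: W_step A W E D by fact
  interpret s': W_step A W E' D' by fact
  have f1: "f1 \<in> Hom A (sub A E') (sub A E)" and f: "f \<in> Hom A (quo A E') (quo A E)"
    and g1: "g1 \<in> Hom A (sub A D) (sub A D')" and g: "g \<in> Hom A (quo A D) (quo A D')"
    using m by (auto simp: ext_mor_def)
  note [simp del] = mem_Hom
  show ?p1
    if c: "c \<in> carrier (stable_Hom A W (quo A E) (quo A D))"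
  proof -
    obtain x where x: "x \<in> Hom A (quo A E) (quo A D)" "c = stable_class A W x" using c
        by (auto simp: s.carrier_stable_Hom)
    have a: "stable_act A W f g c = stable_class A W (Cmp A g (Cmp A x f))"
      using s.stable_act_class[OF s.W x(1) f g] x by simp
    have xf: "Cmp A x f \<in> Hom A (quo A E') (quo A D)" by (rule s.Cmp_closed[OF f x(1)])
    have gxf: "Cmp A g (Cmp A x f) \<in> Hom A (quo A E') (quo A D')" by (rule s.Cmp_closed[OF xf g])
    have "ext_pull A (Cmp A g (Cmp A x f)) (ext_class A D') = ext_pull A (Cmp A x f) (ext_push A g1
        (ext_class A D))"
      using s.ext_pull_comp[OF s'.classes(1) g xf] s.push_eq_pull[OF s.D(1) s'.D(1) m(2)] by simp
    also have "\<dots> = ext_push A g1 (ext_pull A (Cmp A x f) (ext_class A D))"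
      by (rule s.ext_push_pull[OF s.classes(1) xf g1, symmetric])
    also have "\<dots> = ext_act A f g1 (ext_pull A x (ext_class A D))"
      using s.ext_pull_comp[OF s.classes(1) x(1) f] by (simp add: ext_act_def)
    finally show ?thesis
      using a x gxf s.deltaW_class[OF x(1)] s'.deltaW_class[OF gxf]
        by (simp add: s.carrier_stable_Hom)
  qed
  have act: "ext_act A f g1 y \<in> carrier (Ext1 A (quo A E') (sub A D'))"
    if "y \<in> carrier (Ext1 A (quo A E) (sub A D))" for y
    using s.ext_push_closed[OF s.ext_pull_closed[OF that f] g1] by (simp add: ext_act_def)
  show ?p2
    if y: "y \<in> carrier (Ext1 A (quo A E) (sub A D))"
  proof -
    obtain h where h: "h \<in> Hom A (sub A E) (sub A D)" "y = s.conn h" using s.Ext_conn[OF y] .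
    have hf: "Cmp A h f1 \<in> Hom A (sub A E') (sub A D)" by (rule s.Cmp_closed[OF f1 h(1)])
    have ghf: "Cmp A g1 (Cmp A h f1) \<in> Hom A (sub A E') (sub A D')" by (rule s.Cmp_closed[OF hf g1])
    have "ext_act A f g1 y = ext_push A g1 (ext_push A h (ext_pull A f (ext_class A E)))"
      using s.ext_push_pull[OF s.classes(2) f h(1)] h by (simp add: ext_act_def)
    also have "\<dots> = ext_push A g1 (ext_push A h (ext_push A f1 (ext_class A E')))"
      using s.push_eq_pull[OF s'.E(1) s.E(1) m(1)] by simp
    also have "\<dots> = s'.conn (Cmp A g1 (Cmp A h f1))"
      using s.ext_push_comp[OF s'.classes(2) f1 h(1)] s.ext_push_comp[OF s'.classes(2) hf g1]
        by simp
    finally show ?thesis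
      using act[OF y] s'.betaW_conn[OF ghf] s.betaW_conn[OF h(1)]
        s.stable_act_class[OF s.W h(1) f1 g1] h(2) by simp
  qed
  show "ext_act A f g1 y \<in> s'.sat" if y: "y \<in> s.sat"
  proof -
    have y': "y \<in> carrier (Ext1 A (quo A E) (sub A D))"
        "ext_push A (fst D) y = \<one>\<^bsub>Ext1 A (quo A E) (mid A D)\<^esub>"
      using y by (auto simp: s.sat_def)
    obtain h where h: "h \<in> Hom A (mid A D) (mid A D')" "Cmp A h (fst D) = Cmp A (fst D') g1"
      using m(2) unfolding ext_mor_def by blast
    have fD: "fst D \<in> Hom A (sub A D) (mid A D)" "fst D' \<in> Hom A (sub A D') (mid A D')"
      using s.Ea s'.Ea by (simp_all add: mem_Hom)
    have "ext_push A (fst D') (ext_act A f g1 y) = ext_push A (fst D') (ext_pull A f (ext_push A g1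
        y))"
      using s.ext_push_pull[OF y'(1) f g1] by (simp add: ext_act_def)
    also have "\<dots> = ext_pull A f (ext_push A (fst D') (ext_push A g1 y))"
      by (rule s.ext_push_pull[OF s.ext_push_closed[OF y'(1) g1] f fD(2)])
    also have "\<dots> = ext_pull A f (ext_push A h (ext_push A (fst D) y))"
      using s.ext_push_comp[OF y'(1) g1 fD(2)] s.ext_push_comp[OF y'(1) fD(1) h(1)] h(2) by simp
    also have "\<dots> = \<one>\<^bsub>Ext1 A (quo A E') (mid A D')\<^esub>"
      using y'(2) s.ext_push_one[OF h(1) s.obs(2)] s.ext_pull_one[OF f s'.obs(6)] by simp
    finally show ?thesis using act[OF y'(1)] by (simp add: s'.sat_def)
  qed
qed

section \<open>Syzygies of resolutions\<close>

context abelian_category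
begin

text \<open>The same two arrows serve with their roles exchanged: \<open>c\<close> is epic, hence
  the cokernel of its kernel \<open>k\<close>.\<close>

lemma exact_at_opp: "exact_at A f g \<Longrightarrow> exact_at (opp A) g f"
  unfolding exact_at_def using epic_cokernel cokernel_epic by (metis is_cokernel_opp is_kernel_opp)

text \<open>\<open>p\<close> is \<open>d\<close> with its codomain cut down to the image. The second
  claim is stated for every such \<open>p\<close>, so that it applies to the arrows defined by
  \<open>THE\<close> in \<open>cpr\<close> and, dually, \<open>rinc\<close>. Its substance is that
  \<open>p\<close> is epic.\<close>

lemma exact_kernel_factor:
  assumes ex: "exact_at A d e" and m: "is_kernel A m e" and j: "is_kernel A j d"
  shows "\<exists>!p. p \<in> Hom A (Dom A d) (Dom A m) \<and> m \<cdot> p = d"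
    and "p \<in> Hom A (Dom A d) (Dom A m) \<Longrightarrow> m \<cdot> p = d \<Longrightarrow> short_exact A j p"
proof -
  obtain k c where c: "is_cokernel A c d" and k: "is_kernel A k c" "is_kernel A k e"
    using ex unfolding exact_at_def by blast
  note ca = cokernel_arr[OF c] and ka = kernel_arr[OF k(1)] and ke = kernel_arr[OF k(2)]
    and ma = kernel_arr[OF m] and ja = kernel_arr[OF j]
  obtain q where q: "q \<in> Arr A" "Dom A q = Dom A d" "Cod A q = Dom A k" "k \<cdot> q = d"
    using kernelE[OF k(1), of d] ca by auto
  have "e \<cdot> d = Zero A (Dom A k) (Cod A e) \<cdot> q"
    using Cmp_eq_extend[OF ke(4), of q] q ke by simp
  also have "\<dots> = Zero A (Dom A d) (Cod A e)" using q ke by simp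
  finally have ed: "e \<cdot> d = Zero A (Dom A d) (Cod A e)" .
  have dk: "Cod A d = Dom A e" using ca ka ke by simp
  obtain p where p: "p \<in> Arr A" "Dom A p = Dom A d" "Cod A p = Dom A m" "m \<cdot> p = d"
    using kernelE[OF m, of d] ed ca dk by auto
  show "\<exists>!p. p \<in> Hom A (Dom A d) (Dom A m) \<and> m \<cdot> p = d"
  proof (rule ex1I[of _ p])
    show "p \<in> Hom A (Dom A d) (Dom A m) \<and> m \<cdot> p = d" using p by simp
    fix p' assume p': "p' \<in> Hom A (Dom A d) (Dom A m) \<and> m \<cdot> p' = d"
    show "p' = p" by (rule monicD[OF kernel_monic[OF m]]) (use p p' in auto)
  qed
  show "short_exact A j p" if "p \<in> Hom A (Dom A d) (Dom A m)" "m \<cdot> p = d" for p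
  proof -
    have p: "p \<in> Arr A" "Dom A p = Dom A d" "Cod A p = Dom A m" "m \<cdot> p = d" using that by auto
    have "is_kernel A j p"
    proof (rule kernelI)
      have "m \<cdot> (p \<cdot> j) = d \<cdot> j" by (rule Cmp_eq_extend[OF p(4)]) (use p(1-3) ma ja in simp_all)
      also have "\<dots> = m \<cdot> Zero A (Dom A j) (Dom A m)" using ja ma dk by simp
      finally show "p \<cdot> j = Zero A (Dom A j) (Cod A p)"
        unfolding p(3) by (rule monicD[OF kernel_monic[OF m]]) (use p(1-3) ma ja in simp_all)
      fix g assume g: "g \<in> Arr A" "Cod A g = Dom A p" "p \<cdot> g = Zero A (Dom A g) (Cod A p)"
      have "d \<cdot> g = m \<cdot> (p \<cdot> g)" using Cmp_eq_extend[OF p(4), of g] p(1-3) g(1,2) ma by simp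
      also have "\<dots> = Zero A (Dom A g) (Cod A d)" unfolding g(3) using p(1-3) g(1,2) ma dk by simp
      finally show "\<exists>u. u \<in> Hom A (Dom A g) (Dom A j) \<and> j \<cdot> u = g"
        using kernelE[OF j, of g] g p by auto
    qed (use p ja kernel_monic[OF j] in simp_all)
    moreover have "epic A p"
    proof (rule epicI)
      fix u assume u: "u \<in> Arr A" "Dom A u = Cod A p" "u \<cdot> p = Zero A (Dom A p) (Cod A u)"
      \<comment> \<open>It suffices that the kernel \<kappa> of \<open>u\<close> has a right
        inverse. \<open>d\<close> factors through \<open>m \<cdot> \<kappa>\<close>, a monic and
        hence the kernel of some \<open>t\<close>. So \<open>t\<close> kills \<open>d\<close> and
        factors through \<open>c\<close>; as \<open>c\<close> kills \<open>m\<close>, so does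
        \<open>t\<close>, and \<open>m\<close> itself factors through
        \<open>m \<cdot> \<kappa>\<close>.\<close>
      obtain \<kappa> where \<kappa>: "is_kernel A \<kappa> u" using kernels u by blast
      note \<kappa>a = kernel_arr[OF \<kappa>]
      obtain p' where p': "p' \<in> Arr A" "Dom A p' = Dom A d" "Cod A p' = Dom A \<kappa>" "\<kappa> \<cdot> p' = p"
        using kernelE[OF \<kappa>, of p] u p by auto
      have m\<kappa>: "m \<cdot> \<kappa> \<in> Arr A" "Dom A (m \<cdot> \<kappa>) = Dom A \<kappa>" "Cod A (m \<cdot> \<kappa>) = Cod A m" using ma \<kappa>a u p
          by simp_all
      have "monic A (m \<cdot> \<kappa>)"
      proof (rule monicI)
        fix z assume z: "z \<in> Arr A" "Cod A z = Dom A (m \<cdot> \<kappa>)"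
            "(m \<cdot> \<kappa>) \<cdot> z = Zero A (Dom A z) (Cod A (m \<cdot> \<kappa>))"
        have "m \<cdot> (\<kappa> \<cdot> z) = (m \<cdot> \<kappa>) \<cdot> z" using z(1,2) ma \<kappa>a u p by simp
        also have "\<dots> = m \<cdot> Zero A (Dom A z) (Dom A m)" unfolding z(3) using z(1,2) ma m\<kappa> by simp
        finally have "\<kappa> \<cdot> z = Zero A (Dom A z) (Dom A m)"
          by (rule monicD[OF kernel_monic[OF m]]) (use z(1,2) ma \<kappa>a u p m\<kappa> in simp_all)
        then have "\<kappa> \<cdot> z = \<kappa> \<cdot> Zero A (Dom A z) (Dom A \<kappa>)" using z(1,2) ma \<kappa>a u p m\<kappa> by simp
        then show "z = Zero A (Dom A z) (Dom A (m \<cdot> \<kappa>))"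
          unfolding m\<kappa>(2) by (rule monicD[OF kernel_monic[OF \<kappa>]]) (use z(1,2) m\<kappa> \<kappa>a in simp_all)
      qed (rule m\<kappa>)
      then obtain t where t: "is_kernel A (m \<cdot> \<kappa>) t" using monic_normal by blast
      note ta = kernel_arr[OF t]
      have "d = (m \<cdot> \<kappa>) \<cdot> p'" using p'(1-3) ma(1,3) \<kappa>a(1,3) u(1,2) p(1,3) by (simp add: p'(4) p(4))
      then have "t \<cdot> d = (t \<cdot> (m \<cdot> \<kappa>)) \<cdot> p'" using ta(1-3) m\<kappa> p'(1-3) by (metis Cmp_assoc')
      also have "\<dots> = Zero A (Dom A d) (Cod A t)" unfolding ta(4) using ta(1-3) m\<kappa> p'(1-3) by simp
      finally obtain w where w: "w \<in> Arr A" "Dom A w = Cod A c" "Cod A w = Cod A t" "w \<cdot> c = t"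
        using cokernelE[OF c, of t] ta m\<kappa> ma dk by auto
      obtain s where s: "s \<in> Arr A" "Dom A s = Dom A m" "Cod A s = Dom A k" "k \<cdot> s = m"
        using kernelE[OF k(2), of m] ma by auto
      have "c \<cdot> m = Zero A (Dom A k) (Cod A c) \<cdot> s"
        using Cmp_eq_extend[OF ka(4), of s] s ka by simp
      then have cm: "c \<cdot> m = Zero A (Dom A m) (Cod A c)" using s(1-3) ka by simp
      have "t \<cdot> m = w \<cdot> (c \<cdot> m)" unfolding w(4)[symmetric] using w(1-3) ma ca ka ke by simp
      also have "\<dots> = Zero A (Dom A m) (Cod A t)" unfolding cm using w(1-3) ma by simp
      finally obtain v where v: "v \<in> Arr A" "Dom A v = Dom A m" "Cod A v = Dom A \<kappa>"
          "(m \<cdot> \<kappa>) \<cdot> v = m"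
        using kernelE[OF t, of m] ma m\<kappa> ta by auto
      have "m \<cdot> (\<kappa> \<cdot> v) = (m \<cdot> \<kappa>) \<cdot> v" using v(1-3) ma \<kappa>a u(1,2) p(1-3) by simp
      also have "\<dots> = m \<cdot> Id A (Dom A m)" unfolding v(4) using ma by simp
      finally have \<kappa>v: "\<kappa> \<cdot> v = Id A (Dom A m)"
        by (rule monicD[OF kernel_monic[OF m]]) (use v(1-3) ma \<kappa>a u(1,2) p(1-3) in simp_all)
      have "u = u \<cdot> (\<kappa> \<cdot> v)" unfolding \<kappa>v using u(1,2) p(3) by simp
      also have "\<dots> = (u \<cdot> \<kappa>) \<cdot> v" using v(1-3) \<kappa>a(1-3) u(1,2) by simp
      also have "\<dots> = Zero A (Cod A p) (Cod A u)" unfolding \<kappa>a(4) using v(1-3) \<kappa>a(1-3) u(1,2) p(3)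
          by simp
      finally show "u = Zero A (Cod A p) (Cod A u)" .
    qed (rule p)
    ultimately show ?thesis using epic_cokernel by (simp add: short_exact_def)
  qed
qed

lemma cses_ext:
  assumes R: "special_proper_coresolution A V M R"
  shows "is_ext A (cses A R i)" "sub A (cses A R i) = csyz R i"
    "quo A (cses A R i) = csyz R (Suc i)"
    "mid A (cses A R i) = cobj R i" "mid A (cses A R i) \<in> V" "csyz R (Suc i) \<in> left_perp A V"
proof -
  have r: "cobj R i \<in> V" "cdiff R i \<in> Hom A (cobj R i) (cobj R (Suc i))"
      "exact_at A (cdiff R i) (cdiff R (Suc i))"
    "\<And>i. cinc R i \<in> Hom A (csyz R i) (cobj R i)" "\<And>i. is_kernel A (cinc R i) (cdiff R i)"
      "csyz R (Suc i) \<in> left_perp A V"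
    using R unfolding special_proper_coresolution_def by auto
  note f = exact_kernel_factor[OF r(3) r(5) r(5)]
  have e: "Dom A (cdiff R i) = cobj R i" "Dom A (cinc R (Suc i)) = csyz R (Suc i)"
      using r(2) r(4)[of "Suc i"] by auto
  have p: "cpr A R i \<in> Hom A (cobj R i) (csyz R (Suc i)) \<and> cinc R (Suc i) \<cdot> cpr A R i = cdiff R i"
    unfolding cpr_def by (rule theI'[OF f(1)[unfolded e]])
  then have "short_exact A (cinc R i) (cpr A R i)" using f(2) e by auto
  then show "is_ext A (cses A R i)" "sub A (cses A R i) = csyz R i"
      "quo A (cses A R i) = csyz R (Suc i)"
    "mid A (cses A R i) = cobj R i" "mid A (cses A R i) \<in> V" "csyz R (Suc i) \<in> left_perp A V"
    using p r(4)[of i] r(1,6) by (auto simp: cses_def)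
qed

text \<open>The kernel factorisation is applied in \<open>opp A\<close>, where the chosen cokernels
  \<open>rpr\<close> are kernels of the differentials.\<close>

lemma rses_ext:
  assumes Q: "special_proper_resolution A W M Q"
  shows "is_ext A (rses A Q i)" "sub A (rses A Q i) = rsyz Q (Suc i)"
    "quo A (rses A Q i) = rsyz Q i"
    "mid A (rses A Q i) = robj Q i" "mid A (rses A Q i) \<in> W" "rsyz Q (Suc i) \<in> right_perp A W"
proof -
  have r: "robj Q i \<in> W" "rdiff Q i \<in> Hom A (robj Q (Suc i)) (robj Q i)"
      "exact_at A (rdiff Q (Suc i)) (rdiff Q i)"
    "\<And>i. rpr Q i \<in> Hom A (robj Q i) (rsyz Q i)" "\<And>i. is_cokernel A (rpr Q i) (rdiff Q i)"
      "rsyz Q (Suc i) \<in> right_perp A W"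
    using Q unfolding special_proper_resolution_def by auto
  interpret op: abelian_category "opp A" by (rule abelian_opp)
  have c: "is_kernel (opp A) (rpr Q i) (rdiff Q i)" for i using r(5) by simp
  note f = op.exact_kernel_factor[OF exact_at_opp[OF r(3)] c c]
  have e: "Cod A (rdiff Q i) = robj Q i" "Cod A (rpr Q (Suc i)) = rsyz Q (Suc i)"
      using r(2) r(4)[of "Suc i"] by auto
  have "\<exists>!k. k \<in> Hom A (rsyz Q (Suc i)) (robj Q i) \<and> k \<cdot> rpr Q (Suc i) = rdiff Q i"
    using f(1) unfolding opp_simps Hom_opp e .
  then have p: "rinc A Q i \<in> Hom A (rsyz Q (Suc i)) (robj Q i) \<and> rinc A Q i \<cdot> rpr Q (Suc i) =
      rdiff Q i"
    unfolding rinc_def by (rule theI')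
  then have "short_exact A (rinc A Q i) (rpr Q i)" using f(2)[of "rinc A Q i"] e by auto
  then show "is_ext A (rses A Q i)" "sub A (rses A Q i) = rsyz Q (Suc i)"
      "quo A (rses A Q i) = rsyz Q i"
    "mid A (rses A Q i) = robj Q i" "mid A (rses A Q i) \<in> W" "rsyz Q (Suc i) \<in> right_perp A W"
    using p r(4)[of i] r(1,6) by (auto simp: rses_def)
qed

lemma liftV_ext_mor:
  assumes R: "special_proper_coresolution A V M' R'" "special_proper_coresolution A V M R"
    and F: "liftV A R' R f F"
  shows "ext_mor A (cses A R' i) (cses A R i) (F i) (F (Suc i))"
proof -
  obtain u where u: "u \<in> Hom A (cobj R' i) (cobj R i)" "u \<cdot> cinc R' i = cinc R i \<cdot> F i"
    "F (Suc i) \<cdot> cpr A R' i = cpr A R i \<cdot> u" and "F i \<in> Hom A (csyz R' i) (csyz R i)"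
    "F (Suc i) \<in> Hom A (csyz R' (Suc i)) (csyz R (Suc i))"
    using F unfolding liftV_def by blast
  then show ?thesis
    using cses_ext(2-4)[OF R(1), of i] cses_ext(2-4)[OF R(2), of i]
    by (intro ext_morI[of u]) (simp_all add: cses_def)
qed

lemma liftW_ext_mor:
  assumes Q: "special_proper_resolution A W M' Q'" "special_proper_resolution A W M Q"
    and F: "liftW A Q' Q f F"
  shows "ext_mor A (rses A Q' i) (rses A Q i) (F (Suc i)) (F i)"
proof -
  obtain u where u: "u \<in> Hom A (robj Q' i) (robj Q i)" "F i \<cdot> rpr Q' i = rpr Q i \<cdot> u"
    "u \<cdot> rinc A Q' i = rinc A Q i \<cdot> F (Suc i)" and "F i \<in> Hom A (rsyz Q' i) (rsyz Q i)"
    "F (Suc i) \<in> Hom A (rsyz Q' (Suc i)) (rsyz Q (Suc i))"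
    using F unfolding liftW_def by blast
  then show ?thesis
    using rses_ext(2-4)[OF Q(1), of i] rses_ext(2-4)[OF Q(2), of i]
    by (intro ext_morI[of u]) (simp_all add: rses_def)
qed

end

section \<open>The direct systems\<close>

text \<open>From the starting stage on, \<open>int i + n\<close> is nonnegative, so the truncation
  in \<open>nat\<close> does not interfere.\<close>

lemma shift_Suc: "nat (- n) \<le> i \<Longrightarrow> shift n (Suc i) = Suc (shift n i)"
  by (simp add: shift_def)

context abelian_category
begin

lemma V_step_cses:
  assumes "additive_subcategory A V" "special_proper_coresolution A V M R"
    "special_proper_coresolution A V N S"
  shows "V_step A V (cses A R i) (cses A S j)"
  by unfold_locales (use assms(1) cses_ext[OF assms(2), of i] cses_ext[OF assms(3), of j] in
    simp_all)

lemma W_step_rses: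
  assumes "additive_subcategory A W" "special_proper_resolution A W M P"
    "special_proper_resolution A W N Q"
  shows "W_step A W (rses A P i) (rses A Q j)"
  by unfold_locales (use assms(1) rses_ext[OF assms(2), of i] rses_ext[OF assms(3), of j] in
    simp_all)

text \<open>Two interleavings: stable Hom with \<open>Ext1\<close> by \<delta> and \<beta>, and the
  satellites with \<open>Ext1\<close> by inclusion and the transition map. The single steps glue
  because \<open>Suc\<close> commutes with \<open>shift\<close>, so that the quotient ends of stage
  \<open>i\<close> are the subobject ends of stage \<open>Suc i\<close>.\<close>

lemma natural_isos_V:
  assumes V: "additive_subcategory A V"
    and R: "\<And>M. M \<in> Obj A \<Longrightarrow> special_proper_coresolution A V M (R M)"
  shows "\<exists>\<phi> \<psi>.
      natural_iso A (\<lambda>M' M. liftV A (R M') (R M)) (Ext_check A V R n) (Ext_check_map A V R n)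
        (colim_extV A V R n) (colim_extV_map A V R n) \<phi> \<and>
      natural_iso A (\<lambda>M' M. liftV A (R M') (R M)) (colim_extV A V R n) (colim_extV_map A V R n)
        (colim_satV A V R n) (colim_satV_map A V R n) \<psi>"
proof -
  let ?i0 = "nat (- n)"
  let ?E = "\<lambda>M i. cses A (R M) i" and ?D = "\<lambda>N i. cses A (R N) (shift n i)"
  let ?d = "\<lambda>M N i. deltaV A (?E M i)" and ?b = "\<lambda>M N i. betaV A V (csyz (R M) (Suc i)) (?D N i)"
  let ?act = "\<lambda>F F' i. stable_act A V (F i) (F' (shift n i))"
  let ?act' = "\<lambda>F F' i. ext_act A (F (Suc i)) (F' (shift n i))"
  have step: "V_step A V (?E M i) (?D N i)" if "M \<in> Obj A" "N \<in> Obj A" for M N i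
    using V_step_cses[OF V R[OF that(1)] R[OF that(2)]] .
  have ends: "sub A (?E M i) = csyz (R M) i" "quo A (?E M i) = csyz (R M) (Suc i)"
    "sub A (?D M i) = csyz (R M) (shift n i)"
      "?i0 \<le> i \<Longrightarrow> quo A (?D M i) = csyz (R M) (shift n (Suc i))"
    if "M \<in> Obj A" for M i
    using cses_ext(2,3)[OF R[OF that]] by (simp_all add: shift_Suc)
  have groups: "comm_group (homV_sys A V (R M) (R N) n i)" (is ?g1)
    "comm_group (extV_sys A (R M) (R N) n i)" (is ?g2)
    "comm_group (satV_sys A (R M) (R N) n i)" (is ?g3)
    "?d M N i \<in> hom (homV_sys A V (R M) (R N) n i) (extV_sys A (R M) (R N) n i)" (is ?g4)
    "?b M N i \<in> hom (extV_sys A (R M) (R N) n i) (homV_sys A V (R M) (R N) n (Suc i))" (is ?g5)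
    "satV_sys A (R M) (R N) n i = (extV_sys A (R M) (R N) n i)\<lparr>carrier := V_step.sat A (?E M i) (?D
      N i)\<rparr>" (is ?g6)
    "V_step.sat A (?E M i) (?D N i) \<subseteq> carrier (extV_sys A (R M) (R N) n i)" (is ?g7)
    "\<And>c. c \<in> carrier (homV_sys A V (R M) (R N) n i) \<Longrightarrow> ?d M N i c \<in> V_step.sat A (?E M i) (?D N i)"
      (is "\<And>c. ?p c \<Longrightarrow> ?q c")
    if M: "M \<in> Obj A" and N: "N \<in> Obj A" and i: "?i0 \<le> i" for M N i
  proof -
    interpret s: V_step A V "?E M i" "?D N i" by (rule step[OF M N])
    note e = ends[OF M, of i] ends[OF N, of i]
    show ?g1 ?g2 ?g3 ?g4 ?g5 ?g6 ?g7 "\<And>c. ?p c \<Longrightarrow> ?q c"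
      using comm_group_stable_Hom[OF V s.obs(1,3)] s.comm_group_Ext s.comm_group_satelliteV
        s.deltaV_hom
        s.betaV_hom s.satelliteV_eq s.subgroup_sat[THEN subgroup.subset] s.deltaV_sat i
      by (simp_all add: homV_sys_def extV_sys_def satV_sys_def e)
  qed
  have ext: "interleaved ?i0 (homV_sys A V (R M) (R N) n) (extV_sys A (R M) (R N) n) (?d M N) (?b M
      N)"
    if "M \<in> Obj A" "N \<in> Obj A" for M N
    by (rule interleavedI) (use groups[OF that] in simp_all)
  \<comment> \<open>The map back is the transition map of \<open>Ext1\<close>; its values lie in the
    satellite of the next stage because it ends with \<delta>. Both two-step composites are then
    that transition map again.\<close>
  have sat: "interleaved ?i0 (satV_sys A (R M) (R N) n) (extV_sys A (R M) (R N) n) (\<lambda>i \<xi>. \<xi>) (\<lambda>i. ?d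
      M N (Suc i) \<circ> ?b M N i)"
    if ob: "M \<in> Obj A" "N \<in> Obj A" for M N
  proof (rule interleavedI)
    fix i assume i: "?i0 \<le> i"
    note g = groups[OF ob i] and g' = groups[OF ob le_SucI[OF i]]
    show "(\<lambda>\<xi>. \<xi>) \<in> hom (satV_sys A (R M) (R N) n i) (extV_sys A (R M) (R N) n i)"
      using g(7) by (auto simp: g(6) hom_def)
    have "?d M N (Suc i) \<circ> ?b M N i \<in> hom (extV_sys A (R M) (R N) n i) (extV_sys A (R M) (R N) n
        (Suc i))"
      using g(5) g'(4) by (rule hom_compose)
    then show "?d M N (Suc i) \<circ> ?b M N i \<in> hom (extV_sys A (R M) (R N) n i) (satV_sys A (R M) (R N)
        n (Suc i))"
      using g'(8) g(5) by (auto simp: g'(6) hom_def Pi_iff)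
  qed (use groups[OF ob] in simp_all)
  have nat: "(c \<in> carrier (homV_sys A V (R M) (R N) n i) \<longrightarrow>
        ?act F F' i c \<in> carrier (homV_sys A V (R M') (R N') n i) \<and> ?d M' N' i (?act F F' i c) =
            ?act' F F' i (?d M N i c)) \<and>
      (y \<in> carrier (extV_sys A (R M) (R N) n i) \<longrightarrow>
        ?act' F F' i y \<in> carrier (extV_sys A (R M') (R N') n i) \<and> ?b M' N' i (?act' F F' i y) = ?act
            F F' (Suc i) (?b M N i y)) \<and>
      (y \<in> carrier (satV_sys A (R M) (R N) n i) \<longrightarrow> ?act' F F' i y \<in> carrier (satV_sys A (R M') (R N')
          n i))"
    if ob: "M \<in> Obj A" "N \<in> Obj A" "M' \<in> Obj A" "N' \<in> Obj A"
      and l: "liftV A (R M') (R M) f F" "liftV A (R N) (R N') g F'" and i: "?i0 \<le> i"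
        for M N M' N' f g F F' i c y
  proof -
    have "ext_mor A (?D N i) (?D N' i) (F' (shift n i)) (F' (shift n (Suc i)))"
      using liftV_ext_mor[OF R[OF ob(2)] R[OF ob(4)] l(2), of "shift n i"] i
        by (simp add: shift_Suc)
    note k = V_step_natural[OF step[OF ob(1,2)] step[OF ob(3,4)] liftV_ext_mor[OF R[OF ob(3)] R[OF
        ob(1)] l(1)] this]
    note g = groups(6)[OF ob(1,2) i] groups(6)[OF ob(3,4) i]
    note e = ends[OF ob(1), of i] ends[OF ob(2), of i] ends[OF ob(3), of i] ends[OF ob(4), of i]
    show ?thesis
      using k(1)[of c] k(2)[of y] k(3)[of y] i unfolding g
        by (simp add: homV_sys_def extV_sys_def e)
  qed
  note iso1 = natural_iso_interleaved(1)[OF ext, where A = A and lift = "\<lambda>M' M. liftV A (R M') (R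
      M)" and act = ?act and act' = ?act']
  \<comment> \<open>The inverse version is taken: the interleaving starts from the satellites, the
    desired isomorphism from \<open>Ext1\<close>. Both systems carry the same action, the satellites
    being subsets.\<close>
  note iso2 = natural_iso_interleaved(2)[OF sat, where A = A and lift = "\<lambda>M' M. liftV A (R M') (R
      M)" and act = ?act' and act' = ?act']
  have "\<exists>\<phi>. natural_iso A (\<lambda>M' M. liftV A (R M') (R M)) (Ext_check A V R n) (Ext_check_map A V R n)
        (colim_extV A V R n) (colim_extV_map A V R n) \<phi>"
    unfolding Ext_check_def[abs_def] Ext_check_map_def[abs_def] colim_extV_def[abs_def]
      colim_extV_map_def[abs_def]
      homV_trans_def[abs_def] extV_trans_def[abs_def]
    by (rule exI, rule iso1) (use nat in \<open>blast+\<close>)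
  moreover have
      "\<exists>\<psi>. natural_iso A (\<lambda>M' M. liftV A (R M') (R M)) (colim_extV A V R n) (colim_extV_map A V R n)
        (colim_satV A V R n) (colim_satV_map A V R n) \<psi>"
    unfolding colim_satV_def[abs_def] colim_satV_map_def[abs_def] colim_extV_def[abs_def]
      colim_extV_map_def[abs_def]
      extV_trans_def[abs_def] comp_def
    \<comment> \<open>Unfolding the composition removes the inclusion, written as an identity
      function, from both transition maps, so that they match the \<open>Ext1\<close>
      transition.\<close>
    by (rule exI, rule iso2[unfolded comp_def]) (use nat groups(5) in \<open>auto simp: hom_def Pi_iff\<close>)
  ultimately show ?thesis by blast
qed

text \<open>The same two interleavings with \<open>shift\<close> now on the side of
  \<open>M\<close>: there the subobject of stage \<open>i\<close> is the quotient of stage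
  \<open>Suc i\<close>.\<close>

lemma natural_isos_W:
  assumes W: "additive_subcategory A W"
    and Q: "\<And>M. M \<in> Obj A \<Longrightarrow> special_proper_resolution A W M (Q M)"
  shows "\<exists>\<phi> \<psi>.
      natural_iso A (\<lambda>M' M. liftW A (Q M') (Q M)) (Ext_hat A W Q n) (Ext_hat_map A W Q n)
        (colim_extW A W Q n) (colim_extW_map A W Q n) \<phi> \<and>
      natural_iso A (\<lambda>M' M. liftW A (Q M') (Q M)) (colim_extW A W Q n) (colim_extW_map A W Q n)
        (colim_satW A W Q n) (colim_satW_map A W Q n) \<psi>"
proof -
  let ?i0 = "nat (- n)"
  let ?E = "\<lambda>M i. rses A (Q M) (shift n i)" and ?D = "\<lambda>N i. rses A (Q N) i"
  let ?d = "\<lambda>M N i. deltaW A (?D N i)" and ?b = "\<lambda>M N i. betaW A W (rsyz (Q N) (Suc i)) (?E M i)"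
  let ?act = "\<lambda>F F' i. stable_act A W (F (shift n i)) (F' i)"
  let ?act' = "\<lambda>F F' i. ext_act A (F (shift n i)) (F' (Suc i))"
  have step: "W_step A W (?E M i) (?D N i)" if "M \<in> Obj A" "N \<in> Obj A" for M N i
    using W_step_rses[OF W Q[OF that(1)] Q[OF that(2)]] .
  have ends: "quo A (?E M i) = rsyz (Q M) (shift n i)"
      "?i0 \<le> i \<Longrightarrow> sub A (?E M i) = rsyz (Q M) (shift n (Suc i))"
    "quo A (?D M i) = rsyz (Q M) i" "sub A (?D M i) = rsyz (Q M) (Suc i)"
    if "M \<in> Obj A" for M i
    using rses_ext(2,3)[OF Q[OF that]] by (simp_all add: shift_Suc)
  have groups: "comm_group (homW_sys A W (Q M) (Q N) n i)" (is ?g1)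
    "comm_group (extW_sys A (Q M) (Q N) n i)" (is ?g2)
    "comm_group (satW_sys A (Q M) (Q N) n i)" (is ?g3)
    "?d M N i \<in> hom (homW_sys A W (Q M) (Q N) n i) (extW_sys A (Q M) (Q N) n i)" (is ?g4)
    "?b M N i \<in> hom (extW_sys A (Q M) (Q N) n i) (homW_sys A W (Q M) (Q N) n (Suc i))" (is ?g5)
    "satW_sys A (Q M) (Q N) n i = (extW_sys A (Q M) (Q N) n i)\<lparr>carrier := W_step.sat A (?E M i) (?D
      N i)\<rparr>" (is ?g6)
    "W_step.sat A (?E M i) (?D N i) \<subseteq> carrier (extW_sys A (Q M) (Q N) n i)" (is ?g7)
    "\<And>c. c \<in> carrier (homW_sys A W (Q M) (Q N) n i) \<Longrightarrow> ?d M N i c \<in> W_step.sat A (?E M i) (?D N i)"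
      (is "\<And>c. ?p c \<Longrightarrow> ?q c")
    if M: "M \<in> Obj A" and N: "N \<in> Obj A" and i: "?i0 \<le> i" for M N i
  proof -
    interpret s: W_step A W "?E M i" "?D N i" by (rule step[OF M N])
    note e = ends[OF M, of i] ends[OF N, of i]
    show ?g1 ?g2 ?g3 ?g4 ?g5 ?g6 ?g7 "\<And>c. ?p c \<Longrightarrow> ?q c"
      using comm_group_stable_Hom[OF W s.obs(2,4)] s.comm_group_Ext s.comm_group_satelliteW
        s.deltaW_hom
        s.betaW_hom s.satelliteW_eq s.subgroup_sat[THEN subgroup.subset] s.deltaW_sat i
      by (simp_all add: homW_sys_def extW_sys_def satW_sys_def e)
  qed
  have ext: "interleaved ?i0 (homW_sys A W (Q M) (Q N) n) (extW_sys A (Q M) (Q N) n) (?d M N) (?b M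
      N)"
    if "M \<in> Obj A" "N \<in> Obj A" for M N
    by (rule interleavedI) (use groups[OF that] in simp_all)
  have sat: "interleaved ?i0 (satW_sys A (Q M) (Q N) n) (extW_sys A (Q M) (Q N) n) (\<lambda>i \<xi>. \<xi>) (\<lambda>i. ?d
      M N (Suc i) \<circ> ?b M N i)"
    if ob: "M \<in> Obj A" "N \<in> Obj A" for M N
  proof (rule interleavedI)
    fix i assume i: "?i0 \<le> i"
    note g = groups[OF ob i] and g' = groups[OF ob le_SucI[OF i]]
    show "(\<lambda>\<xi>. \<xi>) \<in> hom (satW_sys A (Q M) (Q N) n i) (extW_sys A (Q M) (Q N) n i)"
      using g(7) by (auto simp: g(6) hom_def)
    have "?d M N (Suc i) \<circ> ?b M N i \<in> hom (extW_sys A (Q M) (Q N) n i) (extW_sys A (Q M) (Q N) n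
        (Suc i))"
      using g(5) g'(4) by (rule hom_compose)
    then show "?d M N (Suc i) \<circ> ?b M N i \<in> hom (extW_sys A (Q M) (Q N) n i) (satW_sys A (Q M) (Q N)
        n (Suc i))"
      using g'(8) g(5) by (auto simp: g'(6) hom_def Pi_iff)
  qed (use groups[OF ob] in simp_all)
  have nat: "(c \<in> carrier (homW_sys A W (Q M) (Q N) n i) \<longrightarrow>
        ?act F F' i c \<in> carrier (homW_sys A W (Q M') (Q N') n i) \<and> ?d M' N' i (?act F F' i c) =
            ?act' F F' i (?d M N i c)) \<and>
      (y \<in> carrier (extW_sys A (Q M) (Q N) n i) \<longrightarrow>
        ?act' F F' i y \<in> carrier (extW_sys A (Q M') (Q N') n i) \<and> ?b M' N' i (?act' F F' i y) = ?act
            F F' (Suc i) (?b M N i y)) \<and>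
      (y \<in> carrier (satW_sys A (Q M) (Q N) n i) \<longrightarrow> ?act' F F' i y \<in> carrier (satW_sys A (Q M') (Q N')
          n i))"
    if ob: "M \<in> Obj A" "N \<in> Obj A" "M' \<in> Obj A" "N' \<in> Obj A"
      and l: "liftW A (Q M') (Q M) f F" "liftW A (Q N) (Q N') g F'" and i: "?i0 \<le> i"
        for M N M' N' f g F F' i c y
  proof -
    have "ext_mor A (?E M' i) (?E M i) (F (shift n (Suc i))) (F (shift n i))"
      using liftW_ext_mor[OF Q[OF ob(3)] Q[OF ob(1)] l(1), of "shift n i"] i
        by (simp add: shift_Suc)
    note k = W_step_natural[OF step[OF ob(1,2)] step[OF ob(3,4)] this liftW_ext_mor[OF Q[OF ob(2)]
        Q[OF ob(4)] l(2)]]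
    note g = groups(6)[OF ob(1,2) i] groups(6)[OF ob(3,4) i]
    note e = ends[OF ob(1), of i] ends[OF ob(2), of i] ends[OF ob(3), of i] ends[OF ob(4), of i]
    show ?thesis
      using k(1)[of c] k(2)[of y] k(3)[of y] i unfolding g
        by (simp add: homW_sys_def extW_sys_def e)
  qed
  note iso1 = natural_iso_interleaved(1)[OF ext, where A = A and lift = "\<lambda>M' M. liftW A (Q M') (Q
      M)" and act = ?act and act' = ?act']
  note iso2 = natural_iso_interleaved(2)[OF sat, where A = A and lift = "\<lambda>M' M. liftW A (Q M') (Q
      M)" and act = ?act' and act' = ?act']
  have "\<exists>\<phi>. natural_iso A (\<lambda>M' M. liftW A (Q M') (Q M)) (Ext_hat A W Q n) (Ext_hat_map A W Q n)
        (colim_extW A W Q n) (colim_extW_map A W Q n) \<phi>"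
    unfolding Ext_hat_def[abs_def] Ext_hat_map_def[abs_def] colim_extW_def[abs_def]
      colim_extW_map_def[abs_def]
      homW_trans_def[abs_def] extW_trans_def[abs_def]
    by (rule exI, rule iso1) (use nat in \<open>blast+\<close>)
  moreover have
      "\<exists>\<psi>. natural_iso A (\<lambda>M' M. liftW A (Q M') (Q M)) (colim_extW A W Q n) (colim_extW_map A W Q n)
        (colim_satW A W Q n) (colim_satW_map A W Q n) \<psi>"
    unfolding colim_satW_def[abs_def] colim_satW_map_def[abs_def] colim_extW_def[abs_def]
      colim_extW_map_def[abs_def]
      extW_trans_def[abs_def] comp_def
    by (rule exI, rule iso2[unfolded comp_def]) (use nat groups(5) in \<open>auto simp: hom_def Pi_iff\<close>)
  ultimately show ?thesis by blast
qed

end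

theorem theorem3p10:
  fixes A :: "('o, 'a) additive_data"
    and V W :: "'o set"
    and R :: "'o \<Rightarrow> ('o, 'a) coresolution"
    and Q :: "'o \<Rightarrow> ('o, 'a) resolution"
    and n :: int
  assumes "abelian_category A"
    and "special_preenveloping A V"
    and "special_precovering A W"
    and "\<And>M. M \<in> Obj A \<Longrightarrow> special_proper_coresolution A V M (R M)"
    and "\<And>M. M \<in> Obj A \<Longrightarrow> special_proper_resolution A W M (Q M)"
  shows "(\<exists>\<phi> \<psi>.
            natural_iso A (\<lambda>M' M. liftV A (R M') (R M))
              (Ext_check A V R n) (Ext_check_map A V R n)
              (colim_extV A V R n) (colim_extV_map A V R n) \<phi> \<and>
            natural_iso A (\<lambda>M' M. liftV A (R M') (R M))
              (colim_extV A V R n) (colim_extV_map A V R n)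
              (colim_satV A V R n) (colim_satV_map A V R n) \<psi>) \<and>
         (\<exists>\<phi> \<psi>.
            natural_iso A (\<lambda>M' M. liftW A (Q M') (Q M))
              (Ext_hat A W Q n) (Ext_hat_map A W Q n)
              (colim_extW A W Q n) (colim_extW_map A W Q n) \<phi> \<and>
            natural_iso A (\<lambda>M' M. liftW A (Q M') (Q M))
              (colim_extW A W Q n) (colim_extW_map A W Q n)
              (colim_satW A W Q n) (colim_satW_map A W Q n) \<psi>)"
  using abelian_category.natural_isos_V[OF assms(1) _ assms(4)]
    abelian_category.natural_isos_W[OF assms(1) _ assms(5)] assms(2,3)
  unfolding special_preenveloping_def special_precovering_def by blast

end
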